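(* Let $X\subset\mathbb R^2$ be a compact subset of positive Lebesgue measure and let $r\ge2$ be a natural number. Then $$ms(X,r)=\begin{cases}\frac1{r^2},&\text{if the group }\operatorname{Iso}(X)\text{ is infinite};\\ ms(\mathcal D_{2n}\times I,r),&\text{if }\operatorname{Iso}(X)\text{ is isomorphic to the dihedral group }\mathcal D_{2n}\text{ for some }n\ge2;\\ 0,&\text{otherwise.}\end{cases}$$
   Context: $\operatorname{Iso}(X)$ is the group of all isometries $f$ of $\mathbb R^2$ with $f(X)=X$. $X$ is endowed with the normalized Lebesgue measure $\mu(A)=\lambda(A)/\lambda(X)$ (an $\operatorname{Iso}(X)$-invariant probability Borel measure). $ms(X,r)$ is the least upper bound of $\varepsilon>0$ such that for every measurable $r$-coloring of $X$ (partition into $r$ measurable color classes) there is a measurable monochromatic subset $A\subset X$ with $\mu(A)\ge\varepsilon$ and $f(A)=A$ for some non-identity $f\in\operatorname{Iso}(X)$. $\mathcal D_{2n}$ is the dihedral group of order $2n$ (the isometry group of a regular $n$-gon; for $n=2$ it is the Klein group $\mathbb Z_2\times\mathbb Z_2$). For a finite group $G$, $G\times I$ (with $I=[0,1]$) is the $G$-space with action $g\cdot(h,t)=(gh,t)$ and product measure of the normalized counting measure on $G$ and Lebesgue measure on $I$; $ms(G\times I,r)$ is the least upper bound of $\varepsilon>0$ such that for every measurable $r$-coloring of $G\times I$ there is a measurable monochromatic subset $A$ of measure $\ge\varepsilon$ with $A=g\cdot A$ for some non-identity $g\in G$. *)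

theory Defs
  imports "HOL-Probability.Probability" "HOL-Algebra.Coset"
begin

text \<open>
  The summand \<open>{0}\<close> fixes the least upper bound to be \<open>0\<close> when no \<open>\<epsilon> > 0\<close> qualifies; the supremum
  of the empty set of reals is not meaningful in HOL. A colouring is a measurable map to the discrete
  space of \<open>r\<close> colours; colour classes may be empty.
\<close>

definition ms :: "'x measure \<Rightarrow> ('g, 'm) monoid_scheme \<Rightarrow> ('g \<Rightarrow> 'x \<Rightarrow> 'x) \<Rightarrow> nat \<Rightarrow> real" where
  "ms M G act r = Sup ({0} \<union> {\<epsilon>. \<epsilon> > 0 \<and>
     (\<forall>col \<in> measurable M (count_space {..<r}).
        \<exists>A \<in> sets M. (\<exists>c<r. \<forall>x\<in>A. col x = c) \<and> measure M A \<ge> \<epsilon> \<and>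
          (\<exists>g \<in> carrier G. g \<noteq> \<one>\<^bsub>G\<^esub> \<and> act g ` A = A))})"

definition Iso :: "'a::metric_space set \<Rightarrow> ('a \<Rightarrow> 'a) monoid" where
  "Iso X = \<lparr>carrier = {f. bij f \<and> (\<forall>x y. dist (f x) (f y) = dist x y) \<and> f ` X = X},
            mult = (\<circ>), one = id\<rparr>"

text \<open>Measurable subsets of \<open>X\<close> are the Borel ones, as \<open>\<mu>\<close> is a Borel measure.\<close>

definition normalized_lebesgue :: "'a::euclidean_space set \<Rightarrow> 'a measure" where
  "normalized_lebesgue X = restrict_space (uniform_measure lborel X) X"

definition ms_set :: "'a::euclidean_space set \<Rightarrow> nat \<Rightarrow> real" where
  "ms_set X r = ms (normalized_lebesgue X) (Iso X) (\<lambda>f x. f x) r"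

definition ms_group_interval :: "('g, 'm) monoid_scheme \<Rightarrow> nat \<Rightarrow> real" where
  "ms_group_interval G r =
     ms (uniform_count_measure (carrier G) \<Otimes>\<^sub>M restrict_space lborel {0..1::real}) G
        (\<lambda>g (h, t). (g \<otimes>\<^bsub>G\<^esub> h, t)) r"

text \<open>
  The dihedral group of order \<open>2n\<close>, for \<open>n \<ge> 1\<close>: the pair \<open>(i, s)\<close> stands for \<open>\<rho>\<^sup>i\<sigma>\<^sup>s\<close>, where
  \<open>\<rho>\<close> is the rotation by \<open>2\<pi>/n\<close> and \<open>\<sigma>\<close> a reflection, so that \<open>\<sigma>\<rho>\<^sup>j = \<rho>\<^sup>-\<^sup>j\<sigma>\<close>.
\<close>

definition dihedral_group :: "nat \<Rightarrow> (int \<times> bool) monoid" where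
  "dihedral_group n =
     \<lparr>carrier = {0..<int n} \<times> UNIV,
      mult = (\<lambda>(i, s) (j, t). ((if s then i - j else i + j) mod int n, s \<noteq> t)),
      one = (0, False)\<rparr>"

lemma group_Iso: "group (Iso X)"
proof (rule groupI)
  fix f assume "f \<in> carrier (Iso X)"
  then have f: "bij f" "\<And>x y. dist (f x) (f y) = dist x y" "f ` X = X"
    by (auto simp: Iso_def)
  have "dist (inv_into UNIV f x) (inv_into UNIV f y) = dist x y" for x y
    using f(2)[of "inv_into UNIV f x" "inv_into UNIV f y"] f(1)
    by (simp add: bij_is_surj surj_f_inv_f)
  moreover have "inv_into UNIV f ` X = X"
    using f(1,3) by (metis bij_is_inj image_inv_f_f)
  ultimately have "inv_into UNIV f \<in> carrier (Iso X)"
    using f(1) by (auto simp: Iso_def bij_imp_bij_inv)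
  moreover have "inv_into UNIV f \<otimes>\<^bsub>Iso X\<^esub> f = \<one>\<^bsub>Iso X\<^esub>"
    using f(1) by (simp add: Iso_def bij_is_inj)
  ultimately show "\<exists>g\<in>carrier (Iso X). g \<otimes>\<^bsub>Iso X\<^esub> f = \<one>\<^bsub>Iso X\<^esub>"
    by blast
next
  fix f g assume "f \<in> carrier (Iso X)" "g \<in> carrier (Iso X)"
  then show "f \<otimes>\<^bsub>Iso X\<^esub> g \<in> carrier (Iso X)"
    by (simp add: Iso_def bij_comp) (metis image_image)
qed (auto simp: Iso_def)

lemma group_dihedral_group:
  assumes "n \<ge> 1"
  shows "group (dihedral_group n)"
proof (rule groupI)
  fix x assume x: "x \<in> carrier (dihedral_group n)"
  obtain i s where "x = (i, s)" by force
  with x assms show "\<exists>y\<in>carrier (dihedral_group n). y \<otimes>\<^bsub>dihedral_group n\<^esub> x = \<one>\<^bsub>dihedral_group n\<^esub>"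
    by (intro bexI [of _ "if s then (i, s) else ((- i) mod int n, s)"])
       (auto simp: dihedral_group_def mod_simps)
qed (use assms in \<open>auto simp: dihedral_group_def mod_simps algebra_simps\<close>)

lemma order_dihedral_group: "order (dihedral_group n) = 2 * n"
  by (simp add: order_def dihedral_group_def card_cartesian_product)

lemma sets_normalized_lebesgue:
  "X \<in> sets borel \<Longrightarrow> sets (normalized_lebesgue X) = {A \<in> sets borel. A \<subseteq> X}"
  by (auto simp: normalized_lebesgue_def sets_restrict_space_iff sets_restrict_space)

lemma measure_normalized_lebesgue:
  assumes "compact X" "A \<in> sets borel" "A \<subseteq> X"
  shows "measure (normalized_lebesgue X) A = measure lborel A / measure lborel X"
proof -
  have X: "X \<in> sets borel" using assms(1) by (simp add: borel_compact)
  have "measure (normalized_lebesgue X) A = measure (uniform_measure lborel X) A"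
    unfolding normalized_lebesgue_def using X assms(3)
    by (intro measure_restrict_space) auto
  also have "\<dots> = measure lborel (X \<inter> A) / measure lborel X"
  proof (cases "emeasure lborel X = 0")
    case True
    then have "emeasure lborel (X \<inter> A) = 0"
      using X assms(2) by (metis emeasure_eq_0 inf_le1 sets_lborel)
    then show ?thesis
      using X assms(2) by (simp add: measure_def emeasure_uniform_measure)
  next
    case False
    then show ?thesis
      using X assms emeasure_compact_finite [OF assms(1)]
      by (intro measure_uniform_measure) auto
  qed
  finally show ?thesis
    using assms(3) by (simp add: Int_absorb1)
qed

end

theory Submission
  imports Defs "HOL-Algebra.Multiplicative_Group"
begin

text \<open>
  All isometries that preserve \<open>X\<close> fix its centroid, so after moving the centroid to \<open>0\<close> in the complex
  plane they have the form \<open>z \<mapsto> u z\<close> or \<open>z \<mapsto> u (cnj z)\<close> with \<open>|u| = 1\<close>.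

  If the group is finite, the largest invariant subset of a colour class is a union of orbits, and
  its size only depends on the joint law of the colours along an orbit. Since \<open>X\<close> is, up to a null
  set, the product of the group with an atomless space, the same laws occur for \<open>X\<close> and for the
  product of the group with the interval. If the group consists of rotations, or of one reflection
  and the identity, a half-plane colouring shows that the value is \<open>0\<close>; otherwise the group is
  dihedral, because its rotations are the \<open>n\<close>-th roots of unity.

  If the group is infinite, compactness makes \<open>X\<close> invariant under all rotations. Averaging over all
  reflections gives the lower bound \<open>1/r\<^sup>2\<close>. For the upper bound one colours by the angle, with
  frequencies that grow rapidly from arc to arc: then the colours of a point and of its image under
  a reflection, or under a rotation by an angle far from \<open>0\<close>, are almost independent. Every
  nontrivial rotation has a power of the latter kind.
\<close>

section \<open>Lacunary colourings of the unit interval\<close>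

text \<open>The infinite case is shaped by uniformity: a single colouring has to defeat every
  isometry of the group. A periodic colouring by the angle fails, because a rotation by one of its
  periods preserves all colours. Very small rotations obstruct any colouring by the angle, since a
  measurable colour class nearly agrees with a copy of itself that is shifted by almost nothing. The
  remedy is that a set invariant under \<open>g\<close> is also invariant under the powers of
  \<open>g\<close>, so only rotations by between a quarter and three quarters of a turn have to be
  treated. These move every arc off itself, so a point and its image see different frequencies. The
  value \<open>1/r^2\<close> then arises twice: as the probability that two independent uniform
  colours both equal a given one, and from \<open>r\<close> integrals of squares that sum to at
  least \<open>1/r\<close>, one of which is at least \<open>1/r^2\<close>. In the dihedral case no
  value is computed: the same positive \<epsilon> qualify for \<open>X\<close> and for the product,
  which makes the suprema equal.\<close>

lemma distr_lborel_isometry_real: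
  fixes s t :: real
  assumes "\<bar>s\<bar> = 1"
  shows "distr lborel borel (\<lambda>x. s * x + t) = lborel"
proof -
  have "lborel = density (distr lborel borel (\<lambda>x. t + s * x)) (\<lambda>_. ennreal \<bar>s\<bar>)"
    using assms by (intro lborel_real_affine) auto
  then show ?thesis using assms by (simp add: density_1 add.commute)
qed

lemma measure_lborel_isometry_real:
  fixes s t :: real
  assumes "\<bar>s\<bar> = 1" and A: "A \<in> sets borel"
  shows "measure lborel {x. s * x + t \<in> A} = measure lborel A"
proof -
  have "measure lborel A = measure (distr lborel borel (\<lambda>x. s * x + t)) A"
    using distr_lborel_isometry_real[OF assms(1)] by simp
  also have "\<dots> = measure lborel {x. s * x + t \<in> A}"
    using A by (subst measure_distr) (auto simp: vimage_def)
  finally show ?thesis by simp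
qed

text \<open>Each period of length \<open>1/q\<close> contains at most one cell of colour
  \<open>i\<close>; it has length \<open>1/(r*q)\<close> and starts at \<open>(k + i/r)/q\<close>.
  The periods that meet \<open>{u..v}\<close> are numbered from the floor of \<open>q*u\<close> to
  the floor of \<open>q*v\<close>, which accounts for the \<open>+ 2\<close>.\<close>

lemma frac_cell_cover:
  fixes u v q :: real and r i :: nat
  assumes "u \<le> v" "q > 0" "r \<ge> 1"
  obtains K :: "int set" and l :: "int \<Rightarrow> real"
  where "finite K" "real (card K) \<le> q * (v - u) + 2"
    "{x\<in>{u..v}. \<lfloor>real r * frac (q * x)\<rfloor> = int i} \<subseteq> (\<Union>k\<in>K. {l k..l k + 1 / (r * q)})"
proof -
  define K where "K = {\<lfloor>q * u\<rfloor>..\<lfloor>q * v\<rfloor>}"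
  define l where "l k = (real_of_int k + i / r) / q" for k
  have "q * u \<le> q * v" using assms by simp
  then have "\<lfloor>q * u\<rfloor> \<le> \<lfloor>q * v\<rfloor>" by (rule floor_mono)
  then have "real (card K) = real_of_int (\<lfloor>q * v\<rfloor> - \<lfloor>q * u\<rfloor> + 1)"
    by (simp add: K_def)
  then have card: "real (card K) \<le> q * (v - u) + 2" by (simp add: algebra_simps) linarith
  have "{x\<in>{u..v}. \<lfloor>real r * frac (q * x)\<rfloor> = int i} \<subseteq> (\<Union>k\<in>K. {l k..l k + 1 / (r * q)})"
  proof safe
    fix x assume x: "x \<in> {u..v}" "\<lfloor>real r * frac (q * x)\<rfloor> = int i"
    have "\<lfloor>q * x\<rfloor> \<in> K" using x assms by (auto simp: K_def intro!: floor_mono)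
    moreover have "real i \<le> r * frac (q * x)" "r * frac (q * x) < i + 1"
      using x(2) by linarith+
    then have "i / r \<le> frac (q * x)" "frac (q * x) \<le> (i + 1) / r"
      using assms by (auto simp: field_simps)
    then have "x \<in> {l \<lfloor>q * x\<rfloor>..l \<lfloor>q * x\<rfloor> + 1 / (r * q)}"
      using assms by (auto simp: l_def frac_def field_simps)
    ultimately show "x \<in> (\<Union>k\<in>K. {l k..l k + 1 / (r * q)})" by blast
  qed
  then show ?thesis using card by (intro that[of K l]) (auto simp: K_def)
qed

text \<open>The colour of frequency \<open>q\<close> occupies at most a share \<open>1/r\<close> of
  every full period; the term \<open>2 / q\<close> pays for the incomplete periods at the two
  ends.\<close>

lemma fast_interval:
  fixes u v q :: real and r i :: nat
  assumes "u \<le> v" "q > 0" "r \<ge> 1"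
  shows "measure lborel {x\<in>{u..v}. \<lfloor>real r * frac (q * x)\<rfloor> = int i} \<le> (v - u) / r + 2 / q"
    (is "measure lborel ?S \<le> _")
proof -
  obtain K :: "int set" and l where K: "finite K" "real (card K) \<le> q * (v - u) + 2"
    and sub: "?S \<subseteq> (\<Union>k\<in>K. {l k..l k + 1 / (r * q)})"
    using frac_cell_cover[OF assms, of i] .
  have "measure lborel ?S \<le> measure lborel (\<Union>k\<in>K. {l k..l k + 1 / (r * q)})"
    using sub K by (intro measure_mono_fmeasurable fmeasurable.finite_UN)
      (auto simp: frac_def fmeasurable_compact)
  also have "\<dots> \<le> (\<Sum>k\<in>K. measure lborel {l k..l k + 1 / (r * q)})"
    using K by (intro measure_UNION_le) auto
  also have "\<dots> = card K / (r * q)" using assms by simp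
  also have "\<dots> \<le> (q * (v - u) + 2) / (r * q)"
    using assms K by (intro divide_right_mono) auto
  also have "\<dots> = (v - u) / r + 2 / (r * q)" using assms by (simp add: field_simps)
  also have "2 / (r * q) \<le> 2 / q" using assms by (intro divide_left_mono) auto
  finally show ?thesis by linarith
qed

lemma fast_interval_isometry:
  fixes u v q s t :: real and r i :: nat
  assumes "u \<le> v" "q > 0" "r \<ge> 1" "\<bar>s\<bar> = 1"
  shows "measure lborel {x\<in>{u..v}. \<lfloor>real r * frac (q * (s * x + t))\<rfloor> = int i} \<le> (v - u) / r + 2 / q"
proof -
  define u' v' where "u' = min (s * u + t) (s * v + t)" and "v' = max (s * u + t) (s * v + t)"
  have s: "s = 1 \<or> s = -1" using assms by auto
  have uv: "u' \<le> v'" "v' - u' = v - u" using s assms by (auto simp: u'_def v'_def)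
  have "{x\<in>{u..v}. \<lfloor>real r * frac (q * (s * x + t))\<rfloor> = int i} =
     {x. s * x + t \<in> {y\<in>{u'..v'}. \<lfloor>real r * frac (q * y)\<rfloor> = int i}}"
    using s assms by (auto simp: u'_def v'_def)
  also have "measure lborel \<dots> = measure lborel {y\<in>{u'..v'}. \<lfloor>real r * frac (q * y)\<rfloor> = int i}"
    using assms by (intro measure_lborel_isometry_real) (auto simp: frac_def)
  also have "\<dots> \<le> (v' - u') / r + 2 / q" using uv assms by (intro fast_interval)
  finally show ?thesis using uv by simp
qed

text \<open>This is where independence comes from. The colour of frequency \<open>p\<close> is
  constant on cells of length \<open>1/(r*p)\<close>, and within each cell the colour of frequency
  \<open>q\<close> equals \<open>i\<close> on a share of about \<open>1/r\<close>. The surplus cells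
  at the ends cost at most \<open>2 / p\<close>, and the errors \<open>2 / q\<close> of at most
  \<open>p * (v - u) + 2 \<le> 3 * p\<close> cells cost at most \<open>6 * p / q\<close>.\<close>

lemma slow_fast_interval:
  fixes u v p q s t :: real and r i :: nat
  assumes "u \<le> v" "v - u \<le> 1" "p \<ge> 1" "q > 0" "r \<ge> 1" "\<bar>s\<bar> = 1"
  shows "measure lborel {x\<in>{u..v}. \<lfloor>real r * frac (p * x)\<rfloor> = int i \<and>
           \<lfloor>real r * frac (q * (s * x + t))\<rfloor> = int i} \<le> (v - u) / r\<^sup>2 + 2 / p + 6 * p / q"
    (is "measure lborel ?S \<le> _")
proof -
  obtain K :: "int set" and l where K: "finite K" "real (card K) \<le> p * (v - u) + 2"
    and cover: "{x\<in>{u..v}. \<lfloor>real r * frac (p * x)\<rfloor> = int i} \<subseteq> (\<Union>k\<in>K. {l k..l k + 1 / (r * p)})"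
  proof -
    have "p > 0" using assms by simp
    from frac_cell_cover[OF assms(1) this assms(5), of i] that show ?thesis by blast
  qed
  define D where "D k = {x\<in>{l k..l k + 1 / (r * p)}. \<lfloor>real r * frac (q * (s * x + t))\<rfloor> = int i}" for k
  have sub: "?S \<subseteq> (\<Union>k\<in>K. D k)" using cover unfolding D_def by blast
  have D: "measure lborel (D k) \<le> 1 / (r * p) / r + 2 / q" for k
    using fast_interval_isometry[of "l k" "l k + 1 / (r * p)" q r s t i] assms
    by (simp add: D_def)
  have Df: "D k \<in> fmeasurable lborel" for k
    unfolding D_def
    by (rule fmeasurableI2[of "{l k..l k + 1 / (r * p)}"]) (auto simp: frac_def fmeasurable_compact)
  have "measure lborel ?S \<le> measure lborel (\<Union>k\<in>K. D k)"
    using sub Df K by (intro measure_mono_fmeasurable fmeasurable.finite_UN) (auto simp: frac_def)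
  also have "\<dots> \<le> (\<Sum>k\<in>K. measure lborel (D k))"
    using K by (intro measure_UNION_le) (auto simp: D_def frac_def)
  also have "\<dots> \<le> (\<Sum>k\<in>K. 1 / (r * p) / r + 2 / q)" by (intro sum_mono D)
  also have "\<dots> = card K * (1 / (r * p) / r + 2 / q)" by simp
  also have "\<dots> \<le> (p * (v - u) + 2) * (1 / (r * p) / r + 2 / q)"
    using K assms by (intro mult_right_mono) auto
  also have "\<dots> = (v - u) / r\<^sup>2 + 2 / (r\<^sup>2 * p) + 2 * (p * (v - u) + 2) / q"
    using assms by (simp add: field_simps power2_eq_square)
  also have "\<dots> \<le> (v - u) / r\<^sup>2 + 2 / p + 6 * p / q"
  proof -
    have "2 / (r\<^sup>2 * p) \<le> 2 / p" using assms by (intro divide_left_mono) auto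
    moreover have "2 * (p * (v - u) + 2) / q \<le> 6 * p / q"
    proof (rule divide_right_mono)
      define w where "w = p * (v - u)"
      have "w \<le> p * 1" unfolding w_def using assms by (intro mult_left_mono) auto
      then show "2 * (p * (v - u) + 2) \<le> 6 * p" unfolding w_def[symmetric] using assms by simp
    qed (use assms in auto)
    ultimately show ?thesis by linarith
  qed
  finally show ?thesis .
qed

text \<open>The overlap of an interval of the grid with the preimage of another one may or may not
  contain its end points. Its closed hull has the same length, so the estimates for
  \<open>{u..v}\<close> apply to it.\<close>

lemma interval_hull:
  fixes S :: "real set"
  assumes "is_interval S" "bounded S" "S \<noteq> {}"
  shows "\<exists>u v. u \<le> v \<and> S \<subseteq> {u..v} \<and> measure lborel S = v - u"
proof (intro exI conjI)
  have bdd: "bdd_above S" "bdd_below S"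
    using assms by (simp_all add: bounded_imp_bdd_above bounded_imp_bdd_below)
  show le: "Inf S \<le> Sup S" using bdd assms by (simp add: cInf_le_cSup)
  show sub: "S \<subseteq> {Inf S..Sup S}" using bdd by (auto intro: cInf_lower cSup_upper)
  have sup: "{Inf S<..<Sup S} \<subseteq> S"
  proof
    fix x assume "x \<in> {Inf S<..<Sup S}"
    then obtain y z where "y \<in> S" "y < x" "z \<in> S" "x < z"
      using assms bdd by (auto simp: cInf_less_iff less_cSup_iff)
    then show "x \<in> S" using mem_is_interval_1_I[OF assms(1), of y z x] by simp
  qed
  have Sb: "S \<in> sets borel" using assms(1) by (simp add: real_interval_borel_measurable)
  have "measure lborel S \<le> measure lborel {Inf S..Sup S}"
    using sub Sb by (intro measure_mono_fmeasurable) (auto simp: fmeasurable_compact)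
  moreover have "measure lborel {Inf S<..<Sup S} \<le> measure lborel S"
    using sup Sb sub by (intro measure_mono_fmeasurable fmeasurableI2[of "{Inf S..Sup S}" lborel S])
       (auto simp: fmeasurable_compact)
  ultimately show "measure lborel S = Sup S - Inf S" using le by simp
qed

text \<open>On the overlap \<open>p = Q ^ (a + 1)\<close> is the slow frequency and
  \<open>q = Q ^ (b + 1)\<close> the fast one. The exponent starts at \<open>1\<close>, so that
  \<open>2 / p \<le> 2 / Q\<close> even for \<open>a = 0\<close>; the quotient of the frequencies
  gives \<open>6 * p / q \<le> 6 / Q\<close>. Together this is \<open>8 / Q\<close>.\<close>

lemma lacunary_pair_aux:
  fixes s t :: real and r i M Q a b :: nat
  assumes "r \<ge> 1" "M \<ge> 1" "Q \<ge> 1" "\<bar>s\<bar> = 1" "a < b"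
  shows "measure lborel {x. \<lfloor>real M * x\<rfloor> = int a \<and> \<lfloor>real M * (s * x + t)\<rfloor> = int b \<and>
       \<lfloor>real r * frac (real Q ^ (a + 1) * x)\<rfloor> = int i \<and>
       \<lfloor>real r * frac (real Q ^ (b + 1) * (s * x + t))\<rfloor> = int i}
     \<le> measure lborel {x. \<lfloor>real M * x\<rfloor> = int a \<and> \<lfloor>real M * (s * x + t)\<rfloor> = int b} / r\<^sup>2 + 8 / Q"
    (is "measure lborel ?R \<le> measure lborel ?S / _ + _")
proof (cases "?S = {}")
  case True
  then have "?R = {}" by blast
  then show ?thesis by (simp only: True) simp
next
  case False
  have s: "s = 1 \<or> s = -1" using assms by auto
  have int: "is_interval {x. \<lfloor>real M * x\<rfloor> = int c}" for c
    unfolding is_interval_1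
  proof (intro ballI allI impI)
    fix x y z assume *: "x \<in> {x. \<lfloor>real M * x\<rfloor> = int c}" "y \<in> {x. \<lfloor>real M * x\<rfloor> = int c}" "x \<le> z \<and> z \<le> y"
    then have "real M * x \<le> M * z" "M * z \<le> M * y" by (simp_all add: mult_left_mono)
    then have "\<lfloor>M * x\<rfloor> \<le> \<lfloor>M * z\<rfloor>" "\<lfloor>M * z\<rfloor> \<le> \<lfloor>M * y\<rfloor>" by (simp_all add: floor_mono)
    with * show "z \<in> {x. \<lfloor>real M * x\<rfloor> = int c}" by simp
  qed
  have S: "?S = {x. \<lfloor>real M * x\<rfloor> = int a} \<inter> {x. s * x + t \<in> {x. \<lfloor>real M * x\<rfloor> = int b}}" by auto
  have "is_interval {x. s * x + t \<in> {x. \<lfloor>real M * x\<rfloor> = int b}}"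
    using s
  proof
    assume s: "s = 1"
    show ?thesis unfolding is_interval_1
    proof (intro ballI allI impI)
      fix x y z assume "x \<in> {x. s * x + t \<in> {x. \<lfloor>real M * x\<rfloor> = int b}}"
        "y \<in> {x. s * x + t \<in> {x. \<lfloor>real M * x\<rfloor> = int b}}" "x \<le> z \<and> z \<le> y"
      then show "z \<in> {x. s * x + t \<in> {x. \<lfloor>real M * x\<rfloor> = int b}}"
        using int[of b, unfolded is_interval_1, rule_format, of "x + t" "y + t" "z + t"] s by simp
    qed
  next
    assume s: "s = -1"
    show ?thesis unfolding is_interval_1
    proof (intro ballI allI impI)
      fix x y z assume "x \<in> {x. s * x + t \<in> {x. \<lfloor>real M * x\<rfloor> = int b}}"
        "y \<in> {x. s * x + t \<in> {x. \<lfloor>real M * x\<rfloor> = int b}}" "x \<le> z \<and> z \<le> y"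
      then show "z \<in> {x. s * x + t \<in> {x. \<lfloor>real M * x\<rfloor> = int b}}"
        using int[of b, unfolded is_interval_1, rule_format, of "t - y" "t - x" "t - z"] s by simp
    qed
  qed
  then have 1: "is_interval ?S" unfolding S by (intro is_interval_Int int)
  have sub: "?S \<subseteq> {a / M..(a + 1) / M}"
  proof
    fix x assume "x \<in> ?S"
    then have "a \<le> M * x" "M * x \<le> a + 1" by (auto) linarith+
    then show "x \<in> {a / M..(a + 1) / M}" using assms by (auto simp: field_simps)
  qed
  then have 2: "bounded ?S" using bounded_closed_interval bounded_subset by blast
  obtain u v where uv: "u \<le> v" "?S \<subseteq> {u..v}" "measure lborel ?S = v - u"
    using interval_hull[OF 1 2 False] by blast
  have "measure lborel ?S \<le> measure lborel {a / M..(a + 1) / M}"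
    using sub by (intro measure_mono_fmeasurable) (auto simp: fmeasurable_compact)
  also have "\<dots> \<le> 1" using assms by (simp add: field_simps)
  finally have uv1: "v - u \<le> 1" using uv by simp
  have "measure lborel ?R \<le> measure lborel {x\<in>{u..v}. \<lfloor>real r * frac (real Q ^ (a + 1) * x)\<rfloor> = int i \<and>
           \<lfloor>real r * frac (real Q ^ (b + 1) * (s * x + t))\<rfloor> = int i}"
    using uv by (intro measure_mono_fmeasurable fmeasurableI2[of "{u..v}" lborel "{x\<in>{u..v}. _ x}"])
      (auto simp: fmeasurable_compact frac_def)
  also have "\<dots> \<le> (v - u) / r\<^sup>2 + 2 / real Q ^ (a + 1) + 6 * real Q ^ (a + 1) / real Q ^ (b + 1)"
    using assms uv uv1 by (intro slow_fast_interval) (auto simp: one_le_power simp del: power_Suc)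
  also have "\<dots> \<le> (v - u) / r\<^sup>2 + 8 / Q"
  proof -
    have Q: "real Q \<ge> 1" using assms by simp
    have "real Q * 1 \<le> real Q * real Q ^ a" using Q by (intro mult_left_mono one_le_power) auto
    then have "2 / real Q ^ (a + 1) \<le> 2 / Q" using Q by (intro divide_left_mono) auto
    moreover have "6 * real Q ^ (a + 1) / real Q ^ (b + 1) \<le> 6 / Q"
    proof -
      have "real Q ^ (a + 2) \<le> real Q ^ (b + 1)" using Q assms by (intro power_increasing) auto
      then have "real Q ^ (a + 1) * Q \<le> real Q ^ (b + 1)" by (simp add: mult_ac)
      then show ?thesis using Q by (simp add: field_simps del: power_Suc)
    qed
    ultimately show ?thesis by linarith
  qed
  finally show ?thesis using uv by simp
qed

text \<open>The order of \<open>a\<close> and \<open>b\<close> decides which colour is the slow one.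
  For \<open>b < a\<close> the substitution \<open>y = s * x + t\<close>, whose inverse is
  \<open>y \<mapsto> s * y - s * t\<close> because \<open>s * s = 1\<close>, exchanges the
  two.\<close>

lemma lacunary_pair:
  fixes s t :: real and r i M Q a b :: nat
  assumes "r \<ge> 1" "M \<ge> 1" "Q \<ge> 1" "\<bar>s\<bar> = 1" "a \<noteq> b"
  shows "measure lborel {x. \<lfloor>real M * x\<rfloor> = int a \<and> \<lfloor>real M * (s * x + t)\<rfloor> = int b \<and>
       \<lfloor>real r * frac (real Q ^ (a + 1) * x)\<rfloor> = int i \<and>
       \<lfloor>real r * frac (real Q ^ (b + 1) * (s * x + t))\<rfloor> = int i}
     \<le> measure lborel {x. \<lfloor>real M * x\<rfloor> = int a \<and> \<lfloor>real M * (s * x + t)\<rfloor> = int b} / r\<^sup>2 + 8 / Q"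
    (is "measure lborel ?R \<le> measure lborel ?S / _ + _")
proof (cases "a < b")
  case True
  with assms show ?thesis by (intro lacunary_pair_aux)
next
  case False
  then have "b < a" using assms by simp
  have s: "s = 1 \<or> s = -1" using assms by auto
  then have inv: "s * (s * x + t) + - (s * t) = x" for x by (auto simp: algebra_simps)
  let ?R' = "{y. \<lfloor>real M * y\<rfloor> = int b \<and> \<lfloor>real M * (s * y + - (s * t))\<rfloor> = int a \<and>
       \<lfloor>real r * frac (real Q ^ (b + 1) * y)\<rfloor> = int i \<and>
       \<lfloor>real r * frac (real Q ^ (a + 1) * (s * y + - (s * t)))\<rfloor> = int i}"
  let ?S' = "{y. \<lfloor>real M * y\<rfloor> = int b \<and> \<lfloor>real M * (s * y + - (s * t))\<rfloor> = int a}"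
  have R'b: "?R' \<in> sets borel" unfolding frac_def by measurable
  have S'b: "?S' \<in> sets borel" by measurable
  have "?R = {x. s * x + t \<in> ?R'}" by (simp only: mem_Collect_eq inv) blast
  then have R: "measure lborel ?R = measure lborel ?R'"
    using measure_lborel_isometry_real[OF assms(4) R'b, of t] by (simp only:)
  have "?S = {x. s * x + t \<in> ?S'}" by (simp only: mem_Collect_eq inv) blast
  then have S: "measure lborel ?S = measure lborel ?S'"
    using measure_lborel_isometry_real[OF assms(4) S'b, of t] by (simp only:)
  show ?thesis unfolding R S using assms \<open>b < a\<close> by (intro lacunary_pair_aux)
qed

text \<open>
  On the \<open>a\<close>-th of \<open>M\<close> intervals the colour oscillates with frequency \<open>Q ^ (a + 1)\<close>. Where two different
  intervals overlap after an isometry, one colour is constant on pieces on which the other one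
  equidistributes.
\<close>

definition lacunary_colour :: "nat \<Rightarrow> nat \<Rightarrow> nat \<Rightarrow> real \<Rightarrow> nat" where
  "lacunary_colour r M Q x = nat \<lfloor>real r * frac (real Q ^ (nat \<lfloor>real M * x\<rfloor> + 1) * x)\<rfloor>"

lemma measurable_lacunary_colour [measurable]:
  "lacunary_colour r M Q \<in> measurable borel (count_space UNIV)"
  unfolding lacunary_colour_def frac_def by measurable

lemma lacunary_colour_less: "r \<ge> 1 \<Longrightarrow> lacunary_colour r M Q x < r"
  using frac_lt_1[of "real Q ^ (nat \<lfloor>real M * x\<rfloor> + 1) * x"]
  by (simp add: lacunary_colour_def nat_less_iff floor_less_iff)

text \<open>A point and its image in the same interval see the same frequency; there the
  independence argument gives nothing and the whole overlap is counted. A reflection has its centre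
  at \<open>t / 2\<close>, and an interval that meets its mirror image contains the centre, so one
  value of \<open>a\<close> remains. A shift by at least \<open>1 / 4 \<ge> 1 / M\<close> moves each
  interval off itself.\<close>

lemma lacunary_diagonal:
  fixes s t :: real and M :: nat
  assumes "M \<ge> 4" "s = -1 \<or> s = 1 \<and> \<bar>t\<bar> \<ge> 1 / 4"
  shows "(\<Sum>a<M. measure lborel {x. \<lfloor>real M * x\<rfloor> = int a \<and> \<lfloor>real M * (s * x + t)\<rfloor> = int a}) \<le> 1 / M"
    (is "(\<Sum>a<M. measure lborel (?S a)) \<le> _")
  using assms(2)
proof
  assume s: "s = -1"
  have le: "measure lborel (?S a) \<le> (if a = nat \<lfloor>M * t / 2\<rfloor> then 1 / M else 0)" for a
  proof (cases "a = nat \<lfloor>M * t / 2\<rfloor>")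
    case True
    have "?S a \<subseteq> {a / M..(a + 1) / M}"
    proof
      fix x assume "x \<in> ?S a"
      then have "a \<le> M * x" "M * x \<le> a + 1" by (auto) linarith+
      then show "x \<in> {a / M..(a + 1) / M}" using assms by (auto simp: field_simps)
    qed
    then have "measure lborel (?S a) \<le> measure lborel {a / M..(a + 1) / M}"
      by (intro measure_mono_fmeasurable) (auto simp: fmeasurable_compact)
    also have "\<dots> = 1 / M" using assms by (simp add: field_simps)
    finally show ?thesis using True by simp
  next
    case False
    have "?S a = {}"
    proof safe
      fix x assume *: "\<lfloor>real M * x\<rfloor> = int a" "\<lfloor>real M * (s * x + t)\<rfloor> = int a"
      define y where "y = M * x"
      have "\<lfloor>y\<rfloor> = int a" "\<lfloor>M * t - y\<rfloor> = int a" using * s by (auto simp: y_def algebra_simps)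
      then have "\<lfloor>M * t / 2\<rfloor> = int a" by linarith
      with False show "x \<in> {}" by simp
    qed
    then show ?thesis using False by (simp only: if_False measure_empty)
  qed
  have "(\<Sum>a<M. measure lborel (?S a)) \<le> (\<Sum>a<M. if a = nat \<lfloor>M * t / 2\<rfloor> then 1 / M else 0)"
    by (intro sum_mono le)
  also have "\<dots> \<le> 1 / M" by (simp add: sum.delta)
  finally show ?thesis .
next
  assume s: "s = 1 \<and> \<bar>t\<bar> \<ge> 1 / 4"
  have "?S a = {}" for a
  proof safe
    fix x assume *: "\<lfloor>real M * x\<rfloor> = int a" "\<lfloor>real M * (s * x + t)\<rfloor> = int a"
    have "1 \<le> M * \<bar>t\<bar>" using mult_mono[of 4 "real M" "1/4" "\<bar>t\<bar>"] s assms by simp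
    then have "1 \<le> \<bar>M * t\<bar>" by (simp add: abs_mult)
    moreover have "\<lfloor>M * x + M * t\<rfloor> = int a" using * s by (auto simp: algebra_simps)
    ultimately show "x \<in> {}" using *(1) by linarith
  qed
  then show ?thesis by (simp only: measure_empty) simp
qed

text \<open>Off the diagonal at most \<open>M\<^sup>2\<close> pairs contribute an error
  \<open>8 / Q\<close> each, while their main terms belong to disjoint pieces of the common domain
  and add up to at most its measure over \<open>r\<^sup>2\<close>. The diagonal pairs cost
  \<open>1 / M\<close>.\<close>

lemma lacunary_bound:
  fixes s t :: real and r i M Q :: nat
  assumes "r \<ge> 1" "M \<ge> 4" "Q \<ge> 1" "s = -1 \<or> s = 1 \<and> \<bar>t\<bar> \<ge> 1 / 4"
  shows "measure lborel {x\<in>{0..<1}. s * x + t \<in> {0..<1} \<and> lacunary_colour r M Q x = i \<and>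
            lacunary_colour r M Q (s * x + t) = i}
     \<le> measure lborel {x\<in>{0..<1}. s * x + t \<in> {0..<1}} / r\<^sup>2 + 8 * M\<^sup>2 / Q + 1 / M"
    (is "measure lborel ?A \<le> measure lborel ?T / _ + _ + _")
proof -
  define S where "S = (\<lambda>(a, b). {x. \<lfloor>real M * x\<rfloor> = int a \<and> \<lfloor>real M * (s * x + t)\<rfloor> = int b})"
  define R where "R = (\<lambda>(a, b). {x. \<lfloor>real M * x\<rfloor> = int a \<and> \<lfloor>real M * (s * x + t)\<rfloor> = int b \<and>
       \<lfloor>real r * frac (real Q ^ (a + 1) * x)\<rfloor> = int i \<and>
       \<lfloor>real r * frac (real Q ^ (b + 1) * (s * x + t))\<rfloor> = int i})"
  define P where "P = {(a, b). a < M \<and> b < M \<and> a \<noteq> b}"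
  define D where "D = (\<lambda>a. (a, a)) ` {..<M}"
  have PD: "P \<union> D = {..<M} \<times> {..<M}" by (auto simp: P_def D_def)
  have fin: "finite P" "finite D" using PD finite_Un[of P D] by auto
  have M0: "M > 0" using assms by simp
  have s1: "\<bar>s\<bar> = 1" using assms by auto
  have sub: "S k \<subseteq> ?T" if "k \<in> {..<M} \<times> {..<M}" for k
  proof -
    have *: "x \<in> {0..<1}" if "\<lfloor>real M * x\<rfloor> = int a" "a < M" for x a
    proof -
      have "0 \<le> M * x" "M * x < M" using that by linarith+
      then show ?thesis using M0 by (auto simp: zero_le_mult_iff)
    qed
    show ?thesis using that * by (auto simp: S_def)
  qed
  have Tf: "?T \<in> fmeasurable lborel"
    by (rule fmeasurableI2[of "{0..1}"]) (auto simp: fmeasurable_compact)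
  have Sb: "S k \<in> sets borel" "R k \<in> sets borel" for k
    by (cases k, auto simp: S_def R_def frac_def)+
  have Sf: "S k \<in> fmeasurable lborel" if "k \<in> {..<M} \<times> {..<M}" for k
    using fmeasurableI2[OF Tf sub[OF that]] Sb by simp
  have RS: "R k \<subseteq> S k" for k by (auto simp: R_def S_def)
  have Rf: "R k \<in> fmeasurable lborel" if "k \<in> {..<M} \<times> {..<M}" for k
    using fmeasurableI2[OF Sf[OF that] RS] Sb by simp
  have nat_floor: "\<exists>a<M. \<lfloor>real M * x\<rfloor> = int a" if "x \<in> {0..<1}" for x
  proof -
    have "0 \<le> M * x" "M * x < M" using that M0 by auto
    then show ?thesis by (intro exI[of _ "nat \<lfloor>M * x\<rfloor>"]) (auto simp: nat_less_iff floor_less_iff)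
  qed
  have Asub: "?A \<subseteq> (\<Union>k\<in>{..<M} \<times> {..<M}. R k)"
  proof
    fix x assume x: "x \<in> ?A"
    then obtain a b where ab: "a < M" "\<lfloor>real M * x\<rfloor> = int a" "b < M" "\<lfloor>real M * (s * x + t)\<rfloor> = int b"
      using nat_floor[of x] nat_floor[of "s * x + t"] by blast
    have "lacunary_colour r M Q x = i" "lacunary_colour r M Q (s * x + t) = i" using x by auto
    moreover have "0 \<le> \<lfloor>real r * frac y\<rfloor>" for y by simp
    ultimately have "\<lfloor>real r * frac (real Q ^ (a + 1) * x)\<rfloor> = int i"
      "\<lfloor>real r * frac (real Q ^ (b + 1) * (s * x + t))\<rfloor> = int i"
      unfolding lacunary_colour_def ab(2,4) nat_int by (metis int_nat_eq)+
    then have "x \<in> R (a, b)" using ab by (simp add: R_def)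
    then show "x \<in> (\<Union>k\<in>{..<M} \<times> {..<M}. R k)" using ab by blast
  qed
  have "measure lborel ?A \<le> measure lborel (\<Union>k\<in>{..<M} \<times> {..<M}. R k)"
    using Asub Rf by (intro measure_mono_fmeasurable fmeasurable.finite_UN) auto
  also have "\<dots> \<le> (\<Sum>k\<in>{..<M} \<times> {..<M}. measure lborel (R k))"
    using Sb by (intro measure_UNION_le) auto
  also have "\<dots> = (\<Sum>k\<in>P. measure lborel (R k)) + (\<Sum>k\<in>D. measure lborel (R k))"
    unfolding PD[symmetric] using fin by (intro sum.union_disjoint) (auto simp: P_def D_def)
  finally have A: "measure lborel ?A \<le> (\<Sum>k\<in>P. measure lborel (R k)) + (\<Sum>k\<in>D. measure lborel (R k))" .
  have PM: "k \<in> {..<M} \<times> {..<M}" if "k \<in> P \<or> k \<in> D" for k using that PD by blast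
  have disj: "pairwise (\<lambda>j k. disjnt (S j) (S k)) P"
    unfolding pairwise_def disjnt_def by (auto simp: S_def)
  have "(\<Sum>k\<in>P. measure lborel (R k)) \<le> (\<Sum>k\<in>P. measure lborel (S k) / r\<^sup>2 + 8 / Q)"
  proof (rule sum_mono)
    fix k assume "k \<in> P"
    then show "measure lborel (R k) \<le> measure lborel (S k) / r\<^sup>2 + 8 / Q"
      using lacunary_pair[of r M Q s "fst k" "snd k" t i] assms s1
      by (cases k) (simp add: P_def R_def S_def)
  qed
  also have "\<dots> = (\<Sum>k\<in>P. measure lborel (S k)) / r\<^sup>2 + card P * (8 / Q)"
    by (simp add: sum.distrib sum_divide_distrib)
  also have "\<dots> \<le> measure lborel ?T / r\<^sup>2 + M\<^sup>2 * (8 / Q)"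
  proof (intro add_mono divide_right_mono mult_right_mono)
    have "(\<Sum>k\<in>P. measure lborel (S k)) = measure lborel (\<Union>k\<in>P. S k)"
      using fin disj Sf PM by (intro measure_UNION'[symmetric]) blast+
    also have "\<dots> \<le> measure lborel ?T"
    proof (rule measure_mono_fmeasurable)
      show "(\<Union>k\<in>P. S k) \<subseteq> ?T" using sub PM by blast
      show "(\<Union>k\<in>P. S k) \<in> sets lborel" using Sb fin by (intro sets.finite_UN) auto
    qed (rule Tf)
    finally show "(\<Sum>k\<in>P. measure lborel (S k)) \<le> measure lborel ?T" .
    have "card P \<le> card ({..<M} \<times> {..<M})" using PM by (intro card_mono) auto
    then show "real (card P) \<le> real (M\<^sup>2)"
      by (simp only: of_nat_le_iff) (simp add: card_cartesian_product power2_eq_square)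
  qed auto
  finally have P: "(\<Sum>k\<in>P. measure lborel (R k)) \<le> measure lborel ?T / r\<^sup>2 + M\<^sup>2 * (8 / Q)" .
  have "(\<Sum>k\<in>D. measure lborel (R k)) \<le> (\<Sum>k\<in>D. measure lborel (S k))"
    using RS Sf PM Sb by (intro sum_mono measure_mono_fmeasurable) (blast, simp, blast)
  also have "\<dots> = (\<Sum>a<M. measure lborel (S (a, a)))"
    unfolding D_def by (subst sum.reindex) (auto simp: inj_on_def)
  also have "\<dots> \<le> 1 / M" using lacunary_diagonal[of M s t] assms by (simp add: S_def)
  finally have "(\<Sum>k\<in>D. measure lborel (R k)) \<le> 1 / M" .
  with A P have "measure lborel ?A \<le> measure lborel ?T / r\<^sup>2 + M\<^sup>2 * (8 / Q) + 1 / M" by linarith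
  then show ?thesis by (simp add: mult.commute)
qed

text \<open>The error terms are free of \<open>s\<close> and \<open>t\<close>, so one colouring
  serves all these isometries. \<open>M\<close> is fixed before \<open>Q\<close>, since the bound
  contains \<open>8 * M\<^sup>2 / Q\<close>.\<close>

lemma lacunary_colouring:
  fixes r :: nat and \<delta> :: real
  assumes "r \<ge> 1" "\<delta> > 0"
  obtains c :: "real \<Rightarrow> nat" where "c \<in> measurable borel (count_space UNIV)" "\<And>x. c x < r"
    "\<And>s t i. s = -1 \<or> s = 1 \<and> \<bar>t\<bar> \<ge> 1 / 4 \<Longrightarrow>
        measure lborel {x\<in>{0..<1}. s * x + t \<in> {0..<1} \<and> c x = i \<and> c (s * x + t) = i}
        \<le> measure lborel {x\<in>{0..<1}. s * x + t \<in> {0..<1}} / r\<^sup>2 + \<delta>"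
proof -
  obtain M0 :: nat where M0: "2 / \<delta> < M0" using reals_Archimedean2 by blast
  define M where "M = max 4 M0"
  have M: "M \<ge> 4" "1 / M \<le> \<delta> / 2"
  proof -
    have "2 / \<delta> \<le> M" using M0 by (simp add: M_def)
    then show "1 / M \<le> \<delta> / 2" using assms by (simp add: field_simps M_def)
  qed (simp add: M_def)
  obtain Q0 :: nat where Q0: "16 * M\<^sup>2 / \<delta> < Q0" using reals_Archimedean2 by blast
  define Q where "Q = max 1 Q0"
  have Q: "Q \<ge> 1" "8 * M\<^sup>2 / Q \<le> \<delta> / 2"
  proof -
    have "16 * M\<^sup>2 / \<delta> \<le> Q" using Q0 by (simp add: Q_def)
    then show "8 * M\<^sup>2 / Q \<le> \<delta> / 2" using assms by (simp add: field_simps Q_def)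
  qed (simp add: Q_def)
  show ?thesis
  proof (rule that[of "lacunary_colour r M Q"])
    fix s t :: real and i assume st: "s = -1 \<or> s = 1 \<and> \<bar>t\<bar> \<ge> 1 / 4"
    show "measure lborel {x\<in>{0..<1}. s * x + t \<in> {0..<1} \<and> lacunary_colour r M Q x = i \<and> lacunary_colour r M Q (s * x + t) = i}
        \<le> measure lborel {x\<in>{0..<1}. s * x + t \<in> {0..<1}} / r\<^sup>2 + \<delta>"
      using lacunary_bound[OF assms(1) M(1) Q(1) st, of i] M Q by linarith
  qed (use assms in \<open>simp_all add: lacunary_colour_less\<close>)
qed

section \<open>Planar isometries and Lebesgue measure\<close>

lemma isometry_continuous:
  fixes f :: "'a::metric_space \<Rightarrow> 'b::metric_space"
  assumes "\<And>x y. dist (f x) (f y) = dist x y"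
  shows "continuous_on A f"
  unfolding continuous_on_iff using assms by auto

lemma isometry_measurable:
  fixes f :: "'a::metric_space \<Rightarrow> 'b::metric_space"
  assumes "\<And>x y. dist (f x) (f y) = dist x y"
  shows "f \<in> borel_measurable borel"
  by (intro borel_measurable_continuous_onI isometry_continuous assms)

text \<open>An isometry is an orthogonal map \<open>L\<close> followed by a translation. The
  translation is absorbed into the corners of the box, and the preimage of a box under
  \<open>L\<close> is its image under the orthogonal inverse, which preserves volume; boxes
  determine Lebesgue measure.\<close>

lemma distr_lborel_isometry:
  fixes f :: "real^2 \<Rightarrow> real^2"
  assumes iso: "\<And>x y. dist (f x) (f y) = dist x y"
  shows "distr lborel borel f = lborel"
proof (rule lborel_eqI[symmetric])
  fix l u :: "real^2" assume lu: "\<And>b. b \<in> Basis \<Longrightarrow> l \<bullet> b \<le> u \<bullet> b"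
  define L where "L x = f x - f 0" for x
  have L: "orthogonal_transformation L"
    unfolding orthogonal_transformation_isometry L_def using iso by (simp add: dist_norm)
  have bij: "bij L" using L by (rule orthogonal_transformation_bij)
  have inv: "orthogonal_transformation (inv_into UNIV L)" using L by (rule orthogonal_transformation_inv)
  have meas: "f \<in> borel_measurable borel" using iso by (rule isometry_measurable)
  let ?B = "box (l - f 0) (u - f 0)"
  have eq: "f -` box l u = inv_into UNIV L ` ?B"
  proof -
    have "f -` box l u = L -` ?B" by (auto simp: L_def mem_box inner_diff_left)
    then show ?thesis using bij by (simp add: bij_vimage_eq_inv_image)
  qed
  have fm: "inv_into UNIV L ` ?B \<in> lmeasurable" by (intro measurable_orthogonal_image inv) simp
  have "f -` box l u \<in> sets borel" using measurable_sets[OF meas, of "box l u"] by simp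
  then have "emeasure lborel (f -` box l u) = emeasure lebesgue (inv_into UNIV L ` ?B)"
    by (simp add: eq[symmetric])
  also have "\<dots> = ennreal (measure lebesgue (inv_into UNIV L ` ?B))" using fm by (rule emeasure_eq_measure2)
  also have "measure lebesgue (inv_into UNIV L ` ?B) = measure lebesgue ?B"
    by (intro measure_orthogonal_image inv) simp
  also have "\<dots> = (\<Prod>b\<in>Basis. (u - l) \<bullet> b)"
    using lu by (simp add: measure_lborel_box_eq inner_diff_left)
  finally show "emeasure (distr lborel borel f) (box l u) = (\<Prod>b\<in>Basis. (u - l) \<bullet> b)"
    using meas by (simp add: emeasure_distr)
qed simp

definition complex_of_vec :: "real^2 \<Rightarrow> complex" where
  "complex_of_vec v = Complex (v $ 1) (v $ 2)"

definition vec_of_complex :: "complex \<Rightarrow> real^2" where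
  "vec_of_complex z = (\<chi> i. if i = 1 then Re z else Im z)"

lemma complex_of_vec_inverse [simp]: "vec_of_complex (complex_of_vec v) = v"
  by (simp add: vec_of_complex_def complex_of_vec_def vec_eq_iff forall_2)

lemma vec_of_complex_inverse [simp]: "complex_of_vec (vec_of_complex z) = z"
  by (simp add: vec_of_complex_def complex_of_vec_def complex_eq_iff)

lemma dist_complex_of_vec [simp]: "dist (complex_of_vec v) (complex_of_vec w) = dist v w"
  by (simp add: dist_norm complex_of_vec_def complex_norm norm_vec_def L2_set_def sum_2
      complex_diff cmod_def)

lemma dist_vec_of_complex [simp]: "dist (vec_of_complex v) (vec_of_complex w) = dist v w"
  by (metis dist_complex_of_vec vec_of_complex_inverse)

lemma measurable_complex_of_vec [measurable]: "complex_of_vec \<in> borel_measurable borel"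
  and measurable_vec_of_complex [measurable]: "vec_of_complex \<in> borel_measurable borel"
  by (rule isometry_measurable; simp)+

lemma Basis_vec2: "(Basis :: (real^2) set) = {axis 1 1, axis 2 1}"
  by (auto simp: Basis_vec_def UNIV_2)

lemma axis_1_2_distinct: "axis 1 (1::real) \<noteq> (axis 2 1 :: real^2)"
  by (simp add: axis_eq_axis)

lemma distr_lborel_complex_of_vec: "distr lborel borel complex_of_vec = lborel"
proof (rule lborel_eqI[symmetric])
  fix l u :: complex assume lu: "\<And>b. b \<in> Basis \<Longrightarrow> l \<bullet> b \<le> u \<bullet> b"
  have "complex_of_vec -` box l u = box (vec_of_complex l) (vec_of_complex u)"
    by (auto simp: mem_box Basis_complex_def Basis_vec2 complex_of_vec_def vec_of_complex_def
        inner_axis)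
  then have "emeasure (distr lborel borel complex_of_vec) (box l u) =
     emeasure lborel (box (vec_of_complex l) (vec_of_complex u))"
    by (simp add: emeasure_distr)
  also have "\<dots> = (\<Prod>b\<in>Basis. (u - l) \<bullet> b)"
    using lu[of 1] lu[of \<i>] by (subst emeasure_lborel_box_eq)
      (auto simp: Basis_complex_def Basis_vec2 vec_of_complex_def inner_axis axis_1_2_distinct
        prod.insert)
  finally show "emeasure (distr lborel borel complex_of_vec) (box l u) = (\<Prod>b\<in>Basis. (u - l) \<bullet> b)" .
qed simp

text \<open>Conjugation with the coordinate map, which preserves Lebesgue measure, transfers the
  result from \<open>real^2\<close>.\<close>

lemma distr_lborel_isometry_complex:
  fixes f :: "complex \<Rightarrow> complex"
  assumes iso: "\<And>x y. dist (f x) (f y) = dist x y"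
  shows "distr lborel borel f = lborel"
proof -
  let ?g = "vec_of_complex \<circ> f \<circ> complex_of_vec"
  have f[measurable]: "f \<in> borel_measurable borel" using iso by (rule isometry_measurable)
  have eq: "f \<circ> complex_of_vec = complex_of_vec \<circ> ?g" by auto
  have g: "distr lborel borel ?g = lborel"
    by (rule distr_lborel_isometry) (simp add: iso)
  have "distr lborel borel f = distr (distr lborel borel complex_of_vec) borel f"
    by (simp add: distr_lborel_complex_of_vec)
  also have "\<dots> = distr lborel borel (complex_of_vec \<circ> ?g)"
    by (subst distr_distr) (auto simp: eq)
  also have "\<dots> = distr (distr lborel borel ?g) borel complex_of_vec"
    by (subst distr_distr) auto
  also have "\<dots> = lborel" by (simp add: g distr_lborel_complex_of_vec)
  finally show ?thesis .
qed

lemma emeasure_normalized_lebesgue: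
  assumes "X \<in> sets borel" "A \<in> sets borel" "A \<subseteq> X"
  shows "emeasure (normalized_lebesgue X) A = emeasure lborel A / emeasure lborel X"
proof -
  have "emeasure (normalized_lebesgue X) A = emeasure (uniform_measure lborel X) A"
    unfolding normalized_lebesgue_def using assms by (intro emeasure_restrict_space) auto
  also have "\<dots> = emeasure lborel (X \<inter> A) / emeasure lborel X" using assms by simp
  finally show ?thesis using assms by (simp add: Int_absorb1)
qed

lemma space_normalized_lebesgue [simp]: "space (normalized_lebesgue X) = X"
  by (simp add: normalized_lebesgue_def space_restrict_space)

lemma measurable_normalized_lebesgue:
  assumes "X \<in> sets borel" "Y \<in> sets borel" "f \<in> borel_measurable borel" "f ` X \<subseteq> Y"
  shows "f \<in> measurable (normalized_lebesgue X) (normalized_lebesgue Y)"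
proof (rule measurableI)
  fix A assume "A \<in> sets (normalized_lebesgue Y)"
  then have A: "A \<in> sets borel" "A \<subseteq> Y" using assms by (auto simp: sets_normalized_lebesgue)
  have "f -` A \<in> sets borel" using measurable_sets[OF assms(3) A(1)] by simp
  then show "f -` A \<inter> space (normalized_lebesgue X) \<in> sets (normalized_lebesgue X)"
    using assms by (auto simp: sets_normalized_lebesgue)
qed (use assms in auto)

lemma measurable_normalized_lebesgue_borel:
  assumes "f \<in> measurable borel N"
  shows "f \<in> measurable (normalized_lebesgue X) N"
proof -
  have "measurable (uniform_measure lborel X) N = measurable borel N"
    by (intro measurable_cong_sets) simp_all
  then show ?thesis unfolding normalized_lebesgue_def using assms by (intro measurable_restrict_space1) simp
qed

lemma distr_normalized_lebesgue:
  assumes XY: "X \<in> sets borel" "Y \<in> sets borel" and f: "f \<in> borel_measurable borel"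
    and d: "distr lborel borel f = lborel" and X: "X = f -` Y"
  shows "distr (normalized_lebesgue X) (normalized_lebesgue Y) f = normalized_lebesgue Y"
proof (rule measure_eqI)
  let ?MX = "normalized_lebesgue X" and ?MY = "normalized_lebesgue Y"
  fix A assume "A \<in> sets (distr ?MX ?MY f)"
  then have A: "A \<in> sets borel" "A \<subseteq> Y" using XY by (auto simp: sets_normalized_lebesgue)
  have sub: "f ` X \<subseteq> Y" using X by auto
  have em: "emeasure lborel (f -` B) = emeasure lborel B" if "B \<in> sets borel" for B
    using d f that by (metis emeasure_distr measurable_lborel2 sets_lborel space_borel space_lborel Int_UNIV_right)
  have fA: "f -` A \<in> sets borel" using measurable_sets[OF f A(1)] by simp
  have "emeasure (distr ?MX ?MY f) A =
      emeasure ?MX (f -` A \<inter> X)"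
    using A XY measurable_normalized_lebesgue[OF XY f sub]
    by (subst emeasure_distr) (auto simp: sets_normalized_lebesgue)
  also have "f -` A \<inter> X = f -` A" using A X by auto
  also have "emeasure ?MX (f -` A) = emeasure lborel (f -` A) / emeasure lborel X"
    using XY fA A X by (intro emeasure_normalized_lebesgue) auto
  also have "\<dots> = emeasure lborel A / emeasure lborel Y"
    using em[OF A(1)] em[OF XY(2)] X by simp
  also have "\<dots> = emeasure ?MY A"
    using XY A by (intro emeasure_normalized_lebesgue[symmetric]) auto
  finally show "emeasure (distr ?MX ?MY f) A =
      emeasure ?MY A" .
qed simp

lemma prob_space_normalized_lebesgue:
  assumes "compact X" "measure lborel X > 0"
  shows "prob_space (normalized_lebesgue X)"
proof (rule prob_spaceI)
  have X: "X \<in> sets borel" using assms by (simp add: borel_compact)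
  have "emeasure lborel X \<noteq> 0" "emeasure lborel X \<noteq> \<infinity>"
    using assms(2) emeasure_compact_finite[OF assms(1)] by (auto simp: measure_def)
  then show "emeasure (normalized_lebesgue X) (space (normalized_lebesgue X)) = 1"
    using emeasure_normalized_lebesgue[OF X X] by (simp add: ennreal_divide_self top.not_eq_extremum)
qed

lemma Iso_D:
  assumes "f \<in> carrier (Iso X)"
  shows "bij f" "dist (f x) (f y) = dist x y" "f ` X = X" "X = f -` X" "x \<in> X \<Longrightarrow> f x \<in> X"
proof -
  show *: "bij f" "dist (f x) (f y) = dist x y" "f ` X = X" using assms by (auto simp: Iso_def)
  then show "X = f -` X" by (metis bij_is_inj inj_vimage_image_eq)
  show "x \<in> X \<Longrightarrow> f x \<in> X" using *(3) by blast
qed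

lemma measurable_Iso_complex:
  fixes Y :: "complex set"
  assumes "Y \<in> sets borel" "f \<in> carrier (Iso Y)"
  shows "f \<in> measurable (normalized_lebesgue Y) (normalized_lebesgue Y)"
  using Iso_D[OF assms(2)] assms(1) isometry_measurable[of f]
  by (intro measurable_normalized_lebesgue) auto

lemma distr_Iso_complex:
  fixes Y :: "complex set"
  assumes "Y \<in> sets borel" "f \<in> carrier (Iso Y)"
  shows "distr (normalized_lebesgue Y) (normalized_lebesgue Y) f = normalized_lebesgue Y"
  using Iso_D[OF assms(2)] assms(1) isometry_measurable[of f] distr_lborel_isometry_complex[of f]
  by (intro distr_normalized_lebesgue) auto

text \<open>An isometry fixing \<open>0\<close> is real linear, hence determined by
  \<open>f 1\<close> and \<open>f \<i>\<close>. After division by \<open>u = f 1\<close>, the value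
  at \<open>\<i>\<close> is a unit vector at distance \<open>sqrt 2\<close> from \<open>1\<close>,
  so it is \<open>\<i>\<close> or \<open>- \<i>\<close>; the two signs give the rotations and the
  reflections.\<close>

lemma Iso_complex_cases:
  fixes Y :: "complex set"
  assumes f: "f \<in> carrier (Iso Y)" and 0: "f 0 = 0"
  obtains u where "norm u = 1" "f = (\<lambda>z. u * z)" | u where "norm u = 1" "f = (\<lambda>z. u * cnj z)"
proof -
  have lin: "linear f" using 0 Iso_D[OF f] by (intro isometry_linear) auto
  have nrm: "norm (f z) = norm z" for z using Iso_D(2)[OF f, of z 0] 0 by simp
  define u where "u = f 1"
  have u: "norm u = 1" using nrm[of 1] by (simp add: u_def)
  then have uu: "u * cnj u = 1" by (simp add: complex_norm_square[symmetric])
  define w where "w = f \<i> * cnj u"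
  have "norm w = 1" using nrm[of \<i>] u by (simp add: w_def norm_mult)
  moreover have "dist w 1 = sqrt 2"
  proof -
    have "w - 1 = (f \<i> - f 1) * cnj u" using uu by (simp add: w_def u_def algebra_simps)
    then have "norm (w - 1) = norm (f \<i> - f 1)" using u by (simp add: norm_mult)
    also have "\<dots> = dist \<i> 1" using Iso_D(2)[OF f, of \<i> 1] by (simp add: dist_norm)
    also have "\<dots> = sqrt 2" by (simp add: dist_norm cmod_def)
    finally show ?thesis by (simp add: dist_norm)
  qed
  ultimately have w: "w = \<i> \<or> w = - \<i>"
  proof -
    assume "norm w = 1" "dist w 1 = sqrt 2"
    then have 1: "(Re w)\<^sup>2 + (Im w)\<^sup>2 = 1" and 2: "(Re w - 1)\<^sup>2 + (Im w)\<^sup>2 = 2"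
      by (simp_all add: dist_norm cmod_def)
    from 1 2 have "Re w = 0" by (simp add: power2_eq_square algebra_simps)
    with 1 have "(Im w)\<^sup>2 = 1" by simp
    then have "Im w = 1 \<or> Im w = -1" by (simp add: power2_eq_1_iff)
    with \<open>Re w = 0\<close> show ?thesis by (auto simp: complex_eq_iff)
  qed
  have "f \<i> * (cnj u * u) = w * u" by (simp add: w_def)
  then have fi: "f \<i> = w * u" using uu by (simp add: mult.commute)
  have fz: "f z = Re z *\<^sub>R u + Im z *\<^sub>R (w * u)" for z
  proof -
    have "z = Re z *\<^sub>R 1 + Im z *\<^sub>R \<i>" by (simp add: complex_eq_iff)
    then have "f z = f (Re z *\<^sub>R 1 + Im z *\<^sub>R \<i>)" by simp
    also have "\<dots> = Re z *\<^sub>R f 1 + Im z *\<^sub>R f \<i>" using lin by (simp add: linear_add linear_scale)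
    finally show ?thesis by (simp add: fi u_def)
  qed
  from w show ?thesis
  proof
    assume "w = \<i>"
    then have "f = (\<lambda>z. u * z)" by (auto simp: fun_eq_iff fz complex_eq_iff)
    with u show ?thesis by (rule that)
  next
    assume "w = - \<i>"
    then have "f = (\<lambda>z. u * cnj z)" by (auto simp: fun_eq_iff fz complex_eq_iff)
    with u show ?thesis by (rule that)
  qed
qed

section \<open>Reduction to centred sets in the complex plane\<close>

text \<open>The condition on \<open>\<epsilon>\<close> inside \<open>ms\<close>, isolated so that
  two values of \<open>ms\<close> can be compared by comparing it for each positive
  \<open>\<epsilon>\<close>.\<close>

definition admissible ::
  "'x measure \<Rightarrow> ('g, 'm) monoid_scheme \<Rightarrow> ('g \<Rightarrow> 'x \<Rightarrow> 'x) \<Rightarrow> nat \<Rightarrow> real \<Rightarrow> bool" where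
  "admissible M G act r \<epsilon> \<longleftrightarrow>
     (\<forall>col \<in> measurable M (count_space {..<r}).
        \<exists>A \<in> sets M. (\<exists>c<r. \<forall>x\<in>A. col x = c) \<and> measure M A \<ge> \<epsilon> \<and>
          (\<exists>g \<in> carrier G. g \<noteq> \<one>\<^bsub>G\<^esub> \<and> act g ` A = A))"

lemma ms_admissible: "ms M G act r = Sup ({0} \<union> {\<epsilon>. \<epsilon> > 0 \<and> admissible M G act r \<epsilon>})"
  by (simp add: ms_def admissible_def)

lemma ms_cong:
  assumes "\<And>\<epsilon>. \<epsilon> > 0 \<Longrightarrow> admissible M G act r \<epsilon> \<longleftrightarrow> admissible M' G' act' r \<epsilon>"
  shows "ms M G act r = ms M' G' act' r"
proof -
  have "{\<epsilon>. \<epsilon> > 0 \<and> admissible M G act r \<epsilon>} = {\<epsilon>. \<epsilon> > 0 \<and> admissible M' G' act' r \<epsilon>}"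
    using assms by auto
  then show ?thesis by (simp only: ms_admissible)
qed

lemma ms_le:
  assumes "v \<ge> 0" "\<And>\<epsilon>. \<epsilon> > v \<Longrightarrow> \<not> admissible M G act r \<epsilon>"
  shows "ms M G act r \<le> v"
  unfolding ms_admissible
proof (rule cSup_least)
  fix x assume "x \<in> {0} \<union> {\<epsilon>. \<epsilon> > 0 \<and> admissible M G act r \<epsilon>}"
  then show "x \<le> v" using assms by (cases "x \<le> v") auto
qed simp

text \<open>The supremum is only usable for a set bounded above, and the constant colouring,
  available for \<open>r \<ge> 1\<close>, bounds every admissible \<open>\<epsilon>\<close> by the
  total mass \<open>1\<close>. The guarded last premise lets \<open>\<epsilon> = 0\<close> yield
  nonnegativity of \<open>ms\<close>.\<close>

lemma ms_ge:
  assumes "prob_space M" "r \<ge> 1" "\<epsilon> \<ge> 0" "\<epsilon> > 0 \<Longrightarrow> admissible M G act r \<epsilon>"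
  shows "ms M G act r \<ge> \<epsilon>"
  unfolding ms_admissible
proof (rule cSup_upper)
  interpret prob_space M by fact
  show "bdd_above ({0} \<union> {\<epsilon>. \<epsilon> > 0 \<and> admissible M G act r \<epsilon>})"
  proof (rule bdd_aboveI[of _ 1])
    fix x assume "x \<in> {0} \<union> {\<epsilon>. \<epsilon> > 0 \<and> admissible M G act r \<epsilon>}"
    moreover have "x \<le> 1" if "admissible M G act r x"
    proof -
      have "(\<lambda>_. 0) \<in> measurable M (count_space {..<r})" using assms by simp
      with that obtain A where "measure M A \<ge> x" unfolding admissible_def by blast
      then show ?thesis using prob_le_1[of A] by linarith
    qed
    ultimately show "x \<le> 1" by auto
  qed
qed (use assms in auto)

text \<open>A colouring of \<open>M'\<close> is pulled back along \<open>T\<close> and the invariant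
  set found in \<open>M\<close> is pushed forward; its image under \<open>T\<close> is measurable
  because it is a preimage under \<open>S\<close>. Equality of two values of \<open>ms\<close> uses
  this twice, with \<open>T\<close> and \<open>S\<close> exchanged.\<close>

lemma admissible_transport:
  assumes T: "T \<in> measurable M M'" and S: "S \<in> measurable M' M"
    and ST: "\<And>x. x \<in> space M \<Longrightarrow> S (T x) = x" and TS: "\<And>y. y \<in> space M' \<Longrightarrow> T (S y) = y"
    and d: "distr M M' T = M'"
    and \<psi>: "\<And>g. g \<in> carrier G \<Longrightarrow> \<psi> g \<in> carrier G'"
    and \<psi>1: "\<And>g. g \<in> carrier G \<Longrightarrow> g \<noteq> \<one>\<^bsub>G\<^esub> \<Longrightarrow> \<psi> g \<noteq> \<one>\<^bsub>G'\<^esub>"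
    and act: "\<And>g x. g \<in> carrier G \<Longrightarrow> x \<in> space M \<Longrightarrow> act' (\<psi> g) (T x) = T (act g x)"
    and adm: "admissible M G act r \<epsilon>"
  shows "admissible M' G' act' r \<epsilon>"
  unfolding admissible_def
proof
  fix col assume col: "col \<in> measurable M' (count_space {..<r})"
  have "col \<circ> T \<in> measurable M (count_space {..<r})" using T col by (rule measurable_comp)
  from adm[unfolded admissible_def, rule_format, OF this] obtain A c g where A: "A \<in> sets M" "c < r" "\<forall>x\<in>A. (col \<circ> T) x = c" "measure M A \<ge> \<epsilon>"
    "g \<in> carrier G" "g \<noteq> \<one>\<^bsub>G\<^esub>" "act g ` A = A"
    by auto
  have Asp: "A \<subseteq> space M" using A(1) by (rule sets.sets_into_space)
  have eq: "T ` A = S -` A \<inter> space M'"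
  proof safe
    fix y assume "S y \<in> A" "y \<in> space M'"
    then show "y \<in> T ` A" using TS[of y] by (metis imageI)
  qed (use Asp ST T in \<open>auto simp: measurable_def\<close>)
  have sets: "T ` A \<in> sets M'" unfolding eq using S A(1) by (rule measurable_sets)
  have "T -` (T ` A) \<inter> space M = A" using Asp ST by (auto; metis subsetD)
  then have "measure M' (T ` A) = measure M A"
    using measure_distr[OF T sets] d by simp
  moreover have "act' (\<psi> g) ` (T ` A) = T ` A"
  proof -
    have "act' (\<psi> g) ` (T ` A) = T ` (act g ` A)"
      unfolding image_image using act[OF A(5)] Asp by (intro image_cong) auto
    then show ?thesis using A(7) by simp
  qed
  ultimately show "\<exists>A \<in> sets M'. (\<exists>c<r. \<forall>x\<in>A. col x = c) \<and> measure M' A \<ge> \<epsilon> \<and>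
          (\<exists>g \<in> carrier G'. g \<noteq> \<one>\<^bsub>G'\<^esub> \<and> act' g ` A = A)"
    using sets A \<psi>[OF A(5)] \<psi>1[OF A(5,6)]
    by (intro bexI[of _ "T ` A"] conjI exI[of _ c] bexI[of _ "\<psi> g"]) auto
qed

text \<open>Substituting \<open>f\<close> in the integral \<open>J\<close> that defines the centroid
  changes neither the domain nor the measure. As \<open>f x = f 0 + L x\<close> with
  \<open>L\<close> linear, this gives \<open>J = m *\<^sub>R f 0 + L J\<close>, and division by the
  mass \<open>m\<close> yields \<open>f c = c\<close>.\<close>

lemma centroid_fixed:
  fixes X :: "(real^2) set"
  assumes X: "compact X" "measure lborel X > 0"
  defines "c \<equiv> (1 / measure lborel X) *\<^sub>R (\<integral>x. indicator X x *\<^sub>R x \<partial>lborel)"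
  assumes f: "f \<in> carrier (Iso X)"
  shows "f c = c"
proof -
  note D = Iso_D[OF f]
  have Xb: "X \<in> sets borel" using X by (simp add: borel_compact)
  define m where "m = measure lborel X"
  define J where "J = (\<integral>x. indicator X x *\<^sub>R x \<partial>lborel)"
  define L where "L x = f x - f 0" for x
  have L: "linear L" using isometry_linear[of L] D(2) by (simp add: L_def dist_norm)
  then have bl: "bounded_linear L" by (simp add: linear_conv_bounded_linear)
  have fm[measurable]: "f \<in> borel_measurable borel" using D(2) by (rule isometry_measurable)
  have int: "integrable lborel (\<lambda>x. indicator X x *\<^sub>R x)"
    using borel_integrable_compact[OF X(1), of "\<lambda>x. x"] by simp
  have intc: "integrable lborel (\<lambda>x. indicator X x *\<^sub>R f 0)"
    using borel_integrable_compact[OF X(1), of "\<lambda>x. f 0"] by simp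
  have "J = (\<integral>x. indicator X x *\<^sub>R x \<partial>(distr lborel borel f))"
    using distr_lborel_isometry[OF D(2)] by (simp add: J_def)
  also have "\<dots> = (\<integral>x. indicator X (f x) *\<^sub>R f x \<partial>lborel)"
    using Xb by (intro integral_distr) auto
  also have "\<dots> = (\<integral>x. indicator X x *\<^sub>R f 0 + L (indicator X x *\<^sub>R x) \<partial>lborel)"
  proof (rule Bochner_Integration.integral_cong)
    fix x
    have "indicator X (f x) = (indicator X x :: real)" using D(4) by (auto simp: indicator_def)
    then show "indicator X (f x) *\<^sub>R f x = indicator X x *\<^sub>R f 0 + L (indicator X x *\<^sub>R x)"
      using linear_scale[OF L, of "indicator X x" x] by (simp add: scaleR_right_diff_distrib) (simp add: L_def algebra_simps)
  qed simp
  also have "\<dots> = (\<integral>x. indicator X x *\<^sub>R f 0 \<partial>lborel) + (\<integral>x. L (indicator X x *\<^sub>R x) \<partial>lborel)"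
    by (rule Bochner_Integration.integral_add[OF intc integrable_bounded_linear[OF bl int]])
  finally have sum: "J = (\<integral>x. indicator X x *\<^sub>R f 0 \<partial>lborel) + (\<integral>x. L (indicator X x *\<^sub>R x) \<partial>lborel)" .
  have 1: "(\<integral>x. L (indicator X x *\<^sub>R x) \<partial>lborel) = L J"
    unfolding J_def using bl int by (rule integral_bounded_linear)
  have 2: "(\<integral>x. indicator X x *\<^sub>R f 0 \<partial>lborel) = m *\<^sub>R f 0"
    using emeasure_compact_finite[OF X(1)] Xb by (simp add: m_def)
  have "J = m *\<^sub>R f 0 + L J" using sum unfolding 1 2 .
  then have "c = f 0 + L c"
  proof -
    assume J: "J = m *\<^sub>R f 0 + L J"
    have m: "m \<noteq> 0" using X(2) by (simp add: m_def)
    have c: "c = (1 / m) *\<^sub>R J" by (simp add: c_def J_def m_def)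
    have "f 0 + L c = (1 / m) *\<^sub>R (m *\<^sub>R f 0 + L J)"
      using m L by (simp add: c linear_scale scaleR_right_distrib)
    then show ?thesis using J c by simp
  qed
  then show ?thesis by (simp add: L_def)
qed

lemma reduction_to_complex:
  fixes X :: "(real^2) set"
  assumes X: "compact X" "measure lborel X > 0"
  obtains Y :: "complex set" where "compact Y" "measure lborel Y > 0" "Iso X \<cong> Iso Y"
    "\<And>f. f \<in> carrier (Iso Y) \<Longrightarrow> f 0 = 0" "\<And>r. ms_set X r = ms_set Y r"
proof -
  define c where "c = (1 / measure lborel X) *\<^sub>R (\<integral>x. indicator X x *\<^sub>R x \<partial>lborel)"
  have c: "f c = c" if "f \<in> carrier (Iso X)" for f
    unfolding c_def using centroid_fixed[OF X that] .
  define T where "T v = complex_of_vec (v - c)" for v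
  define S where "S z = vec_of_complex z + c" for z
  have ST[simp]: "S (T v) = v" and TS[simp]: "T (S z) = z" for v z by (simp_all add: S_def T_def)
  have dT[simp]: "dist (T v) (T w) = dist v w" for v w by (simp add: T_def) (simp add: dist_norm)
  have dS[simp]: "dist (S v) (S w) = dist v w" for v w by (metis TS dT)
  have bT: "bij T" by (rule o_bij[of S]) (auto simp: fun_eq_iff)
  have bS: "bij S" by (rule o_bij[of T]) (auto simp: fun_eq_iff)
  have Tm[measurable]: "T \<in> borel_measurable borel" and Sm[measurable]: "S \<in> borel_measurable borel"
    by (rule isometry_measurable; simp)+
  have "T = complex_of_vec \<circ> (+) (- c)" by (auto simp: T_def)
  then have "distr lborel borel T = distr (distr lborel borel ((+) (- c))) borel complex_of_vec"
    by (subst distr_distr) auto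
  then have dist_T: "distr lborel borel T = lborel"
    by (simp add: lborel_distr_plus distr_lborel_complex_of_vec)
  have "distr lborel borel S = distr (distr lborel borel T) borel S" by (simp add: dist_T)
  also have "\<dots> = distr lborel borel (S \<circ> T)" by (subst distr_distr) auto
  also have "S \<circ> T = (\<lambda>x. x)" by auto
  finally have dist_S: "distr lborel borel S = lborel" by (simp add: distr_id2)
  define Y where "Y = T ` X"
  have X_vim: "X = T -` Y" unfolding Y_def using bT by (simp add: bij_is_inj inj_vimage_image_eq)
  have X_im: "S ` Y = X" by (auto simp: Y_def image_image)
  have Y_vim: "Y = S -` X" using X_im bS by (metis bij_is_inj inj_vimage_image_eq)
  have cY: "compact Y" unfolding Y_def using X(1) by (intro compact_continuous_image isometry_continuous) auto
  have Xb: "X \<in> sets borel" and Yb: "Y \<in> sets borel" using X cY by (simp_all add: borel_compact)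
  have "emeasure lborel Y = emeasure lborel X"
    using emeasure_distr[of T lborel borel Y] Yb X_vim dist_T by simp
  then have mY: "measure lborel Y > 0" using X by (simp add: measure_def)
  define \<psi> where "\<psi> f = T \<circ> f \<circ> S" for f
  define \<phi> where "\<phi> f = S \<circ> f \<circ> T" for f
  have \<phi>\<psi>[simp]: "\<phi> (\<psi> f) = f" and \<psi>\<phi>[simp]: "\<psi> (\<phi> g) = g" for f g
    by (auto simp: \<phi>_def \<psi>_def fun_eq_iff)
  have \<psi>: "\<psi> f \<in> carrier (Iso Y)" if "f \<in> carrier (Iso X)" for f
  proof -
    note D = Iso_D[OF that]
    have "\<psi> f ` Y = T ` f ` S ` Y" by (simp add: \<psi>_def image_comp)
    also have "\<dots> = Y" unfolding X_im D(3) by (simp add: Y_def)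
    finally show ?thesis using D bT bS by (simp add: Iso_def) (simp add: \<psi>_def bij_comp)
  qed
  have \<phi>: "\<phi> f \<in> carrier (Iso X)" if "f \<in> carrier (Iso Y)" for f
  proof -
    note D = Iso_D[OF that]
    have "\<phi> f ` X = S ` f ` T ` X" by (simp add: \<phi>_def image_comp)
    also have "\<dots> = X" using D(3) X_im by (simp add: Y_def)
    finally show ?thesis using D bT bS by (simp add: Iso_def) (simp add: \<phi>_def bij_comp)
  qed
  have "\<psi> \<in> iso (Iso X) (Iso Y)"
  proof (rule isoI)
    show "\<psi> \<in> hom (Iso X) (Iso Y)"
      by (rule homI[OF \<psi>]) (auto simp: Iso_def \<psi>_def fun_eq_iff)
    show "bij_betw \<psi> (carrier (Iso X)) (carrier (Iso Y))"
      by (rule bij_betw_byWitness[of _ \<phi>]) (auto simp: \<psi> \<phi>)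
  qed
  then have iso: "Iso X \<cong> Iso Y" by (auto simp: is_iso_def)
  have T0: "T c = 0" by (simp add: T_def complex_of_vec_def complex_eq_iff)
  have f0: "f 0 = 0" if "f \<in> carrier (Iso Y)" for f
  proof -
    have "S (f (T c)) = c" using c[OF \<phi>[OF that]] by (simp add: \<phi>_def)
    then have "f (T c) = T c" by (metis TS)
    then show ?thesis by (simp add: T0)
  qed
  let ?MX = "normalized_lebesgue X" and ?MY = "normalized_lebesgue Y"
  have TM: "T \<in> measurable ?MX ?MY"
    using Xb Yb Tm by (rule measurable_normalized_lebesgue) (simp add: Y_def)
  have SM: "S \<in> measurable ?MY ?MX"
    using Yb Xb Sm by (rule measurable_normalized_lebesgue) (simp add: X_im)
  have ms: "ms_set X r = ms_set Y r" for r
    unfolding ms_set_def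
  proof (rule ms_cong, rule iffI)
    fix \<epsilon> assume "admissible ?MX (Iso X) (\<lambda>f x. f x) r \<epsilon>"
    then show "admissible ?MY (Iso Y) (\<lambda>f x. f x) r \<epsilon>"
    proof (rule admissible_transport[where T = T and S = S and \<psi> = \<psi>, rotated -1])
      show "distr ?MX ?MY T = ?MY"
        using Xb Yb Tm dist_T X_vim by (rule distr_normalized_lebesgue)
      fix g assume "g \<noteq> \<one>\<^bsub>Iso X\<^esub>"
      moreover have "\<phi> id = id" by (auto simp: \<phi>_def)
      ultimately show "\<psi> g \<noteq> \<one>\<^bsub>Iso Y\<^esub>" using \<phi>\<psi>[of g] by (auto simp: Iso_def simp del: \<phi>\<psi>)
    next
      show "T \<in> measurable ?MX ?MY"
        "S \<in> measurable ?MY ?MX"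
        by (rule TM SM)+
    qed (auto simp: \<psi>, simp add: \<psi>_def)
  next
    fix \<epsilon> assume "admissible ?MY (Iso Y) (\<lambda>f x. f x) r \<epsilon>"
    then show "admissible ?MX (Iso X) (\<lambda>f x. f x) r \<epsilon>"
    proof (rule admissible_transport[where T = S and S = T and \<psi> = \<phi>, rotated -1])
      show "distr ?MY ?MX S = ?MX"
        using Yb Xb Sm dist_S Y_vim by (rule distr_normalized_lebesgue)
      fix g assume "g \<noteq> \<one>\<^bsub>Iso Y\<^esub>"
      moreover have "\<psi> id = id" by (auto simp: \<psi>_def)
      ultimately show "\<phi> g \<noteq> \<one>\<^bsub>Iso X\<^esub>" using \<psi>\<phi>[of g] by (auto simp: Iso_def simp del: \<psi>\<phi>)
    next
      show "S \<in> measurable ?MY ?MX"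
        "T \<in> measurable ?MX ?MY"
        by (rule TM SM)+
    qed (auto simp: \<phi>, simp add: \<phi>_def)
  qed
  show ?thesis by (rule that[of Y]) (fact cY mY iso f0 ms)+
qed

section \<open>Finite symmetry groups that are not dihedral\<close>

lemma Iso_comp: "f \<in> carrier (Iso X) \<Longrightarrow> g \<in> carrier (Iso X) \<Longrightarrow> f \<circ> g \<in> carrier (Iso X)"
  using group.is_monoid[OF group_Iso, THEN monoid.m_closed, of f X g] by (simp add: Iso_def)

lemma Iso_inv: "f \<in> carrier (Iso X) \<Longrightarrow> inv_into UNIV f \<in> carrier (Iso X)"
proof -
  assume f: "f \<in> carrier (Iso X)"
  then obtain g where g: "g \<in> carrier (Iso X)" "g \<circ> f = id"
    using group.l_inv_ex[OF group_Iso f] by (auto simp: Iso_def)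
  then have "inv_into UNIV f = g"
    using Iso_D(1)[OF f] by (metis bij_is_surj inv_unique_comp surj_iff comp_assoc comp_id id_comp)
  with g show ?thesis by simp
qed

lemma Iso_funpow: "f \<in> carrier (Iso X) \<Longrightarrow> f ^^ k \<in> carrier (Iso X)"
proof (induction k)
  case 0
  show ?case by (simp add: Iso_def id_def[symmetric])
next
  case (Suc k)
  then show ?case unfolding funpow.simps by (intro Iso_comp)
qed

section \<open>Vanishing by half-plane colourings\<close>

lemma measure_negligible_subset:
  assumes "Y \<in> sets borel" "A \<in> sets (normalized_lebesgue Y)" "negligible N" "A \<subseteq> N"
  shows "measure (normalized_lebesgue Y) A = 0"
proof -
  have A: "A \<in> sets borel" "A \<subseteq> Y" using assms by (auto simp: sets_normalized_lebesgue)
  have "negligible A" using assms negligible_subset by blast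
  then have "emeasure lebesgue A = 0" by (simp add: negligible_iff_null_sets null_sets_def)
  then have "emeasure lborel A = 0" using A by simp
  then show ?thesis using emeasure_normalized_lebesgue[OF assms(1) A] by (simp add: measure_def)
qed

text \<open>Two of the \<open>r\<close> colours suffice. When every invariant set on one side of
  \<open>P\<close> is null, colouring by \<open>P\<close> refutes each positive
  \<open>\<epsilon>\<close>; the lower bound \<open>0\<close> is built into
  \<open>ms\<close>.\<close>

lemma ms_set_eq_0I:
  fixes Y :: "complex set"
  assumes Y: "compact Y" "measure lborel Y > 0" and r: "r \<ge> 2"
    and P[measurable]: "Measurable.pred borel P"
    and sym: "\<And>g A. g \<in> carrier (Iso Y) \<Longrightarrow> g \<noteq> id \<Longrightarrow> g ` A = A \<Longrightarrow>
       (\<forall>x\<in>A. P x) \<or> (\<forall>x\<in>A. \<not> P x) \<Longrightarrow> negligible A"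
  shows "ms_set Y r = 0"
proof -
  let ?M = "normalized_lebesgue Y"
  have Yb: "Y \<in> sets borel" using Y by (simp add: borel_compact)
  define col :: "complex \<Rightarrow> nat" where "col z = (if P z then 0 else 1)" for z
  have "col \<in> measurable borel (count_space {..<r})"
    unfolding col_def using r by (intro measurable_If) simp_all
  then have col: "col \<in> measurable ?M (count_space {..<r})"
    by (rule measurable_normalized_lebesgue_borel)
  have "\<not> admissible ?M (Iso Y) (\<lambda>f x. f x) r \<epsilon>" if "\<epsilon> > 0" for \<epsilon>
  proof
    assume "admissible ?M (Iso Y) (\<lambda>f x. f x) r \<epsilon>"
    from this[unfolded admissible_def, rule_format, OF col] obtain A c g where
      A: "A \<in> sets ?M" "\<forall>x\<in>A. col x = c" "measure ?M A \<ge> \<epsilon>" "g \<in> carrier (Iso Y)" "g \<noteq> id" "g ` A = A"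
      by (auto simp: Iso_def)
    have "(\<forall>x\<in>A. P x) \<or> (\<forall>x\<in>A. \<not> P x)"
      using A(2) by (cases "c = 0") (auto simp: col_def split: if_splits)
    then have "negligible A" using sym A by blast
    then have "measure ?M A = 0" using measure_negligible_subset[OF Yb A(1)] by blast
    then show False using A that by simp
  qed
  then have "ms_set Y r \<le> 0" unfolding ms_set_def by (intro ms_le) auto
  moreover have "ms_set Y r \<ge> 0" unfolding ms_set_def
    using prob_space_normalized_lebesgue[OF Y] r by (intro ms_ge) auto
  ultimately show ?thesis by simp
qed

text \<open>Nonnegative imaginary parts with sum \<open>0\<close> all vanish, and then all real
  parts are positive.\<close>

lemma lex_positive_sum_nonzero:
  fixes w :: "'i \<Rightarrow> complex"
  assumes "finite S" "S \<noteq> {}" "\<And>k. k \<in> S \<Longrightarrow> Im (w k) > 0 \<or> Im (w k) = 0 \<and> Re (w k) > 0"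
  shows "sum w S \<noteq> 0"
proof
  assume "sum w S = 0"
  then have 0: "(\<Sum>k\<in>S. Im (w k)) = 0" "(\<Sum>k\<in>S. Re (w k)) = 0"
    by (metis Im_sum zero_complex.sel(2), metis Re_sum zero_complex.sel(1))
  have "\<forall>k\<in>S. Im (w k) = 0"
    using 0(1) assms by (subst (asm) sum_nonneg_eq_0_iff) (auto simp: less_imp_le dest!: assms(3))
  then have "\<forall>k\<in>S. Re (w k) > 0" using assms(3) by force
  then have "(\<Sum>k\<in>S. Re (w k)) > 0" using assms by (intro sum_pos) auto
  with 0 show False by simp
qed

text \<open>In a finite group the powers of a rotation must repeat; evaluation at \<open>1\<close>
  turns the repetition into an equation of numbers, and the unit \<open>u ^ i\<close> is
  cancelled.\<close>

lemma rotation_power_eq_1: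
  fixes Y :: "complex set"
  assumes "finite (carrier (Iso Y))" "(\<lambda>z. u * z) \<in> carrier (Iso Y)" "norm u = 1"
  obtains n where "n > 0" "u ^ n = 1"
proof -
  have pow: "((\<lambda>z. u * z) ^^ k) = (\<lambda>z. u ^ k * z)" for k
    by (induction k) (auto simp: fun_eq_iff mult.assoc)
  have "(\<lambda>k z. u ^ k * z) ` UNIV \<subseteq> carrier (Iso Y)"
    using Iso_funpow[OF assms(2)] by (auto simp: pow)
  then have "finite (range (\<lambda>k z. u ^ k * z))" using assms(1) finite_subset by blast
  then have "\<not> inj (\<lambda>k::nat. \<lambda>z. u ^ k * z)" using finite_imageD infinite_UNIV_nat by blast
  then obtain i j where "i \<noteq> j" "(\<lambda>z. u ^ i * z) = (\<lambda>z. u ^ j * z)" by (auto simp: inj_def)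
  then have "i \<noteq> j" "u ^ i = u ^ j" by (auto dest: fun_cong[of _ _ 1])
  then obtain i j where ij: "i < j" "u ^ i = u ^ j" by (metis linorder_neqE_nat)
  have "u ^ j = u ^ i * u ^ (j - i)" using ij(1) by (simp flip: power_add)
  then have "u ^ (j - i) = 1" using ij assms(3) by auto
  then show ?thesis using ij that[of "j - i"] by simp
qed

text \<open>
  The orbit of a point under a nontrivial finite rotation sums to zero, so it meets both of the
  lexicographic half-planes, each of which is closed under addition.
\<close>

lemma ms_set_rotations:
  fixes Y :: "complex set"
  assumes Y: "compact Y" "measure lborel Y > 0" and r: "r \<ge> 2"
    and fin: "finite (carrier (Iso Y))"
    and rot: "\<And>f. f \<in> carrier (Iso Y) \<Longrightarrow> \<exists>u. norm u = 1 \<and> f = (\<lambda>z. u * z)"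
  shows "ms_set Y r = 0"
proof (rule ms_set_eq_0I[OF Y r, where P = "\<lambda>z. Im z > 0 \<or> Im z = 0 \<and> Re z > 0"])
  fix g :: "complex \<Rightarrow> complex" and A
  assume g: "g \<in> carrier (Iso Y)" "g \<noteq> id" "g ` A = A"
    and mono: "(\<forall>x\<in>A. Im x > 0 \<or> Im x = 0 \<and> Re x > 0) \<or> (\<forall>x\<in>A. \<not> (Im x > 0 \<or> Im x = 0 \<and> Re x > 0))"
  obtain u where u: "norm u = 1" "g = (\<lambda>z. u * z)" using rot[OF g(1)] by auto
  have u1: "u \<noteq> 1" using u g(2) by auto
  obtain n where n: "n > 0" "u ^ n = 1" using rotation_power_eq_1[OF fin] g(1) u by auto
  \<comment> \<open>As \<open>u \<noteq> 1\<close> and \<open>u ^ n = 1\<close>, the geometric sum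
    vanishes: every orbit is balanced around \<open>0\<close>.\<close>
  have "(\<Sum>k<n. u ^ k) = 0" using u1 n by (simp add: geometric_sum)
  then have sum0: "(\<Sum>k<n. u ^ k * z) = 0" for z by (simp flip: sum_distrib_right)
  have "A \<subseteq> {0}"
  proof
    fix z assume z: "z \<in> A"
    have orb: "u ^ k * z \<in> A" for k
      by (induction k) (use z g(3) u in \<open>auto simp: mult.assoc\<close>)
    show "z \<in> {0}"
    proof (rule ccontr)
      assume "z \<notin> {0}"
      then have nz: "u ^ k * z \<noteq> 0" for k using u by auto
      from mono show False
      proof
        assume "\<forall>x\<in>A. Im x > 0 \<or> Im x = 0 \<and> Re x > 0"
        then have "Im (u ^ k * z) > 0 \<or> Im (u ^ k * z) = 0 \<and> Re (u ^ k * z) > 0" for k using orb by blast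
        then have "(\<Sum>k<n. u ^ k * z) \<noteq> 0" using n by (intro lex_positive_sum_nonzero) auto
        then show False using sum0 by blast
      next
        assume *: "\<forall>x\<in>A. \<not> (Im x > 0 \<or> Im x = 0 \<and> Re x > 0)"
        \<comment> \<open>The complementary half-plane contains \<open>0\<close> as well; away from
          \<open>0\<close> it is the negative of the first one.\<close>
        have "Im (- (u ^ k * z)) > 0 \<or> Im (- (u ^ k * z)) = 0 \<and> Re (- (u ^ k * z)) > 0" for k
        proof -
          define w where "w = u ^ k * z"
          have "\<not> (Im w > 0 \<or> Im w = 0 \<and> Re w > 0)" "w \<noteq> 0" using * orb nz unfolding w_def by blast+
          then show ?thesis unfolding w_def[symmetric] by (auto simp: complex_eq_iff)
        qed
        then have "(\<Sum>k<n. - (u ^ k * z)) \<noteq> 0" using n by (intro lex_positive_sum_nonzero) auto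
        then show False using sum0[of z] by (simp add: sum_negf)
      qed
    qed
  qed
  then show "negligible A" using negligible_subset negligible_sing by blast
qed simp

text \<open>Write \<open>w = v * v\<close>. The map \<open>z \<mapsto> w * cnj z\<close> reflects in
  the line through \<open>0\<close> and \<open>v\<close>, and \<open>Im (cnj v * z)\<close> is the
  signed distance to this line, which changes sign. A set on one side that equals its mirror image
  therefore lies on the axis.\<close>

lemma ms_set_reflection:
  fixes Y :: "complex set"
  assumes Y: "compact Y" "measure lborel Y > 0" and r: "r \<ge> 2" and w: "norm w = 1"
    and refl: "\<And>f. f \<in> carrier (Iso Y) \<Longrightarrow> f = id \<or> f = (\<lambda>z. w * cnj z)"
  shows "ms_set Y r = 0"
proof -
  define v where "v = csqrt w"
  have v2: "v * v = w" unfolding v_def by (metis power2_csqrt power2_eq_square)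
  have "norm v = 1" using w unfolding v_def by simp
  then have vv: "v * cnj v = 1" by (simp add: complex_norm_square[symmetric])
  have *: "Im (cnj v * (w * cnj z)) = - Im (cnj v * z)" for z
  proof -
    have "cnj v * (w * cnj z) = (v * cnj v) * (v * cnj z)" unfolding v2[symmetric] by (simp add: mult_ac)
    also have "\<dots> = cnj (cnj v * z)" by (simp add: vv)
    finally show ?thesis by (simp only: cnj.sel)
  qed
  show ?thesis
  proof (rule ms_set_eq_0I[OF Y r, where P = "\<lambda>z. Im (cnj v * z) > 0"])
    fix g :: "complex \<Rightarrow> complex" and A
    assume g: "g \<in> carrier (Iso Y)" "g \<noteq> id" "g ` A = A"
      and mono: "(\<forall>x\<in>A. Im (cnj v * x) > 0) \<or> (\<forall>x\<in>A. \<not> Im (cnj v * x) > 0)"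
    have gs: "g = (\<lambda>z. w * cnj z)" using refl g by blast
    \<comment> \<open>\<open>\<i> * v\<close> is normal to the axis, and its inner product with
      \<open>z\<close> is the signed distance.\<close>
    have "A \<subseteq> {z. (\<i> * v) \<bullet> z = 0}"
    proof
      fix z assume z: "z \<in> A"
      then have "w * cnj z \<in> A" using g(3) gs by blast
      then have "Im (cnj v * z) = 0" using mono *[of z] z by (smt (verit))
      then show "z \<in> {z. (\<i> * v) \<bullet> z = 0}" by (simp add: inner_complex_def algebra_simps)
    qed
    moreover have "negligible {z. (\<i> * v) \<bullet> z = 0}"
      using vv by (intro negligible_hyperplane) auto
    ultimately show "negligible A" using negligible_subset by blast
  qed simp
qed

section \<open>Recognition of dihedral groups\<close>

lemma cis_mod: "n > 0 \<Longrightarrow> cis (2 * pi * real_of_int (m mod int n) / real n) = cis (2 * pi * real_of_int m / real n)"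
proof -
  assume n: "n > 0"
  have "real_of_int m = real_of_int (m mod int n) + real n * real_of_int (m div int n)"
    by (metis mult_div_mod_eq add.commute of_int_add of_int_mult of_int_of_nat_eq)
  then have "2 * pi * real_of_int m / n = 2 * pi * real_of_int (m mod int n) / n + 2 * pi * real_of_int (m div int n)"
    using n by (simp add: field_simps)
  then have "cis (2 * pi * real_of_int m / n) = cis (2 * pi * real_of_int (m mod int n) / n) * cis (2 * pi * real_of_int (m div int n))"
    by (simp only: cis_mult)
  moreover have "cis (2 * pi * real_of_int (m div int n)) = 1" by (rule cis_multiple_2pi) simp
  ultimately show ?thesis by (simp only: mult_1_right)
qed

lemma finite_rotations_roots_of_unity:
  fixes U :: "complex set"
  assumes fin: "finite U" and ne: "U \<noteq> {}" and mult: "\<And>u v. u \<in> U \<Longrightarrow> v \<in> U \<Longrightarrow> u * v \<in> U" and nz: "0 \<notin> U"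
  shows "U = {z. z ^ card U = 1}"
proof -
  \<comment> \<open>Multiplication by \<open>u\<close> permutes \<open>U\<close>; compare the products of all elements.\<close>
  have pow: "u ^ card U = 1" if u: "u \<in> U" for u
  proof -
    have inj: "inj_on ((*) u) U" using u nz by (auto simp: inj_on_def)
    have "(*) u ` U = U" using endo_inj_surj[OF fin _ inj] mult u by blast
    then have "(\<Prod>v\<in>U. v) = (\<Prod>v\<in>U. u * v)" by (metis prod.reindex_cong[OF inj])
    also have "\<dots> = u ^ card U * (\<Prod>v\<in>U. v)" by (simp add: prod.distrib)
    finally show ?thesis using fin nz by auto
  qed
  have n: "card U > 0" using fin ne by (simp add: card_gt_0_iff)
  show ?thesis
  proof (rule card_subset_eq)
    show "finite {z::complex. z ^ card U = 1}" using n by (simp add: finite_roots_unity)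
    show "card U = card {z::complex. z ^ card U = 1}" using n by (simp add: card_roots_unity_eq)
  qed (use pow in auto)
qed

text \<open>The factors of the rotations form a finite multiplicative group \<open>U\<close>, hence
  are the \<open>n\<close>-th roots of unity, and \<open>n \<ge> 2\<close> because \<open>1\<close>
  and \<open>u0\<close> both occur. Every reflection is a rotation after the given one,
  \<open>u * cnj z = (u * cnj w) * (w * cnj z)\<close>, so the pair \<open>(i, True)\<close> stands
  for the given reflection followed by multiplication with \<open>\<rho> i\<close>.\<close>

lemma Iso_dihedral:
  fixes Y :: "complex set"
  assumes fin: "finite (carrier (Iso Y))" and fix0: "\<And>f. f \<in> carrier (Iso Y) \<Longrightarrow> f 0 = 0"
    and rot: "(\<lambda>z. u0 * z) \<in> carrier (Iso Y)" "u0 \<noteq> 1"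
    and refl: "(\<lambda>z. w * cnj z) \<in> carrier (Iso Y)" "norm w = 1"
  shows "\<exists>n\<ge>2. Iso Y \<cong> dihedral_group n"
proof -
  define U where "U = {u. (\<lambda>z. u * z) \<in> carrier (Iso Y)}"
  define n where "n = card U"
  have "inj_on (\<lambda>u z. u * z) U" by (auto simp: inj_on_def fun_eq_iff)
  then have finU: "finite U" using fin finite_imageD[of "\<lambda>u z. u * z" U] finite_subset[of "(\<lambda>u z. u * z) ` U"]
    by (auto simp: U_def)
  have Umult: "u * v \<in> U" if "u \<in> U" "v \<in> U" for u v
    using Iso_comp[of "\<lambda>z. u * z" Y "\<lambda>z. v * z"] that by (simp add: U_def comp_def) (simp add: mult.assoc[symmetric])
  have "(*) 1 = (id :: complex \<Rightarrow> complex)" by auto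
  then have U1: "1 \<in> U" "u0 \<in> U" using rot by (simp_all add: U_def) (simp add: Iso_def)
  have U0: "0 \<notin> U"
  proof
    assume "0 \<in> U"
    then have "(\<lambda>z::complex. 0 * z) \<in> carrier (Iso Y)" unfolding U_def by blast
    from Iso_D(2)[OF this, of 0 1] show False by simp
  qed
  have n2: "n \<ge> 2"
    using card_mono[OF finU, of "{1, u0}"] U1 rot(2) by (simp add: n_def)
  have Uroots: "U = {z. z ^ n = 1}"
    unfolding n_def using finU U1 Umult U0 by (intro finite_rotations_roots_of_unity) auto
  have bij: "bij_betw (\<lambda>k. cis (2 * pi * real k / real n)) {..<n} U"
    using Complex.bij_betw_roots_unity[of n] n2 Uroots by simp
  define \<rho> where "\<rho> i = cis (2 * pi * real_of_int i / real n)" for i :: int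
  have \<rho>U: "\<rho> i \<in> U" for i
  proof -
    have "nat (i mod int n) < n" using n2 by (simp add: nat_less_iff)
    then have "cis (2 * pi * real (nat (i mod int n)) / real n) \<in> U"
      using bij_betwE[OF bij] by blast
    moreover have "\<rho> i = cis (2 * pi * real (nat (i mod int n)) / real n)"
      using cis_mod[of n i] n2 by (simp add: \<rho>_def)
    ultimately show ?thesis by simp
  qed
  have \<rho>surj: "\<exists>i\<in>{0..<int n}. u = \<rho> i" if "u \<in> U" for u
  proof -
    from that bij obtain k where "k < n" "u = cis (2 * pi * real k / real n)"
      by (auto simp: bij_betw_def)
    then show ?thesis by (intro bexI[of _ "int k"]) (auto simp: \<rho>_def)
  qed
  have \<rho>inj: "i = j" if "\<rho> i = \<rho> j" "i \<in> {0..<int n}" "j \<in> {0..<int n}" for i j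
  proof -
    have "inj_on (\<lambda>k. cis (2 * pi * real k / real n)) {..<n}" using bij by (simp add: bij_betw_def)
    from inj_onD[OF this, of "nat i" "nat j"] that show ?thesis by (auto simp: \<rho>_def nat_less_iff)
  qed
  have \<rho>mod: "\<rho> (m mod int n) = \<rho> m" for m using cis_mod[of n m] n2 by (simp add: \<rho>_def)
  have \<rho>add: "\<rho> (i + j) = \<rho> i * \<rho> j" for i j
    by (simp add: \<rho>_def cis_mult add_divide_distrib distrib_left)
  have \<rho>cnj: "cnj (\<rho> i) = \<rho> (- i)" for i by (simp add: \<rho>_def cis_cnj)
  have ww: "w * cnj w = 1" using refl(2) by (simp add: complex_norm_square[symmetric])
  define \<Phi> where "\<Phi> = (\<lambda>(i, s). \<lambda>z. \<rho> i * (if s then w * cnj z else z))"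
  have \<Phi>mem: "\<Phi> x \<in> carrier (Iso Y)" for x
  proof -
    obtain i s where x: "x = (i, s)" by force
    have r: "(\<lambda>z. \<rho> i * z) \<in> carrier (Iso Y)" using \<rho>U[of i] by (simp add: U_def)
    show ?thesis
    proof (cases s)
      case True
      then show ?thesis using Iso_comp[OF r refl(1)] by (simp add: x \<Phi>_def comp_def)
    qed (use r in \<open>simp add: x \<Phi>_def\<close>)
  qed
  have "\<Phi> \<in> iso (dihedral_group n) (Iso Y)"
  proof (rule isoI)
    show "\<Phi> \<in> hom (dihedral_group n) (Iso Y)"
    proof (rule homI[OF \<Phi>mem])
      fix x y :: "int \<times> bool"
      obtain i s j t where xy: "x = (i, s)" "y = (j, t)" by force
      have "w * (cnj w * c) = c" for c using ww by (metis mult.assoc mult_1)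
      then show "\<Phi> (x \<otimes>\<^bsub>dihedral_group n\<^esub> y) = \<Phi> x \<otimes>\<^bsub>Iso Y\<^esub> \<Phi> y"
        using \<rho>add[of i "-j"] ww
        by (cases s; cases t) (auto simp: xy dihedral_group_def Iso_def \<Phi>_def \<rho>mod \<rho>add \<rho>cnj fun_eq_iff mult_ac)
    qed
    have "inj_on \<Phi> (carrier (dihedral_group n))"
    proof (rule inj_onI)
      fix x y assume xy: "x \<in> carrier (dihedral_group n)" "y \<in> carrier (dihedral_group n)" "\<Phi> x = \<Phi> y"
      obtain i s j t where e: "x = (i, s)" "y = (j, t)" by force
      have w0: "w \<noteq> 0" using refl by auto
      have \<rho>0: "\<rho> k \<noteq> 0" for k by (simp add: \<rho>_def)
      \<comment> \<open>The values at \<open>1\<close> and at \<open>\<i>\<close> separate the two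
        types: conjugation fixes \<open>1\<close> and negates \<open>\<i>\<close>, so equality at
        both points forces \<open>s = t\<close>.\<close>
      have 1: "\<rho> i * (if s then w else 1) = \<rho> j * (if t then w else 1)"
        using fun_cong[OF xy(3), of 1] by (auto simp: e \<Phi>_def split: if_splits)
      have "\<rho> i * (if s then - w else 1) * \<i> = \<rho> j * (if t then - w else 1) * \<i>"
        using fun_cong[OF xy(3), of \<i>] by (cases s; cases t) (simp_all add: e \<Phi>_def mult.assoc)
      then have 2: "\<rho> i * (if s then - w else 1) = \<rho> j * (if t then - w else 1)"
        unfolding mult_right_cancel[OF complex_i_not_zero] .
      have "s = t"
      proof (rule ccontr)
        assume "s \<noteq> t"
        then show False using 1 2 w0 \<rho>0[of i] \<rho>0[of j] by (cases s; cases t) auto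
      qed
      moreover have "\<rho> i = \<rho> j" using 1 \<open>s = t\<close> w0 by (cases t) auto
      ultimately show "x = y" using \<rho>inj[of i j] xy by (auto simp: e dihedral_group_def)
    qed
    moreover have "f \<in> \<Phi> ` carrier (dihedral_group n)" if f: "f \<in> carrier (Iso Y)" for f
      using f fix0[OF f]
    proof (cases rule: Iso_complex_cases)
      case (1 u)
      then have "u \<in> U" using f by (simp add: U_def)
      then obtain i where "i \<in> {0..<int n}" "u = \<rho> i" using \<rho>surj by blast
      then show ?thesis using 1 by (intro image_eqI[of _ _ "(i, False)"]) (auto simp: \<Phi>_def dihedral_group_def)
    next
      case (2 u)
      have "f \<circ> (\<lambda>z. w * cnj z) = (\<lambda>z. (u * cnj w) * z)" using 2 by (auto simp: mult_ac)
      then have "u * cnj w \<in> U" using Iso_comp[OF f refl(1)] by (simp add: U_def)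
      then obtain i where "i \<in> {0..<int n}" "u * cnj w = \<rho> i" using \<rho>surj by blast
      moreover have "u = (u * cnj w) * w" using ww by (simp add: mult_ac)
      ultimately show ?thesis using 2
        by (intro image_eqI[of _ _ "(i, True)"]) (auto simp: \<Phi>_def dihedral_group_def mult_ac)
    qed
    ultimately show "bij_betw \<Phi> (carrier (dihedral_group n)) (carrier (Iso Y))"
      using \<Phi>mem by (auto simp: bij_betw_def)
  qed
  then have "dihedral_group n \<cong> Iso Y" by (auto simp: is_iso_def)
  then have "Iso Y \<cong> dihedral_group n"
    using group.iso_sym[OF group_dihedral_group[of n]] n2 by simp
  with n2 show ?thesis by blast
qed

text \<open>Two reflections differ by a rotation. If there is a reflection and the group is not
  dihedral, then \<open>Iso_dihedral\<close> excludes nontrivial rotations, and only one reflection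
  remains. That group of order two is not among the dihedral groups with \<open>n \<ge> 2\<close>,
  which is why it belongs here.\<close>

lemma ms_set_not_dihedral:
  fixes Y :: "complex set"
  assumes Y: "compact Y" "measure lborel Y > 0" and r: "r \<ge> 2"
    and fin: "finite (carrier (Iso Y))" and fix0: "\<And>f. f \<in> carrier (Iso Y) \<Longrightarrow> f 0 = 0"
    and nd: "\<not> (\<exists>n\<ge>2. Iso Y \<cong> dihedral_group n)"
  shows "ms_set Y r = 0"
proof (cases "\<exists>w. norm w = 1 \<and> (\<lambda>z. w * cnj z) \<in> carrier (Iso Y)")
  case False
  show ?thesis
  proof (rule ms_set_rotations[OF Y r fin])
    fix f assume f: "f \<in> carrier (Iso Y)"
    then show "\<exists>u. norm u = 1 \<and> f = (\<lambda>z. u * z)"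
      using fix0[OF f]
    proof (cases rule: Iso_complex_cases)
      case (2 u)
      with f False show ?thesis by auto
    qed auto
  qed
next
  case True
  then obtain w where w: "norm w = 1" "(\<lambda>z. w * cnj z) \<in> carrier (Iso Y)" by blast
  then have ww: "w * cnj w = 1" by (simp add: complex_norm_square[symmetric])
  have rot: "u = 1" if "(\<lambda>z. u * z) \<in> carrier (Iso Y)" for u
  proof (rule ccontr)
    assume "u \<noteq> 1"
    have "\<exists>n\<ge>2. Iso Y \<cong> dihedral_group n"
      by (rule Iso_dihedral[where ?u0.0 = u and w = w]) (fact fin fix0 that \<open>u \<noteq> 1\<close> w)+
    with nd show False by blast
  qed
  show ?thesis
  proof (rule ms_set_reflection[OF Y r w(1)])
    fix f assume f: "f \<in> carrier (Iso Y)"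
    then show "f = id \<or> f = (\<lambda>z. w * cnj z)"
      using fix0[OF f]
    proof (cases rule: Iso_complex_cases)
      case (1 u)
      then show ?thesis using rot[of u] f by auto
    next
      case (2 u)
      have "f \<circ> (\<lambda>z. w * cnj z) = (\<lambda>z. (u * cnj w) * z)" using 2 by (auto simp: mult_ac)
      then have "u * cnj w = 1" using Iso_comp[OF f w(2)] rot by simp
      then have "u = w" using ww by (metis mult.assoc mult.commute mult_1)
      with 2 show ?thesis by simp
    qed
  qed
qed

section \<open>Finite symmetry groups and the product with the interval\<close>

text \<open>Inside colour \<open>c\<close>, the largest set invariant under \<open>g\<close>
  consists of the points all of whose forward iterates have colour \<open>c\<close>. Periodicity
  supplies the inverse as an iterate, so this set is mapped onto itself and not only into itself.
  Working with these sets removes the choice of \<open>A\<close> from the problem.\<close>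

lemma admissible_iff_stable:
  assumes "prob_space M"
    and meas: "\<And>g. g \<in> carrier G \<Longrightarrow> act g \<in> measurable M M"
    and per: "\<And>g. g \<in> carrier G \<Longrightarrow> \<exists>m>0. \<forall>x\<in>space M. (act g ^^ m) x = x"
  shows "admissible M G act r \<epsilon> \<longleftrightarrow>
    (\<forall>col \<in> measurable M (count_space {..<r}). \<exists>c<r. \<exists>g\<in>carrier G. g \<noteq> \<one>\<^bsub>G\<^esub> \<and>
        measure M {x\<in>space M. \<forall>k::nat. col ((act g ^^ k) x) = c} \<ge> \<epsilon>)"
proof -
  interpret prob_space M by fact
  have pow: "act g ^^ k \<in> measurable M M" if "g \<in> carrier G" for g k
    using meas[OF that] by (rule measurable_compose_n)
  have K: "{x\<in>space M. \<forall>k::nat. col ((act g ^^ k) x) = c} \<in> sets M"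
    if "col \<in> measurable M (count_space {..<r})" "g \<in> carrier G" for col g c
  proof -
    have "Measurable.pred M (\<lambda>x. col ((act g ^^ k) x) = c)" for k :: nat
      using measurable_compose[OF pow[OF that(2)] that(1)]
      by (rule pred_eq_const1) simp
    then show ?thesis by measurable
  qed
  have 1: "\<exists>A \<in> sets M. (\<forall>x\<in>A. col x = c) \<and> measure M A \<ge> \<epsilon> \<and> act g ` A = A"
    if col: "col \<in> measurable M (count_space {..<r})" and g: "g \<in> carrier G"
      and e: "measure M {x\<in>space M. \<forall>k::nat. col ((act g ^^ k) x) = c} \<ge> \<epsilon>" for col g c
  proof (intro bexI conjI)
    let ?K = "{x\<in>space M. \<forall>k::nat. col ((act g ^^ k) x) = c}"
    show "\<forall>x\<in>?K. col x = c" by (auto dest: spec[of _ 0])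
    show "measure M ?K \<ge> \<epsilon>" by fact
    show "?K \<in> sets M" using K col g by blast
    have sp: "(act g ^^ k) x \<in> space M" if "x \<in> space M" for x k
      using measurable_space[OF pow[OF g] that] .
    have step: "(act g ^^ j) x \<in> ?K" if "x \<in> ?K" for x j
      using that sp by (auto simp flip: comp_apply[of "act g ^^ _" "act g ^^ j"] funpow_add)
    obtain m where m: "m > 0" "\<forall>x\<in>space M. (act g ^^ m) x = x" using per[OF g] by blast
    show "act g ` ?K = ?K"
    proof
      show "act g ` ?K \<subseteq> ?K" using step[of _ 1] by auto
      show "?K \<subseteq> act g ` ?K"
      proof
        fix y assume y: "y \<in> ?K"
        then have "y = (act g ^^ Suc (m - 1)) y" using m by simp
        then have "y = act g ((act g ^^ (m - 1)) y)" by simp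
        then show "y \<in> act g ` ?K" using step[OF y, of "m - 1"] by blast
      qed
    qed
  qed
  have 2: "measure M {x\<in>space M. \<forall>k::nat. col ((act g ^^ k) x) = c} \<ge> \<epsilon>"
    if col: "col \<in> measurable M (count_space {..<r})" and g: "g \<in> carrier G"
      and A: "A \<in> sets M" "\<forall>x\<in>A. col x = c" "measure M A \<ge> \<epsilon>" "act g ` A = A" for col g c A
  proof -
    have "(act g ^^ k) x \<in> A" if "x \<in> A" for x k by (induction k) (use that A(4) in auto)
    then have "A \<subseteq> {x\<in>space M. \<forall>k::nat. col ((act g ^^ k) x) = c}"
      using A sets.sets_into_space[OF A(1)] by auto
    then have "measure M A \<le> measure M {x\<in>space M. \<forall>k::nat. col ((act g ^^ k) x) = c}"
      using K[OF col g] by (intro finite_measure_mono)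
    then show ?thesis using A by simp
  qed
  show ?thesis
  proof
    assume adm: "admissible M G act r \<epsilon>"
    show "\<forall>col \<in> measurable M (count_space {..<r}). \<exists>c<r. \<exists>g\<in>carrier G. g \<noteq> \<one>\<^bsub>G\<^esub> \<and>
        measure M {x\<in>space M. \<forall>k::nat. col ((act g ^^ k) x) = c} \<ge> \<epsilon>"
    proof
      fix col assume col: "col \<in> measurable M (count_space {..<r})"
      from adm[unfolded admissible_def, rule_format, OF col] obtain A c g where
        A: "A \<in> sets M" "c < r" "\<forall>x\<in>A. col x = c" "measure M A \<ge> \<epsilon>"
          "g \<in> carrier G" "g \<noteq> \<one>\<^bsub>G\<^esub>" "act g ` A = A" by auto
      show "\<exists>c<r. \<exists>g\<in>carrier G. g \<noteq> \<one>\<^bsub>G\<^esub> \<and> measure M {x\<in>space M. \<forall>k::nat. col ((act g ^^ k) x) = c} \<ge> \<epsilon>"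
        using 2[OF col A(5,1,3,4,7)] A(2,5,6) by blast
    qed
  next
    assume st: "\<forall>col \<in> measurable M (count_space {..<r}). \<exists>c<r. \<exists>g\<in>carrier G. g \<noteq> \<one>\<^bsub>G\<^esub> \<and>
        measure M {x\<in>space M. \<forall>k::nat. col ((act g ^^ k) x) = c} \<ge> \<epsilon>"
    show "admissible M G act r \<epsilon>"
      unfolding admissible_def
    proof
      fix col assume col: "col \<in> measurable M (count_space {..<r})"
      from st[rule_format, OF col] obtain c g where g: "c < r" "g \<in> carrier G" "g \<noteq> \<one>\<^bsub>G\<^esub>"
        "measure M {x\<in>space M. \<forall>k::nat. col ((act g ^^ k) x) = c} \<ge> \<epsilon>" by blast
      show "\<exists>A \<in> sets M. (\<exists>c<r. \<forall>x\<in>A. col x = c) \<and> measure M A \<ge> \<epsilon> \<and>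
          (\<exists>g \<in> carrier G. g \<noteq> \<one>\<^bsub>G\<^esub> \<and> act g ` A = A)"
        using 1[OF col g(2,4)] g(1-3) by blast
    qed
  qed
qed

text \<open>Quantile construction: the values are coded by distinct reals, the pseudoinverse
  \<open>q\<close> of the distribution function pushes the uniform law on the open interval to the
  law of the codes, and decoding gives \<open>w\<close>.\<close>

lemma realise_finite_law_on_interval:
  assumes "prob_space M" and V: "finite V" and v: "v \<in> measurable M (count_space V)"
  obtains w where "w \<in> measurable (restrict_space lborel {0..1::real}) (count_space V)"
    "\<And>B. B \<subseteq> V \<Longrightarrow> measure lborel {t\<in>{0..1}. w t \<in> B} = measure M {x\<in>space M. v x \<in> B}"
proof -
  interpret prob_space M by fact
  obtain x0 where "x0 \<in> space M" using not_empty by blast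
  then have v0: "v x0 \<in> V" using measurable_space[OF v] by simp
  obtain e :: "'b \<Rightarrow> nat" where e: "inj_on e V" using V finite_imp_inj_to_nat_seg by metis
  define e' where "e' a = real (e a)" for a
  have e': "inj_on e' V" using e by (auto simp: inj_on_def e'_def)
  have Z[measurable]: "(\<lambda>x. e' (v x)) \<in> borel_measurable M"
    using measurable_compose[OF v, of e' borel] by simp
  interpret L: real_distribution "distr M borel (\<lambda>x. e' (v x))"
    by (rule real_distribution_distr) simp
  interpret L: cdf_distribution "distr M borel (\<lambda>x. e' (v x))" ..
  let ?L = "distr M borel (\<lambda>x. e' (v x))"
  let ?\<Omega> = "restrict_space lborel {0<..<1::real}"
  define q where "q t = Inf {x. t \<le> cdf ?L x}" for t
  have qm: "q \<in> borel_measurable (restrict_space borel {0<..<1})"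
    using L.measurable_CI unfolding q_def .
  have qd: "distr ?\<Omega> borel q = ?L" using L.distr_I_eq_M unfolding q_def .
  \<comment> \<open>The default \<open>v x0\<close> covers the end points and the null set on which
    \<open>q\<close> misses the codes; it keeps every value in \<open>V\<close>.\<close>
  define w where "w t = (if t \<in> {0<..<1} \<and> q t \<in> e' ` V then inv_into V e' (q t) else v x0)" for t
  have wV: "w t \<in> V" for t using v0 by (auto simp: w_def inv_into_into)
  have qset: "{t\<in>{0<..<1}. q t \<in> S} \<in> sets borel" if "S \<in> sets borel" for S
    using measurable_sets[OF qm that] by (auto simp: sets_restrict_space_iff space_restrict_space vimage_def Int_def conj_commute)
  have mS: "measure lborel {t\<in>{0<..<1}. q t \<in> S} = measure M {x\<in>space M. e' (v x) \<in> S}"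
    if S: "S \<in> sets borel" for S
  proof -
    have qm': "q \<in> measurable ?\<Omega> borel" using qm by (simp add: measurable_def space_restrict_space sets_restrict_space)
    have "measure M {x\<in>space M. e' (v x) \<in> S} = measure ?L S"
      using S by (subst measure_distr) (auto simp: vimage_def Int_def conj_commute intro!: arg_cong[where f = "measure M"])
    also have "\<dots> = measure (distr ?\<Omega> borel q) S" by (simp only: qd)
    also have "\<dots> = measure ?\<Omega> (q -` S \<inter> space ?\<Omega>)" using S qm' by (intro measure_distr) auto
    also have "\<dots> = measure lborel (q -` S \<inter> space ?\<Omega>)"
      by (intro measure_restrict_space) (auto simp: space_restrict_space)
    also have "q -` S \<inter> space ?\<Omega> = {t\<in>{0<..<1}. q t \<in> S}" by (auto simp: space_restrict_space)
    finally show ?thesis by simp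
  qed
  have fin_borel: "S \<in> sets borel" if "finite S" for S :: "real set" using that by (simp add: borel_closed finite_imp_closed)
  have wB: "w t \<in> B \<longleftrightarrow> (if t \<in> {0<..<1} \<and> q t \<in> e' ` V then q t \<in> e' ` B else v x0 \<in> B)"
    if "B \<subseteq> V" for B t
  proof (cases "t \<in> {0<..<1} \<and> q t \<in> e' ` V")
    case True
    then obtain a where a: "a \<in> V" "q t = e' a" by blast
    then have "inv_into V e' (q t) \<in> B \<longleftrightarrow> q t \<in> e' ` B"
      using that e' by (simp add: inv_into_f_f inj_on_image_mem_iff)
    then show ?thesis using True by (simp only: w_def if_True simp_thms)
  next
    case False
    then show ?thesis by (simp only: w_def if_False)
  qed
  let ?QV = "{t\<in>{0<..<1}. q t \<in> e' ` V}"
  have wset: "{t. w t \<in> B} \<in> sets borel" if "B \<subseteq> V" for B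
  proof -
    have fB: "finite B" using that V finite_subset by blast
    have eq: "{t. w t \<in> B} = {t\<in>{0<..<1}. q t \<in> e' ` B} \<union>
        (if v x0 \<in> B then - ?QV else {})"
      using wB[OF that] image_mono[OF that, of e'] by (auto split: if_splits)
    have "{t\<in>{0<..<1}. q t \<in> e' ` B} \<in> sets borel" using fB by (intro qset fin_borel finite_imageI)
    moreover have "?QV \<in> sets borel" using V by (intro qset fin_borel finite_imageI)
    ultimately show ?thesis unfolding eq by simp
  qed
  have "measure lborel {t\<in>{0..1}. w t \<in> B} = measure M {x\<in>space M. v x \<in> B}" if B: "B \<subseteq> V" for B
  proof -
    have fB: "finite B" using that V finite_subset by blast
    have full: "measure lborel ?QV = 1"
    proof -
      have "{x\<in>space M. e' (v x) \<in> e' ` V} = space M" using measurable_space[OF v] by auto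
      then show ?thesis using mS[of "e' ` V"] V fin_borel by (simp add: prob_space)
    qed
    have Vs: "?QV \<in> sets borel" using V by (intro qset fin_borel finite_imageI)
    define NV where "NV = {0..1} - ?QV"
    have NVs: "NV \<in> sets lborel" using Vs by (simp add: NV_def)
    have nn: "emeasure lborel NV = 0"
    proof -
      have "measure lborel NV = measure lborel {0..1::real} - measure lborel ?QV"
        unfolding NV_def using Vs by (intro measure_Diff) auto
      then have "measure lborel NV = 0" using full by simp
      moreover have "NV \<in> fmeasurable lborel"
        by (rule fmeasurableI2[of "{0..1}"]) (use NVs in \<open>auto simp: fmeasurable_compact NV_def\<close>)
      ultimately show ?thesis by (simp add: emeasure_eq_measure2)
    qed
    have "emeasure lborel {t\<in>{0..1}. w t \<in> B} = emeasure lborel {t\<in>{0<..<1}. q t \<in> e' ` B}"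
    proof (rule emeasure_eq_AE)
      have "AE t in lborel. t \<notin> NV"
        using nn NVs by (intro AE_not_in) (simp add: null_sets_def)
      then show "AE t in lborel. t \<in> {t\<in>{0..1}. w t \<in> B} \<longleftrightarrow> t \<in> {t\<in>{0<..<1}. q t \<in> e' ` B}"
      proof eventually_elim
        case (elim t)
        then show ?case using wB[OF B, of t] image_mono[OF B, of e'] unfolding NV_def
          by (auto split: if_splits)
      qed
    next
      have "{t\<in>{0..1}. w t \<in> B} = {0..1} \<inter> {t. w t \<in> B}" by auto
      then show "{t\<in>{0..1}. w t \<in> B} \<in> sets lborel" using wset[OF B] by simp
      show "{t\<in>{0<..<1}. q t \<in> e' ` B} \<in> sets lborel" unfolding sets_lborel using fB by (intro qset fin_borel finite_imageI)
    qed
    then have "measure lborel {t\<in>{0..1}. w t \<in> B} = measure lborel {t\<in>{0<..<1}. q t \<in> e' ` B}"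
      by (simp add: measure_def)
    also have "\<dots> = measure M {x\<in>space M. e' (v x) \<in> e' ` B}" using fB by (intro mS fin_borel) auto
    also have "{x\<in>space M. e' (v x) \<in> e' ` B} = {x\<in>space M. v x \<in> B}"
      using inj_on_image_mem_iff[OF e' _ B] measurable_space[OF v] by (intro Collect_cong) auto
    finally show ?thesis .
  qed
  moreover have "w \<in> measurable (restrict_space lborel {0..1::real}) (count_space V)"
    unfolding measurable_count_space_eq2[OF V]
  proof (intro conjI ballI)
    fix a assume "a \<in> V"
    then have "{t. w t \<in> {a}} \<in> sets borel" by (intro wset) simp
    then have "{0..1} \<inter> {t. w t \<in> {a}} \<in> sets (restrict_space lborel {0..1})"
      by (auto simp: sets_restrict_space)
    then show "w -` {a} \<inter> space (restrict_space lborel {0..1}) \<in> sets (restrict_space lborel {0..1})"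
      by (simp add: space_restrict_space vimage_def Int_commute)
  qed (use wV in auto)
  ultimately show ?thesis using that by blast
qed

text \<open>The bisector is an affine hyperplane with normal \<open>b - a\<close>. Coincidences of
  two isometries and the borders of Dirichlet cells are enclosed in such sets.\<close>

lemma negligible_bisector:
  fixes a b :: "'a::euclidean_space"
  assumes "a \<noteq> b"
  shows "negligible {x. dist x a = dist x b}"
proof -
  have "{x. dist x a = dist x b} = {x. (2 *\<^sub>R (b - a)) \<bullet> x = b \<bullet> b - a \<bullet> a}"
  proof (intro Collect_cong)
    fix x
    have "dist x a = dist x b \<longleftrightarrow> (dist x a)\<^sup>2 = (dist x b)\<^sup>2" by simp
    also have "\<dots> \<longleftrightarrow> (x - a) \<bullet> (x - a) = (x - b) \<bullet> (x - b)" by (simp only: dist_norm power2_norm_eq_inner)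
    also have "\<dots> \<longleftrightarrow> (2 *\<^sub>R (b - a)) \<bullet> x = b \<bullet> b - a \<bullet> a"
      by (simp add: inner_diff_left inner_diff_right inner_commute algebra_simps)
    finally show "dist x a = dist x b \<longleftrightarrow> (2 *\<^sub>R (b - a)) \<bullet> x = b \<bullet> b - a \<bullet> a" .
  qed
  then show ?thesis using assms negligible_hyperplane[of "2 *\<^sub>R (b - a)" "b \<bullet> b - a \<bullet> a"] by simp
qed

text \<open>Probability integral transform. Without atoms the distribution function is continuous,
  so it takes the value \<open>t\<close> at its pseudoinverse \<open>I t\<close>, and
  \<open>cdf L x < t\<close> describes the half-line below \<open>I t\<close>, of measure
  \<open>t\<close>.\<close>

lemma cdf_transform_uniform:
  assumes "real_distribution L" and atomless: "\<And>x. measure L {x} = 0" and B: "B \<in> sets borel"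
  shows "measure L {x. cdf L x \<in> B} = measure lborel (B \<inter> {0..1})"
proof -
  interpret real_distribution L by fact
  interpret cdf_distribution L ..
  have Cc: "isCont (cdf L) x" for x using atomless by (simp add: isCont_cdf)
  have C01: "0 \<le> cdf L x" "cdf L x \<le> 1" for x using cdf_nonneg cdf_bounded_prob by auto
  define I where "I t = Inf {x. t \<le> cdf L x}" for t
  have ps: "t \<le> cdf L x \<longleftrightarrow> I t \<le> x" if "0 < t" "t < 1" for t x
    using pseudoinverse[of t x] that by (simp add: I_def)
  have CI: "cdf L (I t) = t" if t: "0 < t" "t < 1" for t
  proof (rule antisym)
    \<comment> \<open>Left of \<open>I t\<close> the distribution function is at most
      \<open>t\<close>; continuity carries this over to \<open>I t\<close>.\<close>
    have "eventually (\<lambda>x. cdf L x \<le> t) (at_left (I t))"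
      unfolding eventually_at_left_field
    proof (intro exI[of _ "I t - 1"] conjI allI impI)
      fix y assume "y < I t"
      then show "cdf L y \<le> t" using ps[OF t, of y] by linarith
    qed simp
    moreover have "(cdf L \<longlongrightarrow> cdf L (I t)) (at_left (I t))"
      using Cc[of "I t"] by (simp add: isCont_def filterlim_at_split)
    ultimately show "cdf L (I t) \<le> t"
      using tendsto_upperbound[OF _ _ trivial_limit_at_left_real] by metis
    show "t \<le> cdf L (I t)" using ps[OF t] by simp
  qed
  have less: "measure L {x. cdf L x < t} = t" if t: "0 < t" "t < 1" for t
  proof -
    have "{x. cdf L x < t} = {..<I t}"
    proof (rule Set.set_eqI)
      fix x show "x \<in> {x. cdf L x < t} \<longleftrightarrow> x \<in> {..<I t}" using ps[OF t, of x] by auto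
    qed
    moreover have "measure L {..I t} = measure L ({..<I t} \<union> {I t})"
      by (intro arg_cong[where f = "measure L"]) auto
    then have "measure L {..I t} = measure L {..<I t} + measure L {I t}"
      using finite_measure_Union[of "{..<I t}" "{I t}"] by simp
    ultimately show ?thesis using CI[OF t] atomless by (simp add: cdf_def)
  qed
  let ?D = "distr L borel (cdf L)" and ?U = "uniform_measure lborel {0..1::real}"
  have Cm: "cdf L \<in> borel_measurable L" using measurable_C by simp
  have mD: "measure ?D S = measure L {x. cdf L x \<in> S}" if "S \<in> sets borel" for S
    using Cm that by (subst measure_distr) (auto simp: vimage_def)
  have mU: "measure ?U S = measure lborel (S \<inter> {0..1})" if "S \<in> sets borel" for S
    using that by (subst measure_uniform_measure) (auto simp: Int_commute)
  have Cset: "{x. cdf L x \<in> S} \<in> sets L" if "S \<in> sets borel" for S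
    using measurable_sets[OF Cm that] by (simp add: vimage_def)
  have pU: "prob_space ?U" by (rule prob_space_uniform_measure) auto
  have "?D = ?U"
  proof (intro cdf_unique ext)
    show "real_distribution ?D" using Cm by (rule real_distribution_distr)
    show "real_distribution ?U" using pU by (simp add: real_distribution_def real_distribution_axioms_def)
    fix s
    have D: "cdf ?D s = measure L {x. cdf L x \<le> s}" using mD[of "{..s}"] by (simp add: cdf_def[of ?D])
    have U: "cdf ?U s = measure lborel ({..s} \<inter> {0..1})" unfolding cdf_def[of ?U] by (rule mU) simp
    \<comment> \<open>The measure of \<open>cdf L x \<le> s\<close> is squeezed from above by
      letting \<open>t\<close> decrease to \<open>s\<close>.\<close>
    have up: "cdf ?D s \<le> t" if "s < t" "0 < t" "t < 1" for t
    proof -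
      have "measure L {x. cdf L x \<le> s} \<le> measure L {x. cdf L x < t}"
        using that Cset[of "{..<t}"] by (intro finite_measure_mono) auto
      then show ?thesis using less that by (simp add: D)
    qed
    consider "s < 0" | "s = 0" | "0 < s" "s < 1" | "s \<ge> 1" by linarith
    then show "cdf ?D s = cdf ?U s"
    proof cases
      case 1
      then have "{x. cdf L x \<le> s} = {}" "{..s} \<inter> {0..1} = {}" using C01 by (auto simp: not_le intro: less_le_trans)
      then show ?thesis by (simp only: D U measure_empty)
    next
      case 2
      have "cdf ?D s \<le> 0"
      proof (rule dense_ge_bounded[of 0 1])
        fix t :: real assume "0 < t" "t < 1"
        then show "cdf ?D s \<le> t" using up[of t] 2 by simp
      qed simp
      moreover have "{..s} \<inter> {0..1} = {0}" using 2 by auto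
      ultimately show ?thesis using D U by (simp add: measure_nonneg order_antisym)
    next
      case 3
      have "cdf ?D s \<le> s"
      proof (rule dense_ge_bounded[of s 1])
        fix t :: real assume "s < t" "t < 1"
        then show "cdf ?D s \<le> t" using up[of t] 3 by simp
      qed (use 3 in simp)
      moreover have "s \<le> cdf ?D s"
      proof -
        have "measure L {x. cdf L x < s} \<le> measure L {x. cdf L x \<le> s}"
          using Cset[of "{..s}"] by (intro finite_measure_mono) auto
        then show ?thesis using less 3 by (simp add: D)
      qed
      moreover have "{..s} \<inter> {0..1} = {0..s}" using 3 by auto
      ultimately show ?thesis using U 3 by simp
    next
      case 4
      then have "{x. cdf L x \<le> s} = UNIV" "{..s} \<inter> {0..1} = {0..1}" using C01(2) order_trans by auto
      then show ?thesis using D U prob_space by simp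
    qed
  qed
  then show ?thesis using mD[OF B] mU[OF B] by simp
qed

section \<open>The product of a finite group with the interval\<close>

abbreviation "I01 \<equiv> restrict_space lborel {0..1::real}"

abbreviation group_interval :: "('g, 'm) monoid_scheme \<Rightarrow> ('g \<times> real) measure" where
  "group_interval G \<equiv> uniform_count_measure (carrier G) \<Otimes>\<^sub>M I01"

lemma prob_space_unit_interval: "prob_space I01"
  by (rule prob_spaceI) (simp add: emeasure_restrict_space space_restrict_space)

lemma prob_space_group_interval:
  assumes "finite (carrier G)" "carrier G \<noteq> {}"
  shows "prob_space (group_interval G)"
  by (intro prob_space_pair prob_space_uniform_count_measure prob_space_unit_interval assms)

lemma space_group_interval [simp]: "space (group_interval G) = carrier G \<times> {0..1}"
  by (simp add: space_pair_measure space_uniform_count_measure space_restrict_space)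

lemma measurable_group_interval:
  assumes "finite (carrier G)" "\<And>h. h \<in> carrier G \<Longrightarrow> (\<lambda>t. f (h, t)) \<in> measurable I01 K"
  shows "f \<in> measurable (group_interval G) K"
proof -
  have "f \<in> measurable (count_space (carrier G) \<Otimes>\<^sub>M I01) K"
    using assms by (intro measurable_pair_measure_countable1) (auto intro: countable_finite)
  moreover have "sets (group_interval G) = sets (count_space (carrier G) \<Otimes>\<^sub>M I01)"
    by (intro sets_pair_measure_cong) (simp_all add: sets_uniform_count_measure)
  ultimately show ?thesis using measurable_cong_sets[of "group_interval G" _ K K] by blast
qed

lemma measure_group_interval:
  assumes fin: "finite (carrier G)" "carrier G \<noteq> {}" and E: "E \<in> sets (group_interval G)"
  shows "measure (group_interval G) E = (\<Sum>h\<in>carrier G. measure lborel {t\<in>{0..1}. (h, t) \<in> E}) / card (carrier G)"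
    and "h \<in> carrier G \<Longrightarrow> {t\<in>{0..1}. (h, t) \<in> E} \<in> sets borel"
proof -
  let ?S = "\<lambda>h. {t\<in>{0..1}. (h, t) \<in> E}"
  interpret I: prob_space "I01" by (rule prob_space_unit_interval)
  have sp: "E \<subseteq> carrier G \<times> {0..1}" using sets.sets_into_space[OF E] by simp
  have vim: "Pair h -` E = (?S h)" for h using sp by auto
  have sl: "(?S h) \<in> sets I01" for h
    using sets_Pair1[OF E, of h] by (simp add: vim)
  then show "(?S h) \<in> sets borel" for h
    by (subst (asm) sets_restrict_space_iff) auto
  have em: "emeasure I01 (?S h) = ennreal (measure lborel (?S h))" for h
  proof -
    have "emeasure I01 (?S h) = ennreal (measure I01 (?S h))"
      by (rule I.emeasure_eq_measure)
    also have "measure I01 (?S h) = measure lborel (?S h)"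
      by (intro measure_restrict_space) auto
    finally show ?thesis .
  qed
  have "emeasure (group_interval G) E = (\<integral>\<^sup>+h. ennreal (measure lborel (?S h)) \<partial>uniform_count_measure (carrier G))"
    using I.emeasure_pair_measure_alt[OF E] by (simp only: vim em)
  also have "\<dots> = (\<Sum>h\<in>carrier G. ennreal (1 / card (carrier G)) * ennreal (measure lborel (?S h)))"
    unfolding uniform_count_measure_def using fin by (subst nn_integral_point_measure_finite) auto
  also have "\<dots> = ennreal ((\<Sum>h\<in>carrier G. measure lborel (?S h)) / card (carrier G))"
    by (simp add: ennreal_mult[symmetric] sum_ennreal sum_divide_distrib divide_ennreal[symmetric] mult.commute flip: ennreal_mult')
  finally show "measure (group_interval G) E = (\<Sum>h\<in>carrier G. measure lborel (?S h)) / card (carrier G)"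
    by (simp add: measure_def sum_nonneg)
qed

text \<open>\<open>H\<close> is an abstract copy of the symmetry group, because the comparison is
  with the product over \<open>dihedral_group\<close>, whose elements are pairs and not
  isometries.\<close>

locale finite_symmetry =
  fixes Y :: "complex set" and H :: "('g, 'm) monoid_scheme" and \<psi> :: "(complex \<Rightarrow> complex) \<Rightarrow> 'g"
  assumes Y: "compact Y" "measure lborel Y > 0"
    and fin: "finite (carrier (Iso Y))" and fix0: "\<And>f. f \<in> carrier (Iso Y) \<Longrightarrow> f 0 = 0"
    and H: "group H" and iso: "\<psi> \<in> iso (Iso Y) H"
begin

sublocale H: group H by (rule H)

abbreviation "GY \<equiv> carrier (Iso Y)"

lemma \<psi>_mem: "f \<in> GY \<Longrightarrow> \<psi> f \<in> carrier H"
  using iso by (auto simp: iso_def hom_def)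

lemma \<psi>_comp: "f \<in> GY \<Longrightarrow> g \<in> GY \<Longrightarrow> \<psi> (f \<circ> g) = \<psi> f \<otimes>\<^bsub>H\<^esub> \<psi> g"
  using iso by (auto simp: iso_def hom_def Iso_def)

lemma \<psi>_bij: "bij_betw \<psi> GY (carrier H)"
  using iso by (auto simp: iso_def)

lemma id_Iso: "id \<in> GY" by (simp add: Iso_def)

lemma \<psi>_id: "\<psi> id = \<one>\<^bsub>H\<^esub>"
  using \<psi>_comp[OF id_Iso id_Iso] \<psi>_mem[OF id_Iso] by (simp add: H.r_cancel_one')

lemma \<psi>_pow: "f \<in> GY \<Longrightarrow> \<psi> (f ^^ k) = \<psi> f [^]\<^bsub>H\<^esub> k"
proof (induction k)
  case 0
  then show ?case using \<psi>_id by (simp add: id_def)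
next
  case (Suc k)
  have "\<psi> (f ^^ Suc k) = \<psi> ((f ^^ k) \<circ> f)" by (simp only: funpow_Suc_right)
  also have "\<dots> = \<psi> f [^]\<^bsub>H\<^esub> k \<otimes>\<^bsub>H\<^esub> \<psi> f" using Suc by (simp add: \<psi>_comp Iso_funpow)
  finally show ?case by (simp only: H.nat_pow_Suc)
qed

lemma finite_H: "finite (carrier H)" "carrier H \<noteq> {}"
  using bij_betw_finite[OF \<psi>_bij] fin H.one_closed by auto

definition \<phi> where "\<phi> = inv_into GY \<psi>"

lemma \<phi>_mem: "h \<in> carrier H \<Longrightarrow> \<phi> h \<in> GY"
  unfolding \<phi>_def using \<psi>_bij by (metis bij_betw_def inv_into_into)

lemma \<psi>_\<phi>: "h \<in> carrier H \<Longrightarrow> \<psi> (\<phi> h) = h"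
  unfolding \<phi>_def using \<psi>_bij by (simp add: bij_betw_inv_into_right)

lemma \<phi>_\<psi>: "f \<in> GY \<Longrightarrow> \<phi> (\<psi> f) = f"
  unfolding \<phi>_def using \<psi>_bij by (simp add: bij_betw_inv_into_left)

lemma \<phi>_pow_mult:
  assumes "f \<in> GY" "h \<in> carrier H"
  shows "\<phi> (\<psi> f [^]\<^bsub>H\<^esub> k \<otimes>\<^bsub>H\<^esub> h) = (f ^^ k) \<circ> \<phi> h"
proof -
  have "\<psi> ((f ^^ k) \<circ> \<phi> h) = \<psi> f [^]\<^bsub>H\<^esub> k \<otimes>\<^bsub>H\<^esub> h"
    using assms by (simp add: \<psi>_comp \<psi>_pow Iso_funpow \<phi>_mem \<psi>_\<phi>)
  then show ?thesis using assms \<phi>_\<psi>[of "(f ^^ k) \<circ> \<phi> h"] by (simp add: Iso_comp Iso_funpow \<phi>_mem)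
qed

lemma Y_borel: "Y \<in> sets borel" using Y by (simp add: borel_compact)

abbreviation "MY \<equiv> normalized_lebesgue Y"
abbreviation "MH \<equiv> group_interval H"
text \<open>The maximal invariant sets of colour \<open>c\<close> from
  \<open>admissible_iff_stable\<close>, for the two spaces to be compared.\<close>

abbreviation "stableY col f c \<equiv> {x\<in>space MY. \<forall>k::nat. col ((f ^^ k) x) = c}"
abbreviation "stableH col g c \<equiv> {x\<in>space MH. \<forall>k::nat. col (((\<lambda>(h, t). (g \<otimes>\<^bsub>H\<^esub> h, t)) ^^ k) x) = c}"

lemma act_pow:
  fixes t :: real
  assumes "g \<in> carrier H" "h \<in> carrier H"
  shows "((\<lambda>(h, t). (g \<otimes>\<^bsub>H\<^esub> h, t)) ^^ k) (h, t) = (g [^]\<^bsub>H\<^esub> k \<otimes>\<^bsub>H\<^esub> h, t)"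
proof (induction k)
  case (Suc k)
  have "g \<otimes>\<^bsub>H\<^esub> (g [^]\<^bsub>H\<^esub> k \<otimes>\<^bsub>H\<^esub> h) = g [^]\<^bsub>H\<^esub> Suc k \<otimes>\<^bsub>H\<^esub> h"
    using assms by (simp only: H.nat_pow_Suc2 H.m_assoc H.nat_pow_closed)
  with Suc show ?case by (simp del: H.nat_pow_Suc)
qed (use assms in simp)

lemma act_measurable:
  assumes "g \<in> carrier H"
  shows "(\<lambda>(h, t). (g \<otimes>\<^bsub>H\<^esub> h, t)) \<in> measurable MH MH"
proof (rule measurable_group_interval[OF finite_H(1)])
  fix h assume h: "h \<in> carrier H"
  have "Pair (g \<otimes>\<^bsub>H\<^esub> h) \<in> measurable I01 MH"
    using assms h by (intro measurable_Pair1') (simp add: space_uniform_count_measure)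
  then show "(\<lambda>t. case (h, t) of (h, t) \<Rightarrow> (g \<otimes>\<^bsub>H\<^esub> h, t)) \<in> measurable I01 MH"
    by simp
qed

lemma stableY_sets:
  assumes "col \<in> measurable MY (count_space {..<r})" "f \<in> GY"
  shows "stableY col f c \<in> sets MY"
proof -
  have "Measurable.pred MY (\<lambda>x. col ((f ^^ k) x) = c)" for k :: nat
    using measurable_compose[OF measurable_Iso_complex[OF Y_borel Iso_funpow[OF assms(2)]] assms(1)]
    by (rule pred_eq_const1) simp
  then show ?thesis by measurable
qed

lemma stableH_sets:
  assumes "col \<in> measurable MH (count_space {..<r})" "g \<in> carrier H"
  shows "stableH col g c \<in> sets MH"
proof -
  have "Measurable.pred MH (\<lambda>x. col (((\<lambda>(h, t). (g \<otimes>\<^bsub>H\<^esub> h, t)) ^^ k) x) = c)" for k :: nat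
    using measurable_compose[OF measurable_compose_n[OF act_measurable[OF assms(2)]] assms(1)]
    by (rule pred_eq_const1) simp
  then show ?thesis by measurable
qed

lemma measure_stableH:
  assumes "col \<in> measurable MH (count_space {..<r})" "g \<in> carrier H"
  shows "measure MH (stableH col g c) =
    (\<Sum>h\<in>carrier H. measure lborel {t\<in>{0..1}. \<forall>k::nat. col (g [^]\<^bsub>H\<^esub> k \<otimes>\<^bsub>H\<^esub> h, t) = c}) / card (carrier H)"
proof -
  have "{t\<in>{0..1}. (h, t) \<in> stableH col g c} = {t\<in>{0..1}. \<forall>k::nat. col (g [^]\<^bsub>H\<^esub> k \<otimes>\<^bsub>H\<^esub> h, t) = c}"
    if "h \<in> carrier H" for h
    using that act_pow[OF assms(2) that] by auto
  then show ?thesis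
    using measure_group_interval(1)[OF finite_H stableH_sets[OF assms, of c]] by (simp cong: sum.cong)
qed

lemma measure_Iso_invariant:
  assumes "f \<in> GY" "S \<in> sets MY"
  shows "measure MY {x\<in>Y. f x \<in> S} = measure MY S"
proof -
  have "measure MY S = measure (distr MY MY f) S"
    by (simp only: distr_Iso_complex[OF Y_borel assms(1)])
  also have "\<dots> = measure MY (f -` S \<inter> space MY)"
    using assms measurable_Iso_complex[OF Y_borel assms(1)] by (intro measure_distr)
  also have "f -` S \<inter> space MY = {x\<in>Y. f x \<in> S}" by auto
  finally show ?thesis by simp
qed

text \<open>
  The sizes of the stable sets only depend on the law of \<open>x \<mapsto> (h \<mapsto> col (h x))\<close>, which takes values in
  a finite set and can therefore be realised on the interval.
\<close>

lemma colouring_Y_to_H: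
  fixes r :: nat
  assumes col: "col \<in> measurable MY (count_space {..<r})"
  shows "\<exists>col'\<in>measurable MH (count_space {..<r}). \<forall>f\<in>GY. \<forall>c.
     measure MH (stableH col' (\<psi> f) c) = measure MY (stableY col f c)"
proof -
  define V where "V = (carrier H \<rightarrow>\<^sub>E {..<r})"
  have V: "finite V" unfolding V_def by (rule finite_PiE[OF finite_H(1)]) simp
  \<comment> \<open>The colour profile of \<open>x\<close>: the colours of its whole orbit, indexed
    by the group.\<close>
  define v where "v x = restrict (\<lambda>h. col (\<phi> h x)) (carrier H)" for x
  have colr: "col x < r" if "x \<in> Y" for x using measurable_space[OF col, of x] that by simp
  have vV: "v x \<in> V" if "x \<in> Y" for x
    using that colr Iso_D(5)[OF \<phi>_mem] by (auto simp: v_def V_def)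
  have v: "v \<in> measurable MY (count_space V)"
    unfolding measurable_count_space_eq2[OF V]
  proof (intro conjI ballI)
    fix a assume a: "a \<in> V"
    have "v x = a \<longleftrightarrow> (\<forall>h\<in>carrier H. col (\<phi> h x) = a h)" for x
      using a by (auto simp: v_def V_def fun_eq_iff restrict_def PiE_iff extensional_def)
    then have "v -` {a} \<inter> space MY = {x\<in>space MY. \<forall>h\<in>carrier H. col (\<phi> h x) = a h}" by auto
    also have "\<dots> \<in> sets MY"
    proof (rule sets.sets_Collect_finite_All'[OF _ finite_H])
      fix h assume "h \<in> carrier H"
      then have "Measurable.pred MY (\<lambda>x. col (\<phi> h x) = a h)"
        using measurable_compose[OF measurable_Iso_complex[OF Y_borel \<phi>_mem] col]
        by (intro pred_eq_const1[where N = "count_space {..<r}"]) auto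
      then show "{x\<in>space MY. col (\<phi> h x) = a h} \<in> sets MY" by measurable
    qed
    finally show "v -` {a} \<inter> space MY \<in> sets MY" .
  qed (use vV in auto)
  obtain w where w: "w \<in> measurable I01 (count_space V)"
    "\<And>B. B \<subseteq> V \<Longrightarrow> measure lborel {t\<in>{0..1}. w t \<in> B} = measure MY {x\<in>space MY. v x \<in> B}"
    using realise_finite_law_on_interval[OF prob_space_normalized_lebesgue[OF Y] V v] by blast
  have wV: "w t \<in> V" if "t \<in> {0..1}" for t using measurable_space[OF w(1), of t] that by (simp add: space_restrict_space)
  define col' where "col' = (\<lambda>(h, t). w t h)"
  have col': "col' \<in> measurable MH (count_space {..<r})"
  proof (rule measurable_group_interval[OF finite_H(1)])
    fix h assume "h \<in> carrier H"
    then have "(\<lambda>a. a h) \<in> measurable (count_space V) (count_space {..<r})" by (auto simp: V_def)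
    from measurable_compose[OF w(1) this]
    show "(\<lambda>t. col' (h, t)) \<in> measurable I01 (count_space {..<r})"
      by (simp add: col'_def)
  qed
  have "measure MH (stableH col' (\<psi> f) c) = measure MY (stableY col f c)"
    if f: "f \<in> GY" for f c
  proof -
    \<comment> \<open>Every slice has the same measure: the profile of \<open>x\<close> lies in
      \<open>B\<close> exactly when \<open>\<phi> h x\<close> is stable, and \<open>\<phi> h\<close>
      preserves the measure. The average over \<open>h\<close> is therefore this common
      value.\<close>
    have "measure lborel {t\<in>{0..1}. \<forall>k::nat. col' (\<psi> f [^]\<^bsub>H\<^esub> k \<otimes>\<^bsub>H\<^esub> h, t) = c} = measure MY (stableY col f c)"
      if h: "h \<in> carrier H" for h
    proof -
      define B where "B = {a\<in>V. \<forall>k::nat. a (\<psi> f [^]\<^bsub>H\<^esub> k \<otimes>\<^bsub>H\<^esub> h) = c}"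
      have "{t\<in>{0..1}. \<forall>k::nat. col' (\<psi> f [^]\<^bsub>H\<^esub> k \<otimes>\<^bsub>H\<^esub> h, t) = c} = {t\<in>{0..1}. w t \<in> B}"
        using wV by (auto simp: B_def col'_def)
      then have "measure lborel {t\<in>{0..1}. \<forall>k::nat. col' (\<psi> f [^]\<^bsub>H\<^esub> k \<otimes>\<^bsub>H\<^esub> h, t) = c} = measure MY {x\<in>space MY. v x \<in> B}"
        using w(2)[of B] by (simp add: B_def)
      also have "{x\<in>space MY. v x \<in> B} = {x\<in>Y. \<phi> h x \<in> stableY col f c}"
      proof (intro Collect_cong conj_cong)
        fix x assume x: "x \<in> Y"
        have "\<psi> f [^]\<^bsub>H\<^esub> (k::nat) \<otimes>\<^bsub>H\<^esub> h \<in> carrier H" for k using f h \<psi>_mem by simp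
        then have "v x (\<psi> f [^]\<^bsub>H\<^esub> k \<otimes>\<^bsub>H\<^esub> h) = col ((f ^^ k) (\<phi> h x))" for k :: nat
          using \<phi>_pow_mult[OF f h, of k] by (simp add: v_def)
        then show "(v x \<in> B) = (\<phi> h x \<in> stableY col f c)"
          using vV[OF x] Iso_D(5)[OF \<phi>_mem[OF h] x] by (simp add: B_def)
      qed simp
      also have "measure MY \<dots> = measure MY (stableY col f c)"
        by (intro measure_Iso_invariant \<phi>_mem h stableY_sets[OF col f])
      finally show ?thesis .
    qed
    then have "measure MH (stableH col' (\<psi> f) c) =
       (\<Sum>h\<in>carrier H. measure MY (stableY col f c)) / card (carrier H)"
      using measure_stableH[OF col' \<psi>_mem[OF f]] by simp
    then show ?thesis using finite_H by simp
  qed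
  with col' show ?thesis by blast
qed


text \<open>If \<open>f x = g x\<close>, then the isometry \<open>h\<close>, the inverse of
  \<open>f\<close> after \<open>g\<close>, fixes \<open>x\<close>; for any \<open>q\<close> moved by
  \<open>h\<close>, the point \<open>x\<close> is equidistant from \<open>q\<close> and
  \<open>h q\<close>. Each of finitely many pairs thus excludes a null set. The orbit of such a
  \<open>p\<close> has one point for each group element, so its Dirichlet cells can be indexed by
  the group.\<close>

lemma generic_point: "\<exists>p. \<forall>f\<in>GY. \<forall>g\<in>GY. f \<noteq> g \<longrightarrow> f p \<noteq> g p"
proof -
  define P where "P = {(f, g). f \<in> GY \<and> g \<in> GY \<and> f \<noteq> g}"
  have finP: "finite P" by (rule finite_subset[of _ "GY \<times> GY"]) (auto simp: P_def fin)
  have "negligible {x. f x = g x}" if f: "f \<in> GY" and g: "g \<in> GY" and ne: "f \<noteq> g" for f g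
  proof -
    define h where "h = inv_into UNIV f \<circ> g"
    have h: "h \<in> GY" unfolding h_def using f g by (intro Iso_comp Iso_inv)
    have bf: "bij f" using Iso_D(1)[OF f] .
    obtain q where q: "f q \<noteq> g q" using ne by auto
    have hq: "h q \<noteq> q" using q bf by (auto simp: h_def) (metis bij_inv_eq_iff)
    have "{x. f x = g x} \<subseteq> {x. dist x q = dist x (h q)}"
    proof safe
      fix x assume "f x = g x"
      then have "h x = x" using bf by (simp add: h_def) (metis bij_inv_eq_iff)
      then show "dist x q = dist x (h q)" using Iso_D(2)[OF h, of x q] by simp
    qed
    then show ?thesis using negligible_bisector[of q "h q"] hq negligible_subset by metis
  qed
  then have "negligible (\<Union>(f, g)\<in>P. {x. f x = g x})"
    using finP by (intro negligible_Union) (auto simp: P_def)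
  then have "(\<Union>(f, g)\<in>P. {x. f x = g x}) \<noteq> UNIV" using non_negligible_UNIV by metis
  then obtain p where "p \<notin> (\<Union>(f, g)\<in>P. {x. f x = g x})" by auto
  then show ?thesis by (auto simp: P_def)
qed

text \<open>
  The Dirichlet cells of the orbit of a generic point give an equivariant map \<open>\<eta>\<close> to the group, and
  the distribution function of the norm gives an invariant coordinate \<open>T\<close> with uniform law. As \<open>T\<close> is
  invariant and the group permutes the cells, the two are independent.
\<close>

lemma colouring_H_to_Y:
  fixes r :: nat
  assumes col: "col \<in> measurable MH (count_space {..<r})"
  shows "\<exists>col'\<in>measurable MY (count_space {..<r}). \<forall>f\<in>GY. \<forall>c.
     measure MY (stableY col' f c) = measure MH (stableH col (\<psi> f) c)"
proof -
  interpret MY: prob_space MY by (rule prob_space_normalized_lebesgue[OF Y])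
  obtain p where p: "\<And>f g. f \<in> GY \<Longrightarrow> g \<in> GY \<Longrightarrow> f \<noteq> g \<Longrightarrow> f p \<noteq> g p" using generic_point by blast
  \<comment> \<open>Dirichlet cell of the orbit point \<open>f p\<close> inside \<open>Y\<close>.
    The strict inequality makes different cells disjoint; ties lie on finitely many bisectors and
    form a null set.\<close>
  define R where "R f = {x\<in>Y. \<forall>g\<in>GY. g \<noteq> f \<longrightarrow> dist x (f p) < dist x (g p)}" for f
  have R_sets: "R f \<in> sets MY" for f
  proof -
    have "R f = {x\<in>space borel. x \<in> Y} \<inter> (\<Inter>g\<in>GY - {f}. {x. dist x (f p) < dist x (g p)})" by (auto simp: R_def)
    also have "\<dots> \<in> sets borel"
    proof (cases "GY - {f} = {}")
      case True
      then show ?thesis using Y_borel by (simp only: True) simp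
    next
      case False
      have "(\<Inter>g\<in>GY - {f}. {x. dist x (f p) < dist x (g p)}) \<in> sets borel"
        using fin False by (intro sets.finite_INT) auto
      then show ?thesis using Y_borel by simp
    qed
    finally show ?thesis using Y_borel by (auto simp: sets_normalized_lebesgue R_def)
  qed
  have R_disj: "f = g" if "x \<in> R f" "x \<in> R g" "f \<in> GY" "g \<in> GY" for f g x
    using that by (force simp: R_def)
  have R_equiv1: "g x \<in> R (g \<circ> f)" if x: "x \<in> R f" and f: "f \<in> GY" and g: "g \<in> GY" for x f g
  proof -
    have bg: "bij g" using Iso_D(1)[OF g] .
    have "dist (g x) ((g \<circ> f) p) < dist (g x) (f' p)" if f': "f' \<in> GY" "f' \<noteq> g \<circ> f" for f'
    proof -
      define h where "h = inv_into UNIV g \<circ> f'"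
      have "h \<in> GY" unfolding h_def using f' g by (intro Iso_comp Iso_inv)
      moreover have gh: "g \<circ> h = f'" using bg by (auto simp: h_def fun_eq_iff bij_is_surj surj_f_inv_f)
      then have "h \<noteq> f" using f' by auto
      ultimately have "dist x (f p) < dist x (h p)" using x by (simp add: R_def)
      then show ?thesis using Iso_D(2)[OF g] unfolding gh[symmetric] by simp
    qed
    then show ?thesis using x Iso_D(5)[OF g] by (auto simp: R_def)
  qed
  have R_equiv: "g x \<in> R (g \<circ> f) \<longleftrightarrow> x \<in> R f" if f: "f \<in> GY" and g: "g \<in> GY" for x f g
  proof
    assume "g x \<in> R (g \<circ> f)"
    from R_equiv1[OF this Iso_comp[OF g f] Iso_inv[OF g]]
    show "x \<in> R f" using Iso_D(1)[OF g] by (simp add: bij_is_inj flip: comp_assoc)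
  qed (use R_equiv1 f g in blast)
  have cover: "AE x in MY. \<exists>f\<in>GY. x \<in> R f"
  proof (rule AE_I')
    define N where "N = Y - (\<Union>f\<in>GY. R f)"
    define P where "P = {(f, g). f \<in> GY \<and> g \<in> GY \<and> f \<noteq> g}"
    have finP: "finite P" by (rule finite_subset[of _ "GY \<times> GY"]) (auto simp: P_def fin)
    have "negligible (\<Union>(f, g)\<in>P. {x. dist x (f p) = dist x (g p)})"
      using finP p by (intro negligible_Union) (auto simp: P_def intro!: negligible_bisector)
    moreover have "N \<subseteq> (\<Union>(f, g)\<in>P. {x. dist x (f p) = dist x (g p)})"
    proof
      fix x assume x: "x \<in> N"
      obtain f where f: "f \<in> GY" "\<And>g. g \<in> GY \<Longrightarrow> dist x (f p) \<le> dist x (g p)"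
        using arg_min_if_finite[OF fin, of "\<lambda>f. dist x (f p)"] id_Iso by (metis empty_iff linorder_not_less)
      moreover have "x \<notin> R f" "x \<in> Y" using x f by (auto simp: N_def)
      ultimately obtain g where g: "g \<in> GY" "g \<noteq> f" "dist x (g p) \<le> dist x (f p)"
        by (auto simp: R_def not_less)
      then have "dist x (f p) = dist x (g p)" using f(2)[OF g(1)] by simp
      then show "x \<in> (\<Union>(f, g)\<in>P. {x. dist x (f p) = dist x (g p)})" using f g by (auto simp: P_def)
    qed
    moreover have N: "N \<in> sets MY"
      unfolding N_def using R_sets fin sets.top[of MY] by (intro sets.Diff sets.finite_UN) auto
    ultimately have "measure MY N = 0" using measure_negligible_subset[OF Y_borel] by blast
    then show "N \<in> null_sets MY" using N by (simp add: null_sets_def MY.emeasure_eq_measure)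
    show "{x\<in>space MY. \<not> (\<exists>f\<in>GY. x \<in> R f)} \<subseteq> N" by (auto simp: N_def)
  qed
  define L where "L = distr MY borel norm"
  have nm: "norm \<in> borel_measurable MY" by (rule measurable_normalized_lebesgue_borel) simp
  have L: "real_distribution L" unfolding L_def using nm by (rule MY.real_distribution_distr)
  define T where "T x = cdf L (norm x)" for x :: complex
  interpret L: real_distribution L by (rule L)
  have T01: "T x \<in> {0..1}" for x using L.cdf_nonneg L.cdf_bounded_prob by (simp add: T_def)
  have cm: "cdf L \<in> borel_measurable borel"
    by (intro borel_measurable_mono monoI L.cdf_nondecreasing)
  have Tb: "T \<in> borel_measurable MY" unfolding T_def using measurable_compose[OF nm cm] .
  have Tinv: "T (f x) = T x" if "f \<in> GY" for f x
    using Iso_D(2)[OF that, of x 0] fix0[OF that] by (simp add: T_def)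
  have Tset: "{x\<in>Y. T x \<in> B} \<in> sets MY" if "B \<in> sets borel" for B
    using measurable_sets[OF Tb that] by (simp add: vimage_def Int_def conj_commute)
  have Tlaw: "measure MY {x\<in>Y. T x \<in> B} = measure lborel (B \<inter> {0..1})" if B: "B \<in> sets borel" for B
  proof -
    \<comment> \<open>The law of the norm has no atoms because circles are null sets in the
      plane.\<close>
    have atom: "measure L {s} = 0" for s
    proof -
      have "measure L {s} = measure MY (norm -` {s} \<inter> space MY)"
        unfolding L_def using nm by (intro measure_distr) auto
      moreover have "norm -` {s} \<inter> space MY \<subseteq> sphere 0 s" by auto
      moreover have "negligible (sphere (0::complex) s)"
        using negligible_convex_frontier[of "cball (0::complex) s"] by simp
      moreover have "norm -` {s} \<inter> space MY \<in> sets MY" using measurable_sets[OF nm, of "{s}"] by simp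
      ultimately show ?thesis using measure_negligible_subset[OF Y_borel] by simp
    qed
    have "{s. cdf L s \<in> B} \<in> sets borel" using measurable_sets[OF cm B] by (simp add: vimage_def)
    then have "measure L {s. cdf L s \<in> B} = measure MY (norm -` {s. cdf L s \<in> B} \<inter> space MY)"
      unfolding L_def using nm by (intro measure_distr)
    also have "norm -` {s. cdf L s \<in> B} \<inter> space MY = {x\<in>Y. T x \<in> B}" by (auto simp: T_def)
    finally show ?thesis using cdf_transform_uniform[OF L atom B] by simp
  qed
  have RT_sets: "{x\<in>R f. T x \<in> B} \<in> sets MY" if "B \<in> sets borel" for f B
  proof -
    have "{x\<in>R f. T x \<in> B} = R f \<inter> {x\<in>Y. T x \<in> B}" by (auto simp: R_def)
    then show ?thesis using R_sets Tset[OF that] by simp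
  qed
  have indep: "measure MY {x\<in>R f. T x \<in> B} = measure lborel (B \<inter> {0..1}) / card GY"
    if B: "B \<in> sets borel" and f: "f \<in> GY" for B f
  proof -
    \<comment> \<open>\<open>f\<close> carries \<open>R id\<close> onto \<open>R f\<close> and
      preserves both \<open>T\<close> and the measure, so all cells receive the same share of each
      event \<open>T x \<in> B\<close>.\<close>
    have eq: "measure MY {x\<in>R f. T x \<in> B} = measure MY {x\<in>R id. T x \<in> B}" if f: "f \<in> GY" for f
    proof -
      have "{x\<in>Y. f x \<in> {x\<in>R f. T x \<in> B}} = {x\<in>R id. T x \<in> B}"
        using R_equiv[OF id_Iso f] Tinv[OF f] by (auto simp: R_def)
      then show ?thesis using measure_Iso_invariant[OF f RT_sets[OF B], of f] by simp
    qed
    have "measure lborel (B \<inter> {0..1}) = measure MY {x\<in>Y. T x \<in> B}" using Tlaw[OF B] by simp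
    also have "\<dots> = measure MY (\<Union>f\<in>GY. {x\<in>R f. T x \<in> B})"
    proof (rule MY.finite_measure_eq_AE)
      show "AE x in MY. (x \<in> {x\<in>Y. T x \<in> B}) = (x \<in> (\<Union>f\<in>GY. {x\<in>R f. T x \<in> B}))"
        using cover AE_space by eventually_elim (auto simp: R_def)
    qed (use RT_sets[OF B] Tset[OF B] fin in auto)
    also have "\<dots> = (\<Sum>f\<in>GY. measure MY {x\<in>R f. T x \<in> B})"
      using fin RT_sets[OF B] R_disj by (intro MY.finite_measure_finite_Union) (auto simp: disjoint_family_on_def)
    also have "\<dots> = card GY * measure MY {x\<in>R id. T x \<in> B}" using eq by simp
    finally show ?thesis using eq[OF f] fin id_Iso by (auto simp: field_simps card_eq_0_iff)
  qed
  \<comment> \<open>On the null set outside the cells \<open>\<eta>\<close> defaults to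
    \<open>id\<close>, which keeps its values in the group.\<close>
  define \<eta> where "\<eta> x = (if \<exists>f\<in>GY. x \<in> R f then THE f. f \<in> GY \<and> x \<in> R f else id)" for x
  have \<eta>R: "\<eta> x = f" if "x \<in> R f" "f \<in> GY" for x f
  proof -
    have "(THE f. f \<in> GY \<and> x \<in> R f) = f" using that R_disj by (intro the_equality) blast+
    then show ?thesis using that by (auto simp: \<eta>_def)
  qed
  have \<eta>G: "\<eta> x \<in> GY" for x
  proof (cases "\<exists>f\<in>GY. x \<in> R f")
    case True
    then show ?thesis using \<eta>R by blast
  qed (simp add: \<eta>_def id_Iso)
  have \<eta>m: "\<eta> \<in> measurable MY (count_space GY)"
    unfolding measurable_count_space_eq2[OF fin]
  proof (intro conjI ballI)
    fix f assume f: "f \<in> GY"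
    have "\<eta> -` {f} \<inter> space MY = R f \<union> (if f = id then Y - (\<Union>f\<in>GY. R f) else {})"
    proof (intro Set.set_eqI)
      fix x
      show "x \<in> \<eta> -` {f} \<inter> space MY \<longleftrightarrow> x \<in> R f \<union> (if f = id then Y - (\<Union>f\<in>GY. R f) else {})"
      proof (cases "\<exists>g\<in>GY. x \<in> R g")
        case True
        then obtain g where "g \<in> GY" "x \<in> R g" by blast
        then show ?thesis using \<eta>R[of x g] R_disj[of x f g] f by (auto simp: R_def)
      next
        case False
        then show ?thesis using f by (auto simp: \<eta>_def)
      qed
    qed
    then show "\<eta> -` {f} \<inter> space MY \<in> sets MY"
      using R_sets fin sets.top[of MY] by (auto intro!: sets.Un sets.Diff sets.finite_UN)
  qed (use \<eta>G in auto)
  \<comment> \<open>\<open>\<theta>\<close> maps to the product of the group with the interval,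
    preserves the measure and intertwines the actions almost everywhere, so colourings can be pulled
    back along it.\<close>
  define \<theta> where "\<theta> x = (\<psi> (\<eta> x), T x)" for x
  have \<theta>m: "\<theta> \<in> measurable MY MH"
    unfolding \<theta>_def
  proof (rule measurable_Pair)
    have "(\<lambda>x. \<psi> (\<eta> x)) \<in> measurable MY (count_space (carrier H))"
      by (rule measurable_compose[OF \<eta>m]) (auto simp: \<psi>_mem)
    then show "(\<lambda>x. \<psi> (\<eta> x)) \<in> measurable MY (uniform_count_measure (carrier H))"
      using measurable_cong_sets[of MY MY "uniform_count_measure (carrier H)" "count_space (carrier H)"]
      by (simp add: sets_uniform_count_measure)
    show "T \<in> measurable MY I01"
      using Tb T01 by (intro measurable_restrict_space2) auto
  qed
  have \<theta>law: "measure MY {x\<in>Y. \<theta> x \<in> E} = measure MH E" if E: "E \<in> sets MH" for E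
  proof -
    define S where "S h = {t\<in>{0..1}. (h, t) \<in> E}" for h
    have Sb: "S h \<in> sets borel" if "h \<in> carrier H" for h
      unfolding S_def using measure_group_interval(2)[OF finite_H E that] .
    have "measure MY {x\<in>Y. \<theta> x \<in> E} = measure MY (\<Union>f\<in>GY. {x\<in>R f. T x \<in> S (\<psi> f)})"
    proof (rule MY.finite_measure_eq_AE)
      show "AE x in MY. (x \<in> {x\<in>Y. \<theta> x \<in> E}) = (x \<in> (\<Union>f\<in>GY. {x\<in>R f. T x \<in> S (\<psi> f)}))"
        using cover AE_space
      proof eventually_elim
        case (elim x)
        then obtain f where f: "f \<in> GY" "x \<in> R f" by blast
        have "x \<in> (\<Union>f\<in>GY. {x\<in>R f. T x \<in> S (\<psi> f)}) \<longleftrightarrow> T x \<in> S (\<psi> f)" using f R_disj by blast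
        then show ?case using elim \<eta>R[OF f(2,1)] T01 by (simp add: \<theta>_def S_def)
      qed
      show "{x\<in>Y. \<theta> x \<in> E} \<in> sets MY" using measurable_sets[OF \<theta>m E] by (simp add: vimage_def Int_def conj_commute)
      show "(\<Union>f\<in>GY. {x\<in>R f. T x \<in> S (\<psi> f)}) \<in> sets MY"
        using fin Sb \<psi>_mem by (intro sets.finite_UN RT_sets) auto
    qed
    also have "\<dots> = (\<Sum>f\<in>GY. measure MY {x\<in>R f. T x \<in> S (\<psi> f)})"
    proof (rule MY.finite_measure_finite_Union[OF fin])
      show "(\<lambda>f. {x\<in>R f. T x \<in> S (\<psi> f)}) ` GY \<subseteq> sets MY" using Sb \<psi>_mem RT_sets by blast
      show "disjoint_family_on (\<lambda>f. {x\<in>R f. T x \<in> S (\<psi> f)}) GY"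
        using R_disj unfolding disjoint_family_on_def by blast
    qed
    also have "\<dots> = (\<Sum>f\<in>GY. measure lborel (S (\<psi> f)) / card GY)"
    proof (rule sum.cong[OF refl])
      fix f assume f: "f \<in> GY"
      have "S (\<psi> f) \<inter> {0..1} = S (\<psi> f)" by (auto simp: S_def)
      then show "measure MY {x\<in>R f. T x \<in> S (\<psi> f)} = measure lborel (S (\<psi> f)) / card GY"
        using indep[OF Sb[OF \<psi>_mem[OF f]] f] by simp
    qed
    also have "\<dots> = (\<Sum>h\<in>carrier H. measure lborel (S h) / card GY)"
      by (rule sum.reindex_bij_betw[OF \<psi>_bij])
    also have "\<dots> = measure MH E"
      unfolding measure_group_interval(1)[OF finite_H E] S_def bij_betw_same_card[OF \<psi>_bij]
      by (rule sum_divide_distrib[symmetric])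
    finally show ?thesis .
  qed
  define col' where "col' x = col (\<theta> x)" for x
  have col': "col' \<in> measurable MY (count_space {..<r})"
    unfolding col'_def using measurable_compose[OF \<theta>m col] .
  have "measure MY (stableY col' f c) = measure MH (stableH col (\<psi> f) c)"
    if f: "f \<in> GY" for f c
  proof -
    have st: "stableH col (\<psi> f) c \<in> sets MH" using stableH_sets[OF col \<psi>_mem[OF f]] .
    have "measure MY (stableY col' f c) = measure MY {x\<in>Y. \<theta> x \<in> stableH col (\<psi> f) c}"
    proof (rule MY.finite_measure_eq_AE)
      show "AE x in MY. (x \<in> stableY col' f c) = (x \<in> {x\<in>Y. \<theta> x \<in> stableH col (\<psi> f) c})"
        using cover AE_space
      proof eventually_elim
        case (elim x)
        then obtain g where g: "g \<in> GY" "x \<in> R g" by blast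
        have "col' ((f ^^ k) x) = col (\<psi> f [^]\<^bsub>H\<^esub> k \<otimes>\<^bsub>H\<^esub> \<psi> g, T x)" for k
        proof -
          have "(f ^^ k) x \<in> R ((f ^^ k) \<circ> g)" using R_equiv1[OF g(2,1) Iso_funpow[OF f]] .
          then have "\<eta> ((f ^^ k) x) = (f ^^ k) \<circ> g" using \<eta>R Iso_comp[OF Iso_funpow[OF f] g(1)] by blast
          then have "\<psi> (\<eta> ((f ^^ k) x)) = \<psi> f [^]\<^bsub>H\<^esub> k \<otimes>\<^bsub>H\<^esub> \<psi> g"
            using f g by (simp only: \<psi>_comp \<psi>_pow Iso_funpow)
          then show ?thesis using Tinv[OF Iso_funpow[OF f]] by (simp add: col'_def \<theta>_def)
        qed
        moreover have "\<theta> x = (\<psi> g, T x)" using \<eta>R[OF g(2,1)] by (simp add: \<theta>_def)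
        ultimately show ?case
          using elim act_pow[OF \<psi>_mem[OF f] \<psi>_mem[OF g(1)]] \<psi>_mem[OF g(1)] T01[of x] by simp
      qed
      show "stableY col' f c \<in> sets MY" using stableY_sets[OF col' f] .
      show "{x\<in>Y. \<theta> x \<in> stableH col (\<psi> f) c} \<in> sets MY"
        using measurable_sets[OF \<theta>m st] by (simp only: vimage_def Int_def space_normalized_lebesgue mem_Collect_eq conj_commute)
    qed
    then show ?thesis using \<theta>law[OF st] by simp
  qed
  with col' show ?thesis by blast
qed

text \<open>The order \<open>m\<close> of the group is a common period, so both sides become
  statements about stable sets. A colouring on one side is transferred to the other, where
  admissibility applies, and the measure found there is carried back; \<open>\<psi>\<close> and
  \<open>\<phi>\<close> keep the group element nontrivial.\<close>

lemma ms_set_eq_group_interval: "ms_set Y r = ms_group_interval H r"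
  unfolding ms_set_def ms_group_interval_def
proof (rule ms_cong)
  fix \<epsilon> :: real
  define m where "m = order H"
  have m: "m > 0" using finite_H by (simp add: m_def order_def card_gt_0_iff)
  have pow1: "g [^]\<^bsub>H\<^esub> m = \<one>\<^bsub>H\<^esub>" if "g \<in> carrier H" for g
    using that by (simp add: m_def H.pow_order_eq_1)
  have perY: "f ^^ m = id" if f: "f \<in> GY" for f
  proof -
    have "\<psi> (f ^^ m) = \<psi> id" using \<psi>_pow[OF f] pow1[OF \<psi>_mem[OF f]] \<psi>_id by simp
    then show ?thesis using \<psi>_bij Iso_funpow[OF f] id_Iso unfolding bij_betw_def inj_on_def by blast
  qed
  have one: "\<psi> f = \<one>\<^bsub>H\<^esub> \<longleftrightarrow> f = id" if "f \<in> GY" for f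
    using \<psi>_bij that id_Iso \<psi>_id unfolding bij_betw_def inj_on_def by metis
  have oneI: "\<one>\<^bsub>Iso Y\<^esub> = id" by (simp add: Iso_def)
  have A: "admissible MY (Iso Y) (\<lambda>f x. f x) r \<epsilon> \<longleftrightarrow>
    (\<forall>col \<in> measurable MY (count_space {..<r}). \<exists>c<r. \<exists>f\<in>GY. f \<noteq> \<one>\<^bsub>Iso Y\<^esub> \<and>
        measure MY (stableY col f c) \<ge> \<epsilon>)"
  proof (rule admissible_iff_stable[OF prob_space_normalized_lebesgue[OF Y]])
    fix f assume f: "f \<in> GY"
    show "f \<in> measurable MY MY" using measurable_Iso_complex[OF Y_borel f] .
    show "\<exists>m>0. \<forall>x\<in>space MY. (f ^^ m) x = x" using m perY[OF f] by auto
  qed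
  have B: "admissible MH H (\<lambda>g (h, t). (g \<otimes>\<^bsub>H\<^esub> h, t)) r \<epsilon> \<longleftrightarrow>
    (\<forall>col \<in> measurable MH (count_space {..<r}). \<exists>c<r. \<exists>g\<in>carrier H. g \<noteq> \<one>\<^bsub>H\<^esub> \<and>
        measure MH (stableH col g c) \<ge> \<epsilon>)"
  proof (rule admissible_iff_stable[OF prob_space_group_interval[OF finite_H]])
    fix g assume g: "g \<in> carrier H"
    show "(\<lambda>(h, t). (g \<otimes>\<^bsub>H\<^esub> h, t)) \<in> measurable MH MH"
      using act_measurable[OF g] .
    show "\<exists>m>0. \<forall>x\<in>space MH. ((\<lambda>(h, t). (g \<otimes>\<^bsub>H\<^esub> h, t)) ^^ m) x = x"
      using m act_pow[OF g] pow1[OF g] by (intro exI[of _ m]) auto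
  qed
  show "admissible MY (Iso Y) (\<lambda>f x. f x) r \<epsilon> \<longleftrightarrow>
      admissible MH H (\<lambda>g (h, t). (g \<otimes>\<^bsub>H\<^esub> h, t)) r \<epsilon>"
    unfolding A B
  proof (intro iffI ballI)
    fix col assume *: "\<forall>col \<in> measurable MY (count_space {..<r}). \<exists>c<r. \<exists>f\<in>GY. f \<noteq> \<one>\<^bsub>Iso Y\<^esub> \<and>
        measure MY (stableY col f c) \<ge> \<epsilon>" and col: "col \<in> measurable MH (count_space {..<r})"
    obtain col' where col': "col' \<in> measurable MY (count_space {..<r})"
      "\<forall>f\<in>GY. \<forall>c. measure MY (stableY col' f c) = measure MH (stableH col (\<psi> f) c)"
      using colouring_H_to_Y[OF col] by blast
    obtain c f where "c < r" "f \<in> GY" "f \<noteq> \<one>\<^bsub>Iso Y\<^esub>" "measure MY (stableY col' f c) \<ge> \<epsilon>"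
      using *[rule_format, OF col'(1)] by blast
    then show "\<exists>c<r. \<exists>g\<in>carrier H. g \<noteq> \<one>\<^bsub>H\<^esub> \<and> measure MH (stableH col g c) \<ge> \<epsilon>"
      using col'(2) one oneI \<psi>_mem by (intro exI[of _ c] conjI bexI[of _ "\<psi> f"]) auto
  next
    fix col assume *: "\<forall>col \<in> measurable MH (count_space {..<r}). \<exists>c<r. \<exists>g\<in>carrier H. g \<noteq> \<one>\<^bsub>H\<^esub> \<and>
        measure MH (stableH col g c) \<ge> \<epsilon>" and col: "col \<in> measurable MY (count_space {..<r})"
    obtain col' where col': "col' \<in> measurable MH (count_space {..<r})"
      "\<forall>f\<in>GY. \<forall>c. measure MH (stableH col' (\<psi> f) c) = measure MY (stableY col f c)"
      using colouring_Y_to_H[OF col] by blast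
    obtain c g where g: "c < r" "g \<in> carrier H" "g \<noteq> \<one>\<^bsub>H\<^esub>" "measure MH (stableH col' g c) \<ge> \<epsilon>"
      using *[rule_format, OF col'(1)] by blast
    have "measure MY (stableY col (\<phi> g) c) \<ge> \<epsilon>"
      using g(4) col'(2)[rule_format, OF \<phi>_mem[OF g(2)], of c] \<psi>_\<phi>[OF g(2)] by simp
    moreover have "\<phi> g \<noteq> id" using one[OF \<phi>_mem[OF g(2)]] \<psi>_\<phi>[OF g(2)] g(3) by simp
    ultimately show "\<exists>c<r. \<exists>f\<in>GY. f \<noteq> \<one>\<^bsub>Iso Y\<^esub> \<and> measure MY (stableY col f c) \<ge> \<epsilon>"
      using g \<phi>_mem[OF g(2)] oneI by (intro exI[of _ c] conjI bexI[of _ "\<phi> g"]) auto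
  qed
qed

end

section \<open>Infinite symmetry groups\<close>

lemma rotation_IsoI:
  fixes Y :: "complex set"
  assumes u: "norm u = 1" and Y: "\<And>y. y \<in> Y \<Longrightarrow> u * y \<in> Y" "\<And>y. y \<in> Y \<Longrightarrow> cnj u * y \<in> Y"
  shows "(\<lambda>z. u * z) \<in> carrier (Iso Y)"
proof -
  have uu: "u * cnj u = 1" using u by (simp add: complex_norm_square[symmetric])
  have 1: "u * (cnj u * z) = z" "cnj u * (u * z) = z" for z
    using uu by (simp_all add: mult.assoc[symmetric] mult.commute[of "cnj u" u])
  have "bij (\<lambda>z. u * z)" by (rule o_bij[of "\<lambda>z. cnj u * z"]) (auto simp: fun_eq_iff 1)
  moreover have "(\<lambda>z. u * z) ` Y = Y"
  proof
    show "Y \<subseteq> (\<lambda>z. u * z) ` Y"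
    proof
      fix y assume "y \<in> Y"
      then show "y \<in> (\<lambda>z. u * z) ` Y" using Y(2) 1(1)[of y] by (intro image_eqI[of _ _ "cnj u * y"]) auto
    qed
  qed (use Y in auto)
  moreover have "dist (u * x) (u * y) = dist x y" for x y
    using u by (simp add: dist_norm norm_mult flip: right_diff_distrib)
  ultimately show ?thesis by (simp add: Iso_def)
qed

lemma rotation_cnj:
  fixes Y :: "complex set"
  assumes "(\<lambda>z. u * z) \<in> carrier (Iso Y)"
  shows "norm u = 1" "(\<lambda>z. cnj u * z) \<in> carrier (Iso Y)" "y \<in> Y \<Longrightarrow> u * y \<in> Y" "y \<in> Y \<Longrightarrow> cnj u * y \<in> Y"
proof -
  note D = Iso_D[OF assms]
  show u: "norm u = 1" using D(2)[of 1 0] by simp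
  then have uu: "u * cnj u = 1" by (simp add: complex_norm_square[symmetric])
  show 1: "y \<in> Y \<Longrightarrow> u * y \<in> Y" for y using D(5) by blast
  show 2: "y \<in> Y \<Longrightarrow> cnj u * y \<in> Y" for y
  proof -
    assume "y \<in> Y"
    then obtain x where "x \<in> Y" "y = u * x" using D(3) by blast
    then show ?thesis using uu by (simp add: mult.assoc[symmetric] mult.commute[of "cnj u" u])
  qed
  show "(\<lambda>z. cnj u * z) \<in> carrier (Iso Y)" using u 1 2 by (intro rotation_IsoI) auto
qed

text \<open>The reflections are contained in one coset of the rotations, so infinitely many
  rotations preserve \<open>Y\<close>. Their factors accumulate on the unit circle, quotients of
  nearby factors are arbitrarily close to \<open>1\<close>, and the powers of a small rotation come
  close to every point of the circle. As \<open>Y\<close> is closed, the limits preserve it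
  too.\<close>

lemma infinite_Iso_rotations:
  fixes Y :: "complex set"
  assumes Y: "compact Y" and inf: "infinite (carrier (Iso Y))"
    and fix0: "\<And>f. f \<in> carrier (Iso Y) \<Longrightarrow> f 0 = 0" and w: "norm w = 1"
  shows "(\<lambda>z. w * z) \<in> carrier (Iso Y)"
proof -
  define U where "U = {u. (\<lambda>z. u * z) \<in> carrier (Iso Y)}"
  have Umult: "u * v \<in> U" if "u \<in> U" "v \<in> U" for u v
    using Iso_comp[of "\<lambda>z. u * z" Y "\<lambda>z. v * z"] that by (simp add: U_def comp_def) (simp add: mult.assoc[symmetric])
  have Ucnj: "cnj u \<in> U" if "u \<in> U" for u using rotation_cnj(2) that by (simp add: U_def)
  have Unorm: "norm u = 1" if "u \<in> U" for u using rotation_cnj(1) that by (simp add: U_def)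
  have "(*) 1 = (id :: complex \<Rightarrow> complex)" by auto
  then have U1: "1 \<in> U" by (simp add: U_def) (simp add: Iso_def)
  have Upow: "u ^ k \<in> U" if "u \<in> U" for u k by (induction k) (auto simp: U1 Umult that)
  have infU: "infinite U"
  proof
    assume finU: "finite U"
    have "finite {f\<in>carrier (Iso Y). \<exists>u. f = (\<lambda>z. u * cnj z)}"
    proof (cases "\<exists>w. (\<lambda>z. w * cnj z) \<in> carrier (Iso Y)")
      case True
      then obtain w where w: "(\<lambda>z. w * cnj z) \<in> carrier (Iso Y)" by blast
      have "norm w = 1" using Iso_D(2)[OF w, of 1 0] by simp
      then have ww: "w * cnj w = 1" by (simp add: complex_norm_square[symmetric])
      have "{f\<in>carrier (Iso Y). \<exists>u. f = (\<lambda>z. u * cnj z)} \<subseteq> (\<lambda>v z. v * w * cnj z) ` U"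
      proof safe
        fix u assume "(\<lambda>z. u * cnj z) \<in> carrier (Iso Y)"
        moreover have "(\<lambda>z. u * cnj z) \<circ> (\<lambda>z. w * cnj z) = (\<lambda>z. (u * cnj w) * z)" by (auto simp: mult_ac)
        ultimately have "u * cnj w \<in> U" using Iso_comp[OF _ w, of "\<lambda>z. u * cnj z"] by (simp add: U_def)
        moreover have "(\<lambda>z. u * cnj z) = (\<lambda>z. (u * cnj w) * w * cnj z)"
        proof
          fix z
          have "(u * cnj w) * w * cnj z = u * (w * cnj w) * cnj z" by (simp add: mult_ac)
          then show "u * cnj z = (u * cnj w) * w * cnj z" by (simp add: ww)
        qed
        ultimately show "(\<lambda>z. u * cnj z) \<in> (\<lambda>v z. v * w * cnj z) ` U" by blast
      qed
      then show ?thesis using finU finite_surj by blast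
    next
      case False
      then have "{f\<in>carrier (Iso Y). \<exists>u. f = (\<lambda>z. u * cnj z)} = {}" by auto
      then show ?thesis by (simp only: finite.emptyI)
    qed
    moreover have "carrier (Iso Y) \<subseteq> (\<lambda>u z. u * z) ` U \<union> {f\<in>carrier (Iso Y). \<exists>u. f = (\<lambda>z. u * cnj z)}"
    proof
      fix f assume f: "f \<in> carrier (Iso Y)"
      then show "f \<in> (\<lambda>u z. u * z) ` U \<union> {f\<in>carrier (Iso Y). \<exists>u. f = (\<lambda>z. u * cnj z)}"
        using fix0[OF f]
      proof (cases rule: Iso_complex_cases)
        case (1 u)
        then show ?thesis using f by (auto simp: U_def)
      next
        case (2 u)
        then show ?thesis using f by auto
      qed
    qed
    ultimately show False using inf finU finite_subset[of "carrier (Iso Y)"] by blast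
  qed
  have small: "\<exists>v\<in>U. v \<noteq> 1 \<and> dist v 1 < d" if "d > 0" for d
  proof -
    have "U \<subseteq> sphere 0 1" using Unorm by auto
    then obtain x where x: "x islimpt U"
      using infU compact_sphere[of "0::complex" 1] unfolding compact_eq_Bolzano_Weierstrass by blast
    have d2: "d / 2 > 0" using that by simp
    obtain u where u: "u \<in> U" "u \<noteq> x" "dist u x < d / 2"
      using x[unfolded islimpt_approachable, rule_format, OF d2] by blast
    \<comment> \<open>Choosing \<open>u'\<close> closer to the limit point \<open>x\<close> than
      \<open>u\<close> makes the two distinct, so their quotient is not \<open>1\<close>.\<close>
    have "min (d / 2) (dist u x) > 0" using d2 u by simp
    then obtain u' where u': "u' \<in> U" "u' \<noteq> x" "dist u' x < min (d / 2) (dist u x)"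
      using x unfolding islimpt_approachable by meson
    then have ne: "u' \<noteq> u" by auto
    have "dist u' u < d" using u u' dist_triangle2[of u' u x] by simp
    have uu: "u * cnj u = 1" using Unorm[OF u(1)] by (simp add: complex_norm_square[symmetric])
    define v where "v = u' * cnj u"
    have "v - 1 = (u' - u) * cnj u" using uu by (simp add: v_def algebra_simps)
    then have dv: "dist v 1 = dist u' u" using Unorm[OF u(1)] by (simp add: dist_norm norm_mult)
    then have "v \<noteq> 1" using ne by (metis dist_self dist_eq_0_iff)
    then show ?thesis using dv \<open>dist u' u < d\<close> Umult[OF u'(1) Ucnj[OF u(1)]] by (auto simp: v_def)
  qed
  have angle: "\<exists>\<alpha>>0. \<alpha> < d \<and> cis \<alpha> \<in> U" if d: "d > 0" for d
  proof -
    have "isCont Arg 1" by (rule continuous_at_Arg) auto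
    then obtain \<delta> where \<delta>: "\<delta> > 0" "\<And>v. dist v 1 < \<delta> \<Longrightarrow> dist (Arg v) (Arg 1) < d"
      using d unfolding continuous_at_eps_delta by (metis dist_commute)
    obtain v where v: "v \<in> U" "v \<noteq> 1" "dist v 1 < \<delta>" using small[OF \<delta>(1)] by blast
    have Av: "\<bar>Arg v\<bar> < d" using \<delta>(2)[OF v(3)] by (simp add: dist_real_def)
    have v_cis: "v = cis (Arg v)" using Unorm[OF v(1)] rcis_cmod_Arg[of v] by (simp add: rcis_def)
    have "Arg v \<noteq> 0" using v_cis v(2) by auto
    show ?thesis
    proof (cases "Arg v > 0")
      case True
      then show ?thesis using Av v_cis v(1) by auto
    next
      case False
      have "cis (- Arg v) \<in> U" using Ucnj[OF v(1)] v_cis by (metis cis_cnj)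
      then show ?thesis using False \<open>Arg v \<noteq> 0\<close> Av by (intro exI[of _ "- Arg v"]) auto
    qed
  qed
  have dense: "\<exists>u\<in>U. dist u w < d" if d: "d > 0" for d
  proof -
    obtain \<alpha> where \<alpha>: "\<alpha> > 0" "\<alpha> < d" "cis \<alpha> \<in> U" using angle[OF d] by blast
    define \<phi> where "\<phi> = Arg2pi w"
    have \<phi>: "\<phi> \<ge> 0" "w = cis \<phi>"
      using Arg2pi[of w] w complex_norm_eq_1_exp[of w] by (auto simp: \<phi>_def cis_conv_exp)
    \<comment> \<open>The largest multiple of \<open>\<alpha>\<close> not exceeding
      \<open>\<phi>\<close> misses it by less than \<open>\<alpha> < d\<close>.\<close>
    define k where "k = nat \<lfloor>\<phi> / \<alpha>\<rfloor>"
    have k: "real k \<le> \<phi> / \<alpha>" "\<phi> / \<alpha> < real k + 1"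
      using \<phi> \<alpha> by (auto simp: k_def)
    define \<beta> where "\<beta> = \<phi> - k * \<alpha>"
    have \<beta>: "0 \<le> \<beta>" "\<beta> < \<alpha>" using k \<alpha> by (auto simp: \<beta>_def field_simps)
    have "real k * \<alpha> + \<beta> = \<phi>" by (simp add: \<beta>_def)
    then have "w = cis \<alpha> ^ k * cis \<beta>" unfolding Complex.DeMoivre cis_mult by (simp only: \<phi>(2))
    then have "dist (cis \<alpha> ^ k) w = norm (cis \<alpha> ^ k * (1 - cis \<beta>))"
      by (simp add: dist_norm right_diff_distrib)
    also have "\<dots> = norm (cis \<beta> - 1)" by (simp add: norm_mult norm_power norm_minus_commute)
    also have "\<dots> = 2 * \<bar>sin (\<beta> / 2)\<bar>"
      using dist_exp_i_1[of \<beta>] by (simp add: cis_conv_exp dist_norm)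
    also have "\<dots> \<le> \<beta>" using abs_sin_x_le_abs_x[of "\<beta> / 2"] \<beta> by simp
    finally show ?thesis using \<beta> \<alpha> Upow[OF \<alpha>(3)] by (intro bexI[of _ "cis \<alpha> ^ k"]) auto
  qed
  have clY: "closed Y" using Y by (rule compact_imp_closed)
  have closure: "z * y \<in> Y" if y: "y \<in> Y" and z: "\<And>d. d > 0 \<Longrightarrow> \<exists>u\<in>U. dist u z < d" for y z
  proof (rule closed_approachable[THEN iffD1, OF clY], intro allI impI)
    fix e :: real assume e: "e > 0"
    then have "e / (norm y + 1) > 0" by (simp add: add_nonneg_pos)
    then obtain u where u: "u \<in> U" "dist u z < e / (norm y + 1)" using z by blast
    have "dist (u * y) (z * y) = dist u z * norm y" by (simp add: dist_norm norm_mult flip: left_diff_distrib)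
    also have "\<dots> \<le> dist u z * (norm y + 1)" by (intro mult_left_mono) auto
    also have "\<dots> < e" using u by (simp add: pos_less_divide_eq add_nonneg_pos)
    finally show "\<exists>x\<in>Y. dist x (z * y) < e"
      using rotation_cnj(3)[of u Y y] u(1) y by (intro bexI[of _ "u * y"]) (auto simp: U_def)
  qed
  \<comment> \<open>\<open>cnj w\<close> is approximated as well, so that the inverse rotation also
    maps \<open>Y\<close> into itself.\<close>
  have "\<exists>u\<in>U. dist u (cnj w) < d" if d: "d > 0" for d
  proof -
    obtain u where u: "u \<in> U" "dist u w < d" using dense[OF d] by blast
    have "dist (cnj u) (cnj w) = dist u w" by (metis complex_cnj_diff complex_mod_cnj dist_norm)
    then show ?thesis using Ucnj[OF u(1)] u(2) by (intro bexI[of _ "cnj u"]) simp_all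
  qed
  then show ?thesis using dense closure w by (intro rotation_IsoI) auto
qed

text \<open>\<open>cnj y\<close> has the same modulus as \<open>y\<close> and hence is a rotated
  copy of it, so invariance under all rotations entails invariance under conjugation.\<close>

lemma reflection_IsoI:
  fixes Y :: "complex set"
  assumes rot: "\<And>u. norm u = 1 \<Longrightarrow> (\<lambda>z. u * z) \<in> carrier (Iso Y)" and w: "norm w = 1"
  shows "(\<lambda>z. w * cnj z) \<in> carrier (Iso Y)"
proof -
  have cY: "cnj y \<in> Y" if "y \<in> Y" for y
  proof (cases "y = 0")
    case False
    then have "norm (cnj y / y) = 1" by (simp add: norm_divide)
    from rotation_cnj(3)[OF rot[OF this] that] show ?thesis using False by simp
  qed (use that in simp)
  have "cnj ` Y = Y"
  proof
    show "Y \<subseteq> cnj ` Y" using cY by (metis complex_cnj_cnj image_eqI subsetI)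
  qed (use cY in auto)
  moreover have "bij cnj" by (rule o_bij[of cnj]) auto
  moreover have "dist (cnj x) (cnj y) = dist x y" for x y by (metis complex_cnj_diff complex_mod_cnj dist_norm)
  ultimately have "cnj \<in> carrier (Iso Y)" by (simp add: Iso_def)
  from Iso_comp[OF rot[OF w] this] show ?thesis by (simp add: comp_def)
qed

section \<open>The circle parametrised by the unit interval\<close>

lemma fmeasurable_unit_subset:
  assumes "A \<subseteq> {0..<1::real}" "A \<in> sets borel"
  shows "A \<in> fmeasurable lborel"
proof (rule fmeasurableI)
  have "emeasure lborel A \<le> emeasure lborel {0..<1::real}" using assms by (intro emeasure_mono) auto
  also have "\<dots> < \<infinity>" by simp
  finally show "emeasure lborel A < \<infinity>" .
qed (use assms in simp)

abbreviation "UI \<equiv> restrict_space lborel {0..<1::real}"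
abbreviation "circ t \<equiv> cis (2 * pi * t)"

lemma prob_space_UI: "prob_space UI"
  by (rule prob_spaceI) (simp add: emeasure_restrict_space space_restrict_space)

lemma emeasure_UI_space: "emeasure UI {0..<1} = 1"
  using prob_space.emeasure_space_1[OF prob_space_UI] by (simp add: space_restrict_space)

lemma frac_add_int: "frac (x + real_of_int k) = frac x"
  by (simp add: frac_def)

lemma emeasure_UI:
  "emeasure UI {t\<in>{0..<1}. P t} = ennreal (measure lborel {t\<in>{0..<1}. P t})"
proof -
  have "emeasure UI {t\<in>{0..<1}. P t} = emeasure lborel {t\<in>{0..<1}. P t}"
    by (rule emeasure_restrict_space) auto
  also have "\<dots> = ennreal (measure lborel {t\<in>{0..<1}. P t})"
  proof (rule emeasure_eq_ennreal_measure)
    have "emeasure lborel {t\<in>{0..<1}. P t} \<le> emeasure lborel {0..<1::real}" by (intro emeasure_mono) auto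
    also have "\<dots> < \<infinity>" by simp
    finally show "emeasure lborel {t\<in>{0..<1}. P t} \<noteq> Orderings.top" by simp
  qed
  finally show ?thesis .
qed

lemma circ_measurable: "(\<lambda>t. circ t) \<in> borel_measurable borel"
  by (intro borel_measurable_continuous_onI continuous_intros)

lemma circ_frac: "circ (frac t) = circ t"
proof -
  have "circ t = circ (frac t) * cis (2 * pi * real_of_int \<lfloor>t\<rfloor>)"
    by (simp add: cis_mult frac_def algebra_simps)
  moreover have "cis (2 * pi * real_of_int \<lfloor>t\<rfloor>) = 1" by (rule cis_multiple_2pi) simp
  ultimately show ?thesis by simp
qed

lemma circ_surj:
  assumes "norm u = 1"
  obtains s where "s \<in> {0..<1}" "u = circ s"
proof -
  have "u = cis (Arg2pi u)" using assms complex_norm_eq_1_exp[of u] by (simp add: cis_conv_exp)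
  moreover have "0 \<le> Arg2pi u" "Arg2pi u < 2 * pi" using Arg2pi[of u] by auto
  ultimately show ?thesis by (intro that[of "Arg2pi u / (2 * pi)"]) auto
qed

text \<open>The shift by \<open>s\<close> maps \<open>{0..<1 - s}\<close> to \<open>{s..<1}\<close>,
  and the rest wraps around to \<open>{0..<s}\<close> after subtraction of \<open>1\<close>. Both
  pieces are moved by translations.\<close>

lemma circ_shift_measure:
  assumes S: "S \<in> sets borel" and s: "s \<in> {0..<1::real}"
  shows "measure lborel {t\<in>{0..<1}. circ (t + s) \<in> S} = measure lborel {t\<in>{0..<1}. circ t \<in> S}"
proof -
  define g where "g = {t. circ t \<in> S}"
  have g: "g \<in> sets borel" unfolding g_def using measurable_sets[OF circ_measurable S] by (simp add: vimage_def)
  have per: "t - 1 \<in> g \<longleftrightarrow> t \<in> g" for t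
    using circ_frac[of "t - 1"] circ_frac[of t] frac_1_eq[of "t - 1"] by (simp add: g_def)
  have fm: "emeasure lborel A \<noteq> \<infinity>" if "A \<subseteq> {0..<1}" "A \<in> sets borel" for A :: "real set"
    using fmeasurableD2[OF fmeasurable_unit_subset[OF that]] by simp
  have sh: "{t. t + c \<in> A} \<in> sets borel" if "A \<in> sets borel" for A and c :: real
    using measurable_sets[of "\<lambda>t. t + c" borel borel A] that by (simp add: vimage_def)
  let ?A = "{t. 1 * t + s \<in> g \<inter> {s..<1}}" and ?B = "{t. 1 * t + (s - 1) \<in> g \<inter> {0..<s}}"
  have AB: "?A \<in> sets borel" "?B \<in> sets borel" using sh[of "g \<inter> {s..<1}" s] sh[of "g \<inter> {0..<s}" "s - 1"] g by auto
  have "t + s \<in> g \<longleftrightarrow> t + (s - 1) \<in> g" for t using per[of "t + s"] by (simp add: algebra_simps)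
  then have "{t\<in>{0..<1}. circ (t + s) \<in> S} = ?A \<union> ?B"
    using s by (auto simp: g_def)
  moreover have "measure lborel (?A \<union> ?B) = measure lborel ?A + measure lborel ?B"
    using AB s by (intro measure_Union fm) auto
  moreover have "measure lborel ?A = measure lborel (g \<inter> {s..<1})"
    by (rule measure_lborel_isometry_real) (use g in auto)
  moreover have "measure lborel ?B = measure lborel (g \<inter> {0..<s})"
    by (rule measure_lborel_isometry_real) (use g in auto)
  moreover have "measure lborel (g \<inter> {s..<1}) + measure lborel (g \<inter> {0..<s}) = measure lborel (g \<inter> {s..<1} \<union> g \<inter> {0..<s})"
    using g s by (intro measure_Union[symmetric] fm) auto
  moreover have "g \<inter> {s..<1} \<union> g \<inter> {0..<s} = {t\<in>{0..<1}. circ t \<in> S}" using s by (auto simp: g_def)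
  ultimately show ?thesis by simp
qed

lemma emeasure_circ_invariant:
  assumes S: "S \<in> sets borel" and u: "norm u = 1"
  shows "emeasure UI {t\<in>{0..<1}. circ t * u \<in> S} = emeasure UI {t\<in>{0..<1}. circ t \<in> S}"
proof -
  obtain s where s: "s \<in> {0..<1}" "u = circ s" using circ_surj[OF u] .
  have eq: "circ t * u = circ (t + s)" for t by (simp add: s cis_mult distrib_left)
  show ?thesis unfolding eq emeasure_UI circ_shift_measure[OF S s(1)] ..
qed

text \<open>On the circle the isometry becomes \<open>t \<mapsto> frac (s * t + \<tau>)\<close>,
  which has two branches on the unit interval, with shifts \<open>\<tau>\<close> and
  \<open>\<tau> - s\<close>. For \<open>s = 1\<close> the range of \<open>\<tau>\<close> makes both
  shifts at least \<open>1 / 4\<close> in absolute value. The domains of the branches are disjoint,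
  so the main terms add up to at most \<open>1 / r\<^sup>2\<close>, and each branch contributes one
  \<open>\<delta>\<close>.\<close>

lemma joint_colour_bound:
  fixes c :: "real \<Rightarrow> nat" and r i :: nat and s \<tau> \<delta> :: real
  assumes cm: "c \<in> measurable borel (count_space UNIV)"
    and c: "\<And>s t i. s = -1 \<or> s = 1 \<and> \<bar>t\<bar> \<ge> 1 / 4 \<Longrightarrow>
        measure lborel {x\<in>{0..<1}. s * x + t \<in> {0..<1} \<and> c x = i \<and> c (s * x + t) = i}
        \<le> measure lborel {x\<in>{0..<1}. s * x + t \<in> {0..<1}} / r\<^sup>2 + \<delta>"
    and \<delta>: "\<delta> \<ge> 0"
    and st: "s = -1 \<and> 0 \<le> \<tau> \<and> \<tau> < 1 \<or> s = 1 \<and> 1 / 4 \<le> \<tau> \<and> \<tau> \<le> 3 / 4"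
  shows "measure lborel {t\<in>{0..<1}. c t = i \<and> c (frac (s * t + \<tau>)) = i} \<le> 1 / r\<^sup>2 + 2 * \<delta>"
    (is "measure lborel ?J \<le> _")
proof -
  define \<tau>' where "\<tau>' = \<tau> - s"
  define P where "P \<sigma> = {x\<in>{0..<1}. s * x + \<sigma> \<in> {0..<1} \<and> c x = i \<and> c (s * x + \<sigma>) = i}" for \<sigma>
  define Q where "Q \<sigma> = {x\<in>{0..<1::real}. s * x + \<sigma> \<in> {0..<1}}" for \<sigma>
  have ci: "{x. c x = i} \<in> sets borel" using measurable_sets[OF cm, of "{i}"] by (simp add: vimage_def)
  have aff: "(\<lambda>x. s * x + \<sigma>) \<in> borel_measurable borel" for \<sigma> by measurable
  have cs: "{x. c (s * x + \<sigma>) = i} \<in> sets borel" for \<sigma>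
    using measurable_sets[OF aff ci, of \<sigma>] by (simp add: vimage_def)
  have Qb: "Q \<sigma> \<in> sets borel" for \<sigma> unfolding Q_def by measurable
  have "P \<sigma> = Q \<sigma> \<inter> {x. c x = i} \<inter> {x. c (s * x + \<sigma>) = i}" for \<sigma> by (auto simp: P_def Q_def)
  then have Pb: "P \<sigma> \<in> sets borel" for \<sigma> using Qb ci cs by simp
  have Psub: "P \<sigma> \<subseteq> {0..<1}" and Qsub: "Q \<sigma> \<subseteq> {0..<1}" for \<sigma> by (auto simp: P_def Q_def)
  note Pf = fmeasurable_unit_subset[OF Psub Pb]
  have Qf: "emeasure lborel (Q \<sigma>) \<noteq> \<infinity>" for \<sigma>
    using fmeasurableD2[OF fmeasurable_unit_subset[OF Qsub Qb]] by simp
  have sub: "?J \<subseteq> P \<tau> \<union> P \<tau>'"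
  proof
    fix t assume t: "t \<in> ?J"
    have "frac (s * t + \<tau>) = s * t + \<tau> \<or> frac (s * t + \<tau>) = s * t + \<tau>'"
    proof (cases "s * t + \<tau> \<in> {0..<1}")
      case True
      then show ?thesis by (simp add: frac_eq)
    next
      case False
      then have "s * t + \<tau>' \<in> {0..<1}" using st t by (auto simp: \<tau>'_def)
      then have "frac (s * t + \<tau>') = s * t + \<tau>'" by (simp add: frac_eq)
      moreover have "frac (s * t + \<tau>') = frac (s * t + \<tau>)"
      proof -
        obtain k :: int where "s = real_of_int k" using st by (metis of_int_1 of_int_minus)
        then have "s * t + \<tau>' = (s * t + \<tau>) + real_of_int (- k)" by (simp add: \<tau>'_def)
        then show ?thesis by (simp only: frac_add_int)
      qed
      ultimately show ?thesis by simp
    qed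
    moreover have f01: "frac (s * t + \<tau>) \<in> {0..<1}" by (simp add: frac_lt_1)
    ultimately show "t \<in> P \<tau> \<union> P \<tau>'"
    proof (elim disjE)
      assume "frac (s * t + \<tau>) = s * t + \<tau>"
      then have "t \<in> P \<tau>" using t f01 unfolding P_def by (simp only: mem_Collect_eq simp_thms)
      then show ?thesis by simp
    next
      assume "frac (s * t + \<tau>) = s * t + \<tau>'"
      then have "t \<in> P \<tau>'" using t f01 unfolding P_def by (simp only: mem_Collect_eq simp_thms)
      then show ?thesis by simp
    qed
  qed
  have "measure lborel ?J \<le> measure lborel (P \<tau> \<union> P \<tau>')"
  proof (rule measure_mono_fmeasurable[OF sub])
    have "(\<lambda>t. frac (s * t + \<tau>)) \<in> borel_measurable borel" unfolding frac_def by measurable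
    from measurable_sets[OF this ci] have "{t. c (frac (s * t + \<tau>)) = i} \<in> sets borel" by (simp add: vimage_def)
    moreover have "?J = {0..<1} \<inter> {t. c t = i} \<inter> {t. c (frac (s * t + \<tau>)) = i}" by auto
    ultimately show "?J \<in> sets lborel" using ci by simp
  qed (use Pf in auto)
  also have "\<dots> \<le> measure lborel (P \<tau>) + measure lborel (P \<tau>')" using Pb by (intro measure_Un_le) auto
  also have "\<dots> \<le> (measure lborel (Q \<tau>) / r\<^sup>2 + \<delta>) + (measure lborel (Q \<tau>') / r\<^sup>2 + \<delta>)"
    unfolding P_def Q_def using st by (intro add_mono c) (auto simp: \<tau>'_def)
  also have "\<dots> = (measure lborel (Q \<tau>) + measure lborel (Q \<tau>')) / r\<^sup>2 + 2 * \<delta>"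
    by (simp add: add_divide_distrib)
  also have "measure lborel (Q \<tau>) + measure lborel (Q \<tau>') = measure lborel (Q \<tau> \<union> Q \<tau>')"
    using Qb st by (intro measure_Union[symmetric] Qf) (auto simp: Q_def \<tau>'_def)
  also have "measure lborel (Q \<tau> \<union> Q \<tau>') / r\<^sup>2 \<le> 1 / r\<^sup>2"
  proof (rule divide_right_mono)
    have "measure lborel (Q \<tau> \<union> Q \<tau>') \<le> measure lborel {0..<1::real}"
      using Qb by (intro measure_mono_fmeasurable fmeasurableI) (auto simp: Q_def)
    then show "measure lborel (Q \<tau> \<union> Q \<tau>') \<le> 1" by simp
  qed simp
  finally show ?thesis by simp
qed

text \<open>Steps of less than a quarter turn cannot leap over the arc from \<open>1 / 4\<close> to
  \<open>3 / 4\<close>, so some multiple lands in it. For \<open>\<sigma> > 3 / 4\<close> the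
  rotation is a small step backwards, and \<open>1 - \<sigma>\<close> takes the place of
  \<open>\<sigma>\<close>.\<close>

lemma rotation_power_far:
  assumes "norm u = 1" "u \<noteq> 1"
  obtains k :: nat and \<tau> where "1 / 4 \<le> \<tau>" "\<tau> \<le> 3 / 4" "u ^ k = circ \<tau>"
proof -
  have pow: "circ x ^ k = circ (real k * x)" for x k by (simp add: Complex.DeMoivre mult_ac)
  have small: "\<exists>k::nat. 1 / 4 \<le> k * x \<and> k * x \<le> 3 / 4" if "0 < x" "x < 1 / 4" for x :: real
  proof (intro exI conjI)
    let ?k = "nat \<lceil>1 / (4 * x)\<rceil>"
    have "1 / (4 * x) > 0" using that by simp
    then have k: "1 / (4 * x) \<le> ?k" "?k < 1 / (4 * x) + 1" by linarith+
    have "1 / (4 * x) * x \<le> ?k * x" "?k * x \<le> (1 / (4 * x) + 1) * x"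
      using k that by (intro mult_right_mono; simp)+
    then show "1 / 4 \<le> ?k * x" "?k * x \<le> 3 / 4" using that by (auto simp: distrib_right)
  qed
  obtain \<sigma> where \<sigma>: "\<sigma> \<in> {0..<1}" "u = circ \<sigma>" using circ_surj[OF assms(1)] .
  have \<sigma>0: "\<sigma> > 0" using \<sigma> assms(2) by (cases "\<sigma> = 0") auto
  consider "\<sigma> < 1 / 4" | "1 / 4 \<le> \<sigma>" "\<sigma> \<le> 3 / 4" | "\<sigma> > 3 / 4" by linarith
  then show ?thesis
  proof cases
    case 1
    then obtain k :: nat where "1 / 4 \<le> k * \<sigma>" "k * \<sigma> \<le> 3 / 4" using small \<sigma>0 by blast
    then show ?thesis using that[of "k * \<sigma>" k] by (simp only: \<sigma>(2) pow)
  next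
    case 2
    then show ?thesis using that[of \<sigma> 1] \<sigma>(2) by simp
  next
    case 3
    then obtain k :: nat where k: "1 / 4 \<le> k * (1 - \<sigma>)" "k * (1 - \<sigma>) \<le> 3 / 4"
      using small[of "1 - \<sigma>"] \<sigma> by auto
    have "circ (1 - k * (1 - \<sigma>)) = circ (frac (1 - k * (1 - \<sigma>)))" by (rule circ_frac[symmetric])
    also have "frac (1 - k * (1 - \<sigma>)) = frac (k * \<sigma>)"
    proof -
      have "1 - k * (1 - \<sigma>) = k * \<sigma> + real_of_int (1 - int k)" by (simp add: algebra_simps)
      then show ?thesis by (simp only: frac_add_int)
    qed
    also have "circ (frac (k * \<sigma>)) = u ^ k" by (simp only: circ_frac \<sigma>(2) pow)
    finally show ?thesis using that[of "1 - k * (1 - \<sigma>)" k] k by simp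
  qed
qed

lemma Arg2pi_measurable: "Arg2pi \<in> borel_measurable borel"
  unfolding borel_measurable_iff_greater using open_Arg2pi2pi_gt by (auto intro!: borel_open)

section \<open>Both bounds for sets invariant under all rotations\<close>

locale rotation_symmetric =
  fixes Y :: "complex set"
  assumes Y: "compact Y" "measure lborel Y > 0"
    and rot: "\<And>u. norm u = 1 \<Longrightarrow> (\<lambda>z. u * z) \<in> carrier (Iso Y)"
    and fix0: "\<And>f. f \<in> carrier (Iso Y) \<Longrightarrow> f 0 = 0"
begin

lemma Yb: "Y \<in> sets borel" using Y by (simp add: borel_compact)

abbreviation "M \<equiv> normalized_lebesgue Y"

sublocale M: prob_space M by (rule prob_space_normalized_lebesgue[OF Y])
sublocale U: prob_space UI by (rule prob_space_UI)
sublocale UM: pair_sigma_finite UI M ..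

lemma ident_M [measurable]: "(\<lambda>x. x) \<in> borel_measurable M"
  by (rule measurable_normalized_lebesgue_borel) simp

lemma circ_UI [measurable]: "(\<lambda>t. circ t) \<in> borel_measurable UI"
  by (rule measurable_restrict_space1) (simp add: circ_measurable)

lemma rotation_mem: "z \<in> Y \<Longrightarrow> circ t * z \<in> Y"
  using rotation_cnj(3)[OF rot] by simp

text \<open>All rotations preserve \<open>M\<close>, so the integral may be averaged over the angle;
  Fubini moves the average inside. This replaces polar coordinates and reduces estimates on
  \<open>Y\<close> to estimates on single circles.\<close>

lemma rotation_average:
  assumes f[measurable]: "f \<in> borel_measurable borel"
  shows "(\<integral>\<^sup>+z. f z \<partial>M) = (\<integral>\<^sup>+z. (\<integral>\<^sup>+t. f (circ t * z) \<partial>UI) \<partial>M)"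
proof -
  have m: "(\<lambda>(t, z). f (circ t * z)) \<in> borel_measurable (UI \<Otimes>\<^sub>M M)" by measurable
  have fM: "f \<in> borel_measurable M" by (rule measurable_normalized_lebesgue_borel[OF f])
  have "(\<integral>\<^sup>+z. f (circ t * z) \<partial>M) = (\<integral>\<^sup>+z. f z \<partial>M)" for t
  proof -
    have r: "(\<lambda>z. circ t * z) \<in> carrier (Iso Y)" by (rule rot) simp
    have "(\<integral>\<^sup>+z. f z \<partial>M) = (\<integral>\<^sup>+z. f z \<partial>(distr M M (\<lambda>z. circ t * z)))"
      by (simp only: distr_Iso_complex[OF Yb r])
    also have "\<dots> = (\<integral>\<^sup>+z. f (circ t * z) \<partial>M)"
      using measurable_Iso_complex[OF Yb r] fM by (simp add: nn_integral_distr)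
    finally show ?thesis by simp
  qed
  then have "(\<integral>\<^sup>+z. f z \<partial>M) = (\<integral>\<^sup>+t. (\<integral>\<^sup>+z. f (circ t * z) \<partial>M) \<partial>UI)"
    by (simp add: emeasure_UI_space)
  also have "\<dots> = (\<integral>\<^sup>+z. (\<integral>\<^sup>+t. f (circ t * z) \<partial>UI) \<partial>M)"
    using UM.Fubini[OF m] by simp
  finally show ?thesis .
qed

lemma nn_integral_circ_indicator:
  assumes "S \<in> sets borel"
  shows "(\<integral>\<^sup>+t. indicator S (circ t * z) \<partial>UI) = emeasure UI {t\<in>{0..<1}. circ t * z \<in> S}"
proof -
  have "(\<lambda>t. circ t * z) \<in> borel_measurable UI" by measurable
  from measurable_sets[OF this assms] have s: "{t\<in>{0..<1}. circ t * z \<in> S} \<in> sets UI"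
    by (simp add: space_restrict_space vimage_def Int_def conj_commute)
  have "(\<integral>\<^sup>+t. indicator S (circ t * z) \<partial>UI) = (\<integral>\<^sup>+t. indicator {t\<in>{0..<1}. circ t * z \<in> S} t \<partial>UI)"
    by (intro nn_integral_cong) (auto simp: space_restrict_space indicator_def)
  then show ?thesis using s by simp
qed

lemma circle_average_rotation:
  assumes S: "S \<in> sets borel" and u: "norm u = 1"
  shows "emeasure UI {t\<in>{0..<1}. circ t * (u * z) \<in> S} = emeasure UI {t\<in>{0..<1}. circ t * z \<in> S}"
proof -
  have "(\<lambda>w. w * z) \<in> borel_measurable borel" by measurable
  from measurable_sets[OF this S] have "{w. w * z \<in> S} \<in> sets borel" by (simp add: vimage_def)
  from emeasure_circ_invariant[OF this u] show ?thesis by (simp add: mult.assoc)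
qed

text \<open>
  If \<open>a i z\<close> is the proportion of colour \<open>i\<close> on the circle through \<open>z\<close>, then the average over all
  reflections of the measure of the points that agree in colour \<open>i\<close> with their mirror image is the
  integral of \<open>(a i)\<^sup>2\<close>, and the \<open>a i\<close> sum to \<open>1\<close>.
\<close>

lemma ms_set_ge:
  assumes r: "r \<ge> 2"
  shows "ms_set Y r \<ge> 1 / (real r)\<^sup>2"
proof (rule dense_le)
  \<comment> \<open>The strict inequality leaves room for averaging: if all the sets
    \<open>D i t\<close> below had measure less than \<open>\<epsilon>\<close>, their average would
    be too small.\<close>
  fix \<epsilon> :: real assume e: "\<epsilon> < 1 / (real r)\<^sup>2"
  have adm: "admissible M (Iso Y) (\<lambda>f x. f x) r \<epsilon>" if e0: "\<epsilon> > 0"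
    unfolding admissible_def
  proof
    fix col assume col: "col \<in> measurable M (count_space {..<r})"
    define C where "C i = {z\<in>Y. col z = i}" for i
    have CM: "C i \<in> sets M" for i
    proof -
      have "Measurable.pred M (\<lambda>x. col x = i)" using col by (rule pred_eq_const1) simp
      then have "{x\<in>space M. col x = i} \<in> sets M" by measurable
      then show ?thesis by (simp add: C_def)
    qed
    then have Cb[measurable]: "C i \<in> sets borel" for i using Yb by (simp add: sets_normalized_lebesgue)
    have colr: "col z < r" if "z \<in> Y" for z using measurable_space[OF col, of z] that by simp
    define a where "a i z = emeasure UI {t\<in>{0..<1}. circ t * z \<in> C i}" for i z
    have a_int: "a i z = (\<integral>\<^sup>+t. indicator (C i) (circ t * z) \<partial>UI)" for i z
      unfolding a_def by (rule nn_integral_circ_indicator[symmetric]) simp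
    have am[measurable]: "a i \<in> borel_measurable borel" for i
      unfolding a_int[abs_def] by measurable
    have a_rot: "a i (u * z) = a i z" if "norm u = 1" for u i z
      unfolding a_def using that by (intro circle_average_rotation) auto
    \<comment> \<open>\<open>cnj z\<close> lies on the same circle as \<open>z\<close>, and
      \<open>a i\<close> depends on the circle only.\<close>
    have a_cnj: "a i (cnj z) = a i z" for i z
    proof (cases "z = 0")
      case False
      then have "norm (cnj z / z) = 1" by (simp add: norm_divide)
      from a_rot[OF this, of i z] False show ?thesis by simp
    qed simp
    define D where "D i t = {z\<in>Y. z \<in> C i \<and> circ t * cnj z \<in> C i}" for i t
    have DM: "D i t \<in> sets M" for i t
    proof -
      have "(\<lambda>z. circ t * cnj z) \<in> borel_measurable borel"
        by (intro borel_measurable_continuous_onI continuous_intros)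
      from measurable_sets[OF this Cb] have "{z. circ t * cnj z \<in> C i} \<in> sets borel" by (simp add: vimage_def)
      then have "C i \<inter> {z. circ t * cnj z \<in> C i} \<in> sets borel" by simp
      moreover have "D i t = C i \<inter> {z. circ t * cnj z \<in> C i}" by (auto simp: D_def C_def)
      ultimately show ?thesis using Yb by (auto simp: sets_normalized_lebesgue C_def)
    qed
    have key1: "(\<integral>\<^sup>+t. emeasure M (D i t) \<partial>UI) = (\<integral>\<^sup>+z. indicator (C i) z * a i z \<partial>M)" for i
    proof -
      have cnjm[measurable]: "cnj \<in> borel_measurable borel"
        by (intro borel_measurable_continuous_onI continuous_intros)
      have m: "(\<lambda>(t, z). indicator (C i) z * indicator (C i) (circ t * cnj z) :: ennreal) \<in> borel_measurable (UI \<Otimes>\<^sub>M M)"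
        by measurable
      have "(\<integral>\<^sup>+t. emeasure M (D i t) \<partial>UI) = (\<integral>\<^sup>+t. (\<integral>\<^sup>+z. indicator (C i) z * indicator (C i) (circ t * cnj z) \<partial>M) \<partial>UI)"
      proof (rule nn_integral_cong)
        fix t
        have "emeasure M (D i t) = (\<integral>\<^sup>+z. indicator (D i t) z \<partial>M)" using DM by simp
        also have "\<dots> = (\<integral>\<^sup>+z. indicator (C i) z * indicator (C i) (circ t * cnj z) \<partial>M)"
          by (intro nn_integral_cong) (auto simp: D_def indicator_def)
        finally show "emeasure M (D i t) = (\<integral>\<^sup>+z. indicator (C i) z * indicator (C i) (circ t * cnj z) \<partial>M)" .
      qed
      also have "\<dots> = (\<integral>\<^sup>+z. (\<integral>\<^sup>+t. indicator (C i) z * indicator (C i) (circ t * cnj z) \<partial>UI) \<partial>M)"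
        using UM.Fubini[OF m] by simp
      also have "\<dots> = (\<integral>\<^sup>+z. indicator (C i) z * a i (cnj z) \<partial>M)"
        unfolding a_int by (intro nn_integral_cong nn_integral_cmult) measurable
      finally show ?thesis by (simp add: a_cnj)
    qed
    \<comment> \<open>\<open>a i\<close> is constant on circles, so averaging over rotations
      replaces the indicator by its mean \<open>a i\<close>.\<close>
    have key2: "(\<integral>\<^sup>+z. indicator (C i) z * a i z \<partial>M) = (\<integral>\<^sup>+z. a i z * a i z \<partial>M)" for i
    proof -
      have "(\<integral>\<^sup>+z. indicator (C i) z * a i z \<partial>M) =
          (\<integral>\<^sup>+z. (\<integral>\<^sup>+t. indicator (C i) (circ t * z) * a i (circ t * z) \<partial>UI) \<partial>M)"
        by (rule rotation_average) measurable
      also have "\<dots> = (\<integral>\<^sup>+z. (\<integral>\<^sup>+t. indicator (C i) (circ t * z) * a i z \<partial>UI) \<partial>M)"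
        by (simp add: a_rot)
      also have "\<dots> = (\<integral>\<^sup>+z. a i z * a i z \<partial>M)"
        by (intro nn_integral_cong, subst nn_integral_multc) (simp_all add: a_int)
      finally show ?thesis .
    qed
    have sq: "ennreal (1 / r) \<le> (\<Sum>i<r. a i z * a i z)" if z: "z \<in> Y" for z
    proof -
      define \<alpha> where "\<alpha> i = measure UI {t\<in>{0..<1}. circ t * z \<in> C i}" for i
      have a\<alpha>: "a i z = ennreal (\<alpha> i)" for i unfolding a_def \<alpha>_def by (rule U.emeasure_eq_measure)
      have ms: "{t\<in>{0..<1}. circ t * z \<in> C i} \<in> sets UI" for i
      proof -
        have "(\<lambda>t. circ t * z) \<in> borel_measurable UI" by measurable
        from measurable_sets[OF this Cb] show ?thesis
          by (simp add: space_restrict_space vimage_def Int_def conj_commute)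
      qed
      have "(\<Union>i<r. {t\<in>{0..<1}. circ t * z \<in> C i}) = space UI"
        using rotation_mem[OF z] colr by (auto simp: C_def space_restrict_space)
      then have "1 = measure UI (\<Union>i<r. {t\<in>{0..<1}. circ t * z \<in> C i})" using U.prob_space by (simp only:)
      also have "\<dots> = (\<Sum>i<r. \<alpha> i)"
        unfolding \<alpha>_def using ms
        by (intro U.finite_measure_finite_Union) (auto simp: disjoint_family_on_def C_def)
      finally have sum1: "(\<Sum>i<r. \<alpha> i) = 1" by simp
      \<comment> \<open>Cauchy-Schwarz for the vector \<open>\<alpha>\<close>, in the form of the
        sum of squared deviations from the mean \<open>1 / r\<close>.\<close>
      have "0 \<le> (\<Sum>i<r. (\<alpha> i - 1 / r)\<^sup>2)" by (intro sum_nonneg) auto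
      also have "\<dots> = (\<Sum>i<r. \<alpha> i * \<alpha> i - (2 / r) * \<alpha> i + 1 / r\<^sup>2)"
        by (intro sum.cong) (auto simp: power2_eq_square algebra_simps)
      also have "\<dots> = (\<Sum>i<r. \<alpha> i * \<alpha> i) - (2 / r) * (\<Sum>i<r. \<alpha> i) + r * (1 / r\<^sup>2)"
        by (simp add: sum.distrib sum_subtractf sum_distrib_left)
      also have "\<dots> = (\<Sum>i<r. \<alpha> i * \<alpha> i) - 1 / r"
        using r unfolding sum1 by (simp add: power2_eq_square)
      finally have "1 / r \<le> (\<Sum>i<r. \<alpha> i * \<alpha> i)" by simp
      then have "ennreal (1 / r) \<le> ennreal (\<Sum>i<r. \<alpha> i * \<alpha> i)" by (rule ennreal_leI)
      also have "\<dots> = (\<Sum>i<r. a i z * a i z)"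
        unfolding a\<alpha> by (subst sum_ennreal[symmetric]) (auto simp: \<alpha>_def ennreal_mult)
      finally show ?thesis .
    qed
    have "ennreal (1 / r) = (\<integral>\<^sup>+z. ennreal (1 / r) \<partial>M)" by (simp add: M.emeasure_space_1[simplified])
    also have "\<dots> \<le> (\<integral>\<^sup>+z. (\<Sum>i<r. a i z * a i z) \<partial>M)"
      using sq by (intro nn_integral_mono) auto
    also have "\<dots> = (\<Sum>i<r. (\<integral>\<^sup>+z. a i z * a i z \<partial>M))"
    proof (rule nn_integral_sum)
      fix i
      show "(\<lambda>z. a i z * a i z) \<in> borel_measurable M"
        by (rule measurable_normalized_lebesgue_borel) measurable
    qed
    also have "\<dots> = (\<Sum>i<r. (\<integral>\<^sup>+t. emeasure M (D i t) \<partial>UI))" by (simp only: key1 key2)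
    finally have avg: "ennreal (1 / r) \<le> (\<Sum>i<r. (\<integral>\<^sup>+t. emeasure M (D i t) \<partial>UI))" .
    have "\<exists>i<r. \<exists>t. measure M (D i t) \<ge> \<epsilon>"
    proof (rule ccontr)
      assume "\<not> ?thesis"
      then have "measure M (D i t) \<le> \<epsilon>" if "i < r" for i t using that by (meson less_imp_le not_le)
      then have "emeasure M (D i t) \<le> ennreal \<epsilon>" if "i < r" for i t
        using that by (simp add: M.emeasure_eq_measure ennreal_leI)
      then have "(\<integral>\<^sup>+t. emeasure M (D i t) \<partial>UI) \<le> (\<integral>\<^sup>+t. ennreal \<epsilon> \<partial>UI)" if "i < r" for i
        using that by (intro nn_integral_mono) auto
      then have "(\<integral>\<^sup>+t. emeasure M (D i t) \<partial>UI) \<le> ennreal \<epsilon>" if "i < r" for i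
        using that by (simp add: emeasure_UI_space)
      then have "(\<Sum>i<r. (\<integral>\<^sup>+t. emeasure M (D i t) \<partial>UI)) \<le> (\<Sum>i<r. ennreal \<epsilon>)" by (intro sum_mono) auto
      also have "\<dots> = ennreal (r * \<epsilon>)" using e0 by (simp add: ennreal_mult ennreal_of_nat_eq_real_of_nat)
      finally have "ennreal (1 / r) \<le> ennreal (r * \<epsilon>)" using avg by (rule order_trans[rotated])
      then have "1 / r \<le> r * \<epsilon>" using e0 by (simp add: ennreal_le_iff)
      moreover have "r * \<epsilon> < r * (1 / (real r)\<^sup>2)" using e r by (intro mult_strict_left_mono) auto
      ultimately show False using r by (simp add: power2_eq_square)
    qed
    then obtain i t where it: "i < r" "measure M (D i t) \<ge> \<epsilon>" by blast
    define s where "s z = circ t * cnj z" for z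
    have s: "s \<in> carrier (Iso Y)" unfolding s_def[abs_def] using rot by (intro reflection_IsoI) auto
    have ss: "s (s z) = z" for z
      by (simp add: s_def cis_cnj mult.assoc[symmetric] cis_mult)
    \<comment> \<open>A reflection that fixes \<open>1\<close> has \<open>circ t = 1\<close> and
      hence negates \<open>\<i>\<close>.\<close>
    have "s \<i> \<noteq> \<i> \<or> s 1 \<noteq> 1" by (auto simp: s_def)
    then have s1: "s \<noteq> id" by auto
    have Ds: "z \<in> D i t \<longleftrightarrow> z \<in> C i \<and> s z \<in> C i" for z by (auto simp: D_def s_def C_def)
    have sD: "s z \<in> D i t" if "z \<in> D i t" for z using that unfolding Ds ss by blast
    have "s ` D i t = D i t"
    proof
      show "D i t \<subseteq> s ` D i t" using sD ss by (metis image_eqI subsetI)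
    qed (use sD in auto)
    then show "\<exists>A \<in> sets M. (\<exists>c<r. \<forall>x\<in>A. col x = c) \<and> measure M A \<ge> \<epsilon> \<and>
          (\<exists>g \<in> carrier (Iso Y). g \<noteq> \<one>\<^bsub>Iso Y\<^esub> \<and> g ` A = A)"
      using it s s1 DM[of i t]
      by (intro bexI[of _ "D i t"] conjI exI[of _ i] bexI[of _ s]) (auto simp: D_def C_def Iso_def)
  qed
  show "\<epsilon> \<le> ms_set Y r"
  proof (cases "\<epsilon> \<ge> 0")
    case True
    then show ?thesis unfolding ms_set_def using adm r M.prob_space_axioms by (intro ms_ge) auto
  next
    case False
    have "0 \<le> ms_set Y r" unfolding ms_set_def using r M.prob_space_axioms by (intro ms_ge) auto
    then show ?thesis using False by simp
  qed
qed


text \<open>The colour depends on the angle only and repeats the lacunary colouring on every circle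
  around \<open>0\<close>. In an invariant set of colour \<open>i\<close>, each point and its image
  have colour \<open>i\<close>. For a reflection or a rotation far from the identity, such points
  make up at most \<open>1 / r\<^sup>2 + 2 * \<delta>\<close> of each circle, and averaging over
  rotations carries the bound to \<open>Y\<close>.\<close>

lemma ms_set_upper:
  assumes r: "r \<ge> 2"
  shows "ms_set Y r \<le> 1 / (real r)\<^sup>2"
  unfolding ms_set_def
proof (rule ms_le)
  fix \<epsilon> :: real assume e: "1 / (real r)\<^sup>2 < \<epsilon>"
  \<comment> \<open>The estimate on circles loses \<open>2 * \<delta>\<close>, which is half of the
    gap between \<open>\<epsilon>\<close> and \<open>1 / (real r)\<^sup>2\<close>.\<close>
  define \<delta> where "\<delta> = (\<epsilon> - 1 / (real r)\<^sup>2) / 4"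
  have "q + 2 * ((\<epsilon> - q) / 4) < \<epsilon>" if "q < \<epsilon>" for q using that by (simp add: field_simps)
  from this[OF e] have \<delta>: "\<delta> > 0" "1 / (real r)\<^sup>2 + 2 * \<delta> < \<epsilon>" using e by (simp_all only: \<delta>_def) simp
  obtain c :: "real \<Rightarrow> nat" where cm: "c \<in> measurable borel (count_space UNIV)" and cr: "\<And>x. c x < r"
    and c: "\<And>s t i. s = -1 \<or> s = 1 \<and> \<bar>t\<bar> \<ge> 1 / 4 \<Longrightarrow>
        measure lborel {x\<in>{0..<1}. s * x + t \<in> {0..<1} \<and> c x = i \<and> c (s * x + t) = i}
        \<le> measure lborel {x\<in>{0..<1}. s * x + t \<in> {0..<1}} / r\<^sup>2 + \<delta>"
    using lacunary_colouring[of r \<delta>] r \<delta>(1) by auto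
  define col where "col z = c (Arg2pi z / (2 * pi))" for z
  have "(\<lambda>z. Arg2pi z / (2 * pi)) \<in> borel_measurable borel" using Arg2pi_measurable by simp
  from measurable_compose[OF this cm] have colU: "col \<in> measurable borel (count_space UNIV)" by (simp add: col_def[abs_def])
  have colb: "col \<in> measurable borel (count_space {..<r})"
    using colU cr by (auto simp: measurable_def col_def)
  then have col: "col \<in> measurable M (count_space {..<r})"
    by (rule measurable_normalized_lebesgue_borel)
  have ci: "{z. col z = i} \<in> sets borel" for i using measurable_sets[OF colU, of "{i}"] by (simp add: vimage_def)
  have col_circ: "col (circ t * of_real \<rho>) = c (frac t)" if "\<rho> > 0" for t \<rho>
  proof -
    have "Arg2pi (circ (frac t) * of_real \<rho>) = 2 * pi * frac t"
      using that frac_lt_1[of t] by (intro Arg2pi_unique[of \<rho>]) (auto simp: cis_conv_exp mult.commute)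
    then show ?thesis unfolding circ_frac by (simp add: col_def)
  qed
  \<comment> \<open>\<open>s = 1\<close> stands for the rotation by \<open>\<tau>\<close> turns and
    \<open>s = -1\<close> for the reflection \<open>z \<mapsto> circ \<tau> * cnj z\<close>; in both
    cases angles are transformed by \<open>t \<mapsto> s * t + \<tau>\<close>.\<close>
  have bound: "measure M A \<le> 1 / (real r)\<^sup>2 + 2 * \<delta>"
    if A: "\<And>z. z \<in> A \<Longrightarrow> z \<in> Y \<and> col z = i \<and> col (g z) = i"
      and g: "g = (\<lambda>z. circ \<tau> * (if s = 1 then z else cnj z))"
      and st: "s = -1 \<and> 0 \<le> \<tau> \<and> \<tau> < 1 \<or> s = 1 \<and> 1 / 4 \<le> \<tau> \<and> \<tau> \<le> 3 / 4" for A g i and s \<tau> :: real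
  proof -
    define S where "S = {z\<in>Y. col z = i \<and> col (g z) = i}"
    have gm: "g \<in> borel_measurable borel"
      unfolding g by (cases "s = 1") (auto intro!: borel_measurable_continuous_onI continuous_intros)
    from measurable_sets[OF this ci[of i]] have "{z. col (g z) = i} \<in> sets borel" by (simp add: vimage_def)
    then have "Y \<inter> {z. col z = i} \<inter> {z. col (g z) = i} \<in> sets borel" using Yb ci by simp
    moreover have "S = Y \<inter> {z. col z = i} \<inter> {z. col (g z) = i}" by (auto simp: S_def)
    ultimately have Sb: "S \<in> sets borel" by simp
    then have SM: "S \<in> sets M" using Yb by (auto simp: sets_normalized_lebesgue S_def)
    define B where "B = 1 / (real r)\<^sup>2 + 2 * \<delta>"
    have inner: "emeasure UI {t\<in>{0..<1}. circ t * z \<in> S} \<le> ennreal B" if z: "z \<noteq> 0" for z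
    proof -
      define \<rho> where "\<rho> = norm z"
      have \<rho>: "\<rho> > 0" using z by (simp add: \<rho>_def)
      define u where "u = z / of_real \<rho>"
      have u: "norm u = 1" "z = u * of_real \<rho>" using \<rho> by (auto simp: u_def \<rho>_def norm_divide)
      have "emeasure UI {t\<in>{0..<1}. circ t * z \<in> S} = emeasure UI {t\<in>{0..<1}. circ t * of_real \<rho> \<in> S}"
        unfolding u(2) by (rule circle_average_rotation[OF Sb u(1)])
      also have "\<dots> = ennreal (measure lborel {t\<in>{0..<1}. circ t * of_real \<rho> \<in> S})" by (rule emeasure_UI)
      also have "\<dots> \<le> ennreal B"
      proof (rule ennreal_leI)
        let ?J = "{t\<in>{0..<1}. c t = i \<and> c (frac (s * t + \<tau>)) = i}" and ?T = "{t\<in>{0..<1}. circ t * of_real \<rho> \<in> S}"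
        have gz: "g (circ t * of_real \<rho>) = circ (s * t + \<tau>) * of_real \<rho>" for t
          using st by (auto simp: g cis_mult cis_cnj algebra_simps)
        have sub: "?T \<subseteq> ?J"
        proof safe
          fix t :: real assume t: "t \<in> {0..<1}" and S: "circ t * of_real \<rho> \<in> S"
          have "frac t = t" using t by (simp add: frac_eq)
          then show "c t = i" using S col_circ[OF \<rho>, of t] by (simp add: S_def)
          show "c (frac (s * t + \<tau>)) = i" using S col_circ[OF \<rho>, of "s * t + \<tau>"] by (simp add: S_def gz)
        qed
        have "(\<lambda>t. circ t * of_real \<rho>) \<in> borel_measurable borel"
          by (intro borel_measurable_continuous_onI continuous_intros)
        from measurable_sets[OF this Sb] have 1: "{t. circ t * of_real \<rho> \<in> S} \<in> sets borel" by (simp add: vimage_def)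
        have fr: "(\<lambda>t. frac (s * t + \<tau>)) \<in> borel_measurable borel" unfolding frac_def by measurable
        have c1: "{t. c t = i} \<in> sets borel" using measurable_sets[OF cm, of "{i}"] by (simp add: vimage_def)
        from measurable_sets[OF fr c1] have 2: "{t. c (frac (s * t + \<tau>)) = i} \<in> sets borel" by (simp add: vimage_def)
        have "measure lborel ?T \<le> measure lborel ?J"
        proof (rule measure_mono_fmeasurable[OF sub])
          have "?T = {0..<1} \<inter> {t. circ t * of_real \<rho> \<in> S}" by auto
          then show "?T \<in> sets lborel" using 1 by simp
          have "?J = {0..<1} \<inter> {t. c t = i} \<inter> {t. c (frac (s * t + \<tau>)) = i}" by auto
          then have "?J \<in> sets borel" using c1 2 by simp
          then show "?J \<in> fmeasurable lborel"
            by (intro fmeasurable_unit_subset) auto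
        qed
        also have "\<dots> \<le> 1 / r\<^sup>2 + 2 * \<delta>" using cm c \<delta> st by (intro joint_colour_bound) auto
        finally show "measure lborel ?T \<le> B" by (simp add: B_def)
      qed
      finally show ?thesis .
    qed
    \<comment> \<open>The circle estimate excludes the origin, where the circle degenerates; it is a
      null set.\<close>
    have nz: "AE z in M. z \<noteq> 0"
    proof (rule AE_I'[of "Y \<inter> {0}"])
      have "Y \<inter> {0} \<in> sets M" using Yb by (auto simp: sets_normalized_lebesgue)
      moreover from this have "measure M (Y \<inter> {0}) = 0"
        by (rule measure_negligible_subset[OF Yb, of _ "{0}"]) auto
      ultimately show "Y \<inter> {0} \<in> null_sets M" by (simp add: null_sets_def M.emeasure_eq_measure)
    qed auto
    have "emeasure M S = (\<integral>\<^sup>+z. indicator S z \<partial>M)" using SM by simp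
    also have "\<dots> = (\<integral>\<^sup>+z. (\<integral>\<^sup>+t. indicator S (circ t * z) \<partial>UI) \<partial>M)"
      using Sb by (intro rotation_average) simp
    also have "\<dots> = (\<integral>\<^sup>+z. emeasure UI {t\<in>{0..<1}. circ t * z \<in> S} \<partial>M)"
      by (simp only: nn_integral_circ_indicator[OF Sb])
    also have "\<dots> \<le> (\<integral>\<^sup>+z. ennreal B \<partial>M)"
      using nz inner by (intro nn_integral_mono_AE) (auto elim: eventually_mono)
    also have "\<dots> = ennreal B" by (simp add: M.emeasure_space_1[simplified])
    finally have "ennreal (measure M S) \<le> ennreal B" by (simp add: M.emeasure_eq_measure)
    then have "measure M S \<le> B" using \<delta> by (subst (asm) ennreal_le_iff) (auto simp: B_def)
    moreover have "measure M A \<le> measure M S"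
      using A SM by (intro M.finite_measure_mono) (auto simp: S_def)
    ultimately show ?thesis by (simp add: B_def)
  qed
  show "\<not> admissible M (Iso Y) (\<lambda>f x. f x) r \<epsilon>"
  proof
    assume "admissible M (Iso Y) (\<lambda>f x. f x) r \<epsilon>"
    from this[unfolded admissible_def, rule_format, OF col] obtain A i f where
      A: "A \<in> sets M" "\<forall>x\<in>A. col x = i" "measure M A \<ge> \<epsilon>" "f \<in> carrier (Iso Y)" "f \<noteq> id" "f ` A = A"
      by (auto simp: Iso_def)
    have AY: "A \<subseteq> Y" using A(1) Yb by (simp add: sets_normalized_lebesgue)
    have fA: "f z \<in> A" if "z \<in> A" for z using A(6) that by blast
    have contr: False if g: "g = (\<lambda>z. circ \<tau> * (if s = 1 then z else cnj z))"
      and st: "s = -1 \<and> 0 \<le> \<tau> \<and> \<tau> < 1 \<or> s = 1 \<and> 1 / 4 \<le> \<tau> \<and> \<tau> \<le> 3 / 4"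
      and gA: "\<And>z. z \<in> A \<Longrightarrow> g z \<in> A" for g and s \<tau> :: real
    proof -
      have "measure M A \<le> 1 / (real r)\<^sup>2 + 2 * \<delta>"
        using A(2) gA AY by (intro bound[OF _ g st]) auto
      then show False using A(3) \<delta>(2) by simp
    qed
    from A(4) fix0[OF A(4)] show False
    proof (cases rule: Iso_complex_cases)
      case (1 u)
      then have "u \<noteq> 1" using A(5) by auto
      with 1(1) obtain k :: nat and \<tau> where k: "1 / 4 \<le> \<tau>" "\<tau> \<le> 3 / 4" "u ^ k = circ \<tau>"
        by (rule rotation_power_far)
      \<comment> \<open>\<open>A\<close> is invariant under the powers of \<open>f\<close>, so
        \<open>f\<close> may be replaced by a power whose angle is far from
        \<open>0\<close>.\<close>
      have "u ^ k * z \<in> A" if "z \<in> A" for z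
        by (induction k) (use that fA 1(2) in \<open>auto simp: mult.assoc\<close>)
      then show False using contr[of "\<lambda>z. circ \<tau> * z" \<tau> 1] k by auto
    next
      case (2 u)
      obtain \<tau> where \<tau>: "\<tau> \<in> {0..<1}" "u = circ \<tau>" using circ_surj[OF 2(1)] .
      show False using contr[of f \<tau> "-1"] 2(2) \<tau> fA by auto
    qed
  qed
qed simp

end

theorem theorem7p3:
  fixes X :: "(real ^ 2) set" and r :: nat
  assumes "compact X" and "measure lborel X > 0" and "r \<ge> 2"
  shows "(infinite (carrier (Iso X)) \<longrightarrow> ms_set X r = 1 / (real r)\<^sup>2) \<and>
         (\<forall>n\<ge>2. Iso X \<cong> dihedral_group n \<longrightarrow> ms_set X r = ms_group_interval (dihedral_group n) r) \<and>
         (finite (carrier (Iso X)) \<and> \<not> (\<exists>n\<ge>2. Iso X \<cong> dihedral_group n) \<longrightarrow> ms_set X r = 0)"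
proof -
  obtain Y :: "complex set" where Y: "compact Y" "measure lborel Y > 0" and iso: "Iso X \<cong> Iso Y"
    and fix0: "\<And>f. f \<in> carrier (Iso Y) \<Longrightarrow> f 0 = 0" and ms: "\<And>r. ms_set X r = ms_set Y r"
    using reduction_to_complex[OF assms(1,2)] by blast
  have fin: "finite (carrier (Iso X)) \<longleftrightarrow> finite (carrier (Iso Y))"
    using iso bij_betw_finite by (auto simp: is_iso_def iso_def)
  have iso': "Iso Y \<cong> Iso X" using group.iso_sym[OF group_Iso iso] .
  have dih: "Iso X \<cong> dihedral_group n \<longleftrightarrow> Iso Y \<cong> dihedral_group n" for n
    using iso_trans[OF iso] iso_trans[OF iso'] by blast
  show ?thesis
    unfolding ms fin dih
  proof (intro conjI impI allI)
    assume inf: "infinite (carrier (Iso Y))"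
    interpret rotation_symmetric Y
      by unfold_locales (use Y fix0 infinite_Iso_rotations[OF Y(1) inf] in auto)
    show "ms_set Y r = 1 / (real r)\<^sup>2" using ms_set_ge ms_set_upper assms(3) by (intro antisym)
  next
    fix n :: nat assume n: "2 \<le> n" and "Iso Y \<cong> dihedral_group n"
    then obtain \<psi> where \<psi>: "\<psi> \<in> iso (Iso Y) (dihedral_group n)" by (auto simp: is_iso_def)
    have "finite (carrier (dihedral_group n))" by (simp add: dihedral_group_def)
    then have "finite (carrier (Iso Y))" using \<psi> bij_betw_finite by (auto simp: iso_def)
    then interpret finite_symmetry Y "dihedral_group n" \<psi>
      using Y fix0 \<psi> group_dihedral_group[of n] n by (intro finite_symmetry.intro) auto
    show "ms_set Y r = ms_group_interval (dihedral_group n) r" by (rule ms_set_eq_group_interval)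
  next
    assume "finite (carrier (Iso Y)) \<and> \<not> (\<exists>n\<ge>2. Iso Y \<cong> dihedral_group n)"
    then show "ms_set Y r = 0" using Y assms(3) fix0 by (intro ms_set_not_dihedral) auto
  qed
qed

end
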